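(* Given a topological monoid $(M,\tau)$, the category $\underline{\mathcal{R}}_\tau$ is equivalent to the category $\mathcal{C}_s$ of supercompact objects in $\mathrm{Cont}(M,\tau)$. In particular, another topological monoid $(M',\tau')$ is Morita equivalent to $(M,\tau)$ (i.e. $\mathrm{Cont}(M,\tau)\simeq\mathrm{Cont}(M',\tau')$) if and only if $\underline{\mathcal{R}}_\tau\simeq\underline{\mathcal{R}}_{\tau'}$.
   Context: An $(M,\tau)$-set is a right $M$-set $X$ whose action $X\times M\to X$ is continuous when $X$ is given the discrete topology; $\mathrm{Cont}(M,\tau)$ is the category of $(M,\tau)$-sets and equivariant maps. An object $C$ is supercompact if every jointly epic family $\{A_i\to C\}$ contains an epimorphism. A right congruence on $M$ is an equivalence relation $r\subseteq M\times M$ with $(p,q)\in r\Rightarrow(pm,qm)\in r$ for all $m\in M$; $m^*(r)=\{(x,y)\mid(mx,my)\in r\}$. $\underline{\mathcal{R}}_\tau$ is the small category whose objects are the right congruences $r$ on $M$ such that the right $M$-set $M/r$ is an $(M,\tau)$-set, and whose morphisms $r_1\to r_2$ are the equivalence classes $[m]$ of $r_2$ such that $r_1\subseteq m^*(r_2)$, with composition induced by multiplication in $M$. *)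

theory Defs
  imports "HOL-Analysis.Analysis"
begin

text \<open>The hom-sets need not be disjoint, so composition also receives the three objects involved:
  \<open>Comp C X Y Z g f\<close> is \<open>g\<close> after \<open>f\<close>, for \<open>f\<close> from \<open>X\<close> to \<open>Y\<close> and \<open>g\<close> from \<open>Y\<close> to \<open>Z\<close>.\<close>

record ('o, 'a) cat =
  Obj :: "'o set"
  Hom :: "'o \<Rightarrow> 'o \<Rightarrow> 'a set"
  Ident :: "'o \<Rightarrow> 'a"
  Comp :: "'o \<Rightarrow> 'o \<Rightarrow> 'o \<Rightarrow> 'a \<Rightarrow> 'a \<Rightarrow> 'a"

definition category :: "('o, 'a) cat \<Rightarrow> bool" where
  "category C \<longleftrightarrow>
    (\<forall>X\<in>Obj C. Ident C X \<in> Hom C X X) \<and>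
    (\<forall>X\<in>Obj C. \<forall>Y\<in>Obj C. \<forall>Z\<in>Obj C. \<forall>f\<in>Hom C X Y. \<forall>g\<in>Hom C Y Z.
      Comp C X Y Z g f \<in> Hom C X Z) \<and>
    (\<forall>X\<in>Obj C. \<forall>Y\<in>Obj C. \<forall>f\<in>Hom C X Y.
      Comp C X X Y f (Ident C X) = f \<and> Comp C X Y Y (Ident C Y) f = f) \<and>
    (\<forall>W\<in>Obj C. \<forall>X\<in>Obj C. \<forall>Y\<in>Obj C. \<forall>Z\<in>Obj C.
      \<forall>f\<in>Hom C W X. \<forall>g\<in>Hom C X Y. \<forall>h\<in>Hom C Y Z.
      Comp C W Y Z h (Comp C W X Y g f) = Comp C W X Z (Comp C X Y Z h g) f)"

definition full_subcategory :: "('o, 'a) cat \<Rightarrow> 'o set \<Rightarrow> ('o, 'a) cat" where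
  "full_subcategory C S = C\<lparr>Obj := Obj C \<inter> S\<rparr>"

definition iso_arrow :: "('o, 'a) cat \<Rightarrow> 'o \<Rightarrow> 'o \<Rightarrow> 'a \<Rightarrow> bool" where
  "iso_arrow C X Y f \<longleftrightarrow> f \<in> Hom C X Y \<and>
    (\<exists>g\<in>Hom C Y X. Comp C X Y X g f = Ident C X \<and> Comp C Y X Y f g = Ident C Y)"

record ('o, 'a, 'p, 'b) cat_map =
  omap :: "'o \<Rightarrow> 'p"
  amap :: "'o \<Rightarrow> 'o \<Rightarrow> 'a \<Rightarrow> 'b"

definition is_functor ::
    "('o, 'a) cat \<Rightarrow> ('p, 'b) cat \<Rightarrow> ('o, 'a, 'p, 'b) cat_map \<Rightarrow> bool" where
  "is_functor C D F \<longleftrightarrow>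
    (\<forall>X\<in>Obj C. omap F X \<in> Obj D) \<and>
    (\<forall>X\<in>Obj C. \<forall>Y\<in>Obj C. \<forall>f\<in>Hom C X Y. amap F X Y f \<in> Hom D (omap F X) (omap F Y)) \<and>
    (\<forall>X\<in>Obj C. amap F X X (Ident C X) = Ident D (omap F X)) \<and>
    (\<forall>X\<in>Obj C. \<forall>Y\<in>Obj C. \<forall>Z\<in>Obj C. \<forall>f\<in>Hom C X Y. \<forall>g\<in>Hom C Y Z.
      amap F X Z (Comp C X Y Z g f) =
      Comp D (omap F X) (omap F Y) (omap F Z) (amap F Y Z g) (amap F X Y f))"

definition id_map :: "('o, 'a, 'o, 'a) cat_map" where
  "id_map = \<lparr>omap = (\<lambda>X. X), amap = (\<lambda>X Y f. f)\<rparr>"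

definition comp_map ::
    "('p, 'b, 'q, 'c) cat_map \<Rightarrow> ('o, 'a, 'p, 'b) cat_map \<Rightarrow> ('o, 'a, 'q, 'c) cat_map" where
  "comp_map G F = \<lparr>omap = (\<lambda>X. omap G (omap F X)),
    amap = (\<lambda>X Y f. amap G (omap F X) (omap F Y) (amap F X Y f))\<rparr>"

definition natural_iso ::
    "('o, 'a) cat \<Rightarrow> ('p, 'b) cat \<Rightarrow> ('o, 'a, 'p, 'b) cat_map \<Rightarrow> ('o, 'a, 'p, 'b) cat_map
      \<Rightarrow> ('o \<Rightarrow> 'b) \<Rightarrow> bool" where
  "natural_iso C D F G \<eta> \<longleftrightarrow>
    (\<forall>X\<in>Obj C. iso_arrow D (omap F X) (omap G X) (\<eta> X)) \<and>
    (\<forall>X\<in>Obj C. \<forall>Y\<in>Obj C. \<forall>f\<in>Hom C X Y.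
      Comp D (omap F X) (omap F Y) (omap G Y) (\<eta> Y) (amap F X Y f) =
      Comp D (omap F X) (omap G X) (omap G Y) (amap G X Y f) (\<eta> X))"

definition equivalent_cats :: "('o, 'a) cat \<Rightarrow> ('p, 'b) cat \<Rightarrow> bool" (infix "\<simeq>\<^sub>c" 50) where
  "C \<simeq>\<^sub>c D \<longleftrightarrow> category C \<and> category D \<and>
    (\<exists>F G \<eta> \<epsilon>. is_functor C D F \<and> is_functor D C G \<and>
      natural_iso C C id_map (comp_map G F) \<eta> \<and>
      natural_iso D D (comp_map F G) id_map \<epsilon>)"

definition epi_arrow :: "('o, 'a) cat \<Rightarrow> 'o \<Rightarrow> 'o \<Rightarrow> 'a \<Rightarrow> bool" where
  "epi_arrow C X Y f \<longleftrightarrow> f \<in> Hom C X Y \<and>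
    (\<forall>Z\<in>Obj C. \<forall>g\<in>Hom C Y Z. \<forall>h\<in>Hom C Y Z.
      Comp C X Y Z g f = Comp C X Y Z h f \<longrightarrow> g = h)"

text \<open>A family of arrows with codomain \<open>Y\<close> is given by the set of its members \<open>(A, f)\<close>;
  the empty family is allowed.\<close>

definition sink :: "('o, 'a) cat \<Rightarrow> 'o \<Rightarrow> ('o \<times> 'a) set \<Rightarrow> bool" where
  "sink C Y S \<longleftrightarrow> (\<forall>(A, f)\<in>S. A \<in> Obj C \<and> f \<in> Hom C A Y)"

definition jointly_epic :: "('o, 'a) cat \<Rightarrow> 'o \<Rightarrow> ('o \<times> 'a) set \<Rightarrow> bool" where
  "jointly_epic C Y S \<longleftrightarrow>
    (\<forall>Z\<in>Obj C. \<forall>g\<in>Hom C Y Z. \<forall>h\<in>Hom C Y Z.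
      (\<forall>(A, f)\<in>S. Comp C A Y Z g f = Comp C A Y Z h f) \<longrightarrow> g = h)"

definition supercompact :: "('o, 'a) cat \<Rightarrow> 'o \<Rightarrow> bool" where
  "supercompact C Y \<longleftrightarrow> Y \<in> Obj C \<and>
    (\<forall>S. sink C Y S \<and> jointly_epic C Y S \<longrightarrow> (\<exists>(A, f)\<in>S. epi_arrow C A Y f))"

definition supercompact_objects :: "('o, 'a) cat \<Rightarrow> ('o, 'a) cat" where
  "supercompact_objects C = full_subcategory C {Y. supercompact C Y}"

record ('u, 'm) mset =
  pts :: "'u set"
  act :: "'u \<Rightarrow> 'm \<Rightarrow> 'u"

text \<open>The action is required to be extensional, so that an object is determined by its
  underlying set and the action on that set.\<close>

definition right_mset :: "('u, 'm::monoid_mult) mset \<Rightarrow> bool" where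
  "right_mset X \<longleftrightarrow>
    act X \<in> pts X \<rightarrow>\<^sub>E (UNIV \<rightarrow> pts X) \<and>
    (\<forall>x\<in>pts X. act X x 1 = x) \<and>
    (\<forall>x\<in>pts X. \<forall>m n. act X (act X x m) n = act X x (m * n))"

definition continuous_mset :: "('u, 'm::topological_monoid_mult) mset \<Rightarrow> bool" where
  "continuous_mset X \<longleftrightarrow> right_mset X \<and>
    continuous_map (prod_topology (discrete_topology (pts X)) euclidean)
      (discrete_topology (pts X)) (\<lambda>(x, m). act X x m)"

definition equivariant_maps ::
    "('u, 'm) mset \<Rightarrow> ('u, 'm) mset \<Rightarrow> ('u \<Rightarrow> 'u) set" where
  "equivariant_maps X Y =
    {f \<in> pts X \<rightarrow>\<^sub>E pts Y. \<forall>x\<in>pts X. \<forall>m. f (act X x m) = act Y (f x) m}"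

text \<open>HOL has no type of all sets. The category of sets over which continuous actions are
  formed is therefore a parameter: a collection \<open>\<U>\<close> of sets over an arbitrary type that is closed
  under passing to sets of at most the same cardinality and that contains an infinite set.
  The sets in a Grothendieck universe having an infinite element, and the sets of cardinality
  at most a given infinite cardinal, are both instances.\<close>

definition set_universe :: "'u set set \<Rightarrow> bool" where
  "set_universe \<U> \<longleftrightarrow> (\<forall>X\<in>\<U>. \<forall>Y. Y \<lesssim> X \<longrightarrow> Y \<in> \<U>) \<and> (\<exists>X\<in>\<U>. infinite X)"

definition small :: "'u set set \<Rightarrow> 'b set \<Rightarrow> bool" where
  "small \<U> A \<longleftrightarrow> (\<exists>X\<in>\<U>. A \<lesssim> X)"

definition Cont ::
    "'u set set \<Rightarrow> 'm itself \<Rightarrow> (('u, 'm::topological_monoid_mult) mset, 'u \<Rightarrow> 'u) cat" where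
  "Cont \<U> M = \<lparr>Obj = {X. pts X \<in> \<U> \<and> continuous_mset X},
    Hom = equivariant_maps,
    Ident = (\<lambda>X. restrict (\<lambda>x. x) (pts X)),
    Comp = (\<lambda>X Y Z g f. compose (pts X) g f)\<rparr>"

definition right_congruence :: "('m::monoid_mult) rel \<Rightarrow> bool" where
  "right_congruence r \<longleftrightarrow> equiv UNIV r \<and> (\<forall>p q m. (p, q) \<in> r \<longrightarrow> (p * m, q * m) \<in> r)"

definition pullback_rel :: "'m::monoid_mult \<Rightarrow> 'm rel \<Rightarrow> 'm rel" where
  "pullback_rel m r = {(x, y). (m * x, m * y) \<in> r}"

text \<open>The right action of \<open>m\<close> on \<open>UNIV // r\<close> sends the class of \<open>p\<close> to the class of \<open>p * m\<close>.\<close>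

definition quotient_mset :: "('m::monoid_mult) rel \<Rightarrow> ('m set, 'm) mset" where
  "quotient_mset r = \<lparr>pts = UNIV // r,
    act = (\<lambda>c\<in>UNIV // r. \<lambda>m. \<Union>p\<in>c. r `` {p * m})\<rparr>"

text \<open>For \<open>[m]\<close> from \<open>r\<^sub>1\<close> to \<open>r\<^sub>2\<close> and \<open>[n]\<close> from \<open>r\<^sub>2\<close> to \<open>r\<^sub>3\<close>, the composite is \<open>[n * m]\<close>: these
  classes stand for the maps from \<open>M/r\<^sub>1\<close> to \<open>M/r\<^sub>2\<close> and from \<open>M/r\<^sub>2\<close> to \<open>M/r\<^sub>3\<close> that multiply
  representatives on the left by \<open>m\<close> and \<open>n\<close>. The unions are unions of a single class.\<close>

definition RCong :: "'m itself \<Rightarrow> ('m::topological_monoid_mult rel, 'm set) cat" where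
  "RCong M = \<lparr>Obj = {r. right_congruence r \<and> continuous_mset (quotient_mset r)},
    Hom = (\<lambda>r\<^sub>1 r\<^sub>2. {r\<^sub>2 `` {m} | m. r\<^sub>1 \<subseteq> pullback_rel m r\<^sub>2}),
    Ident = (\<lambda>r. r `` {1}),
    Comp = (\<lambda>r\<^sub>1 r\<^sub>2 r\<^sub>3 d c. \<Union>m\<in>c. \<Union>n\<in>d. r\<^sub>3 `` {n * m})\<rparr>"

end

theory Submission
  imports Defs
begin

text \<open>An object of \<open>Cont(M, \<tau>)\<close> is supercompact iff it is cyclic: a jointly epic family is jointly
  surjective (collapse the union of the images to a point), and every object is the union of its
  cyclic subobjects. Cyclic objects are the quotients \<open>M/r\<close>, and a map from \<open>M/r\<close> to \<open>X\<close> is a point of \<open>X\<close>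
  on which \<open>r\<close>-related elements act equally; this gives the first equivalence.

  Supercompactness is invariant under equivalence, so \<open>Cont\<close> determines the category of congruences.
  Conversely, \<open>X\<close> is determined by the functor sending \<open>r\<close> to the set of maps from \<open>M/r\<close> to \<open>X\<close>. Precomposed
  with an equivalence of the categories of congruences, this functor is again a sheaf for the covers
  \<open>M/r \<rightarrow> M/s\<close>, and a sheaf \<open>P\<close> is realized by the set of all pairs \<open>(r, x)\<close> such that \<open>x \<in> P r\<close> does
  not descend to a congruence larger than \<open>r\<close>: in the resulting action, \<open>r\<close> is the stabilizer of \<open>(r, x)\<close>.\<close>

section \<open>Categories and equivalences\<close>

text \<open>The obstacle in the converse is that an equivalence \<open>H\<close> between categories
  of congruences need not respect inclusions: the morphism \<open>[1]\<close> given by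
  \<open>r \<subseteq> s\<close> goes to some \<open>[k]\<close>. Since \<open>[1]\<close> is an
  epimorphism, so is \<open>[k]\<close>, and epimorphisms of congruences are onto; an element
  \<open>j\<close> with \<open>k * j\<close> related to \<open>1\<close> then supplies the
  amalgamation. Being a cover is thus a property of the category alone. Likewise, two elements
  \<open>p\<close>, \<open>q\<close> of the target monoid need not come from morphisms in the image
  of \<open>H\<close>; they do so only after composition with an isomorphism, because
  \<open>H\<close> is merely essentially surjective.

  The realization must also fit into the universe \<U>, although congruences may be as numerous as
  sets of pairs. It does, because in a point \<open>(r, x)\<close> the element \<open>x\<close>
  determines \<open>r\<close> up to isomorphism, and isomorphic congruences are pullbacks of each
  other along a single element. Smallness of the monoids enters here and in placing
  \<open>M/r\<close> inside the universe.\<close>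

lemma
  assumes "category C"
  shows ident_in_hom: "X \<in> Obj C \<Longrightarrow> Ident C X \<in> Hom C X X"
    and comp_in_hom: "\<lbrakk>X \<in> Obj C; Y \<in> Obj C; Z \<in> Obj C; f \<in> Hom C X Y; g \<in> Hom C Y Z\<rbrakk>
      \<Longrightarrow> Comp C X Y Z g f \<in> Hom C X Z"
    and comp_ident_right: "\<lbrakk>X \<in> Obj C; Y \<in> Obj C; f \<in> Hom C X Y\<rbrakk> \<Longrightarrow> Comp C X X Y f (Ident C X) = f"
    and comp_ident_left: "\<lbrakk>X \<in> Obj C; Y \<in> Obj C; f \<in> Hom C X Y\<rbrakk> \<Longrightarrow> Comp C X Y Y (Ident C Y) f = f"
    and comp_assoc: "\<lbrakk>W \<in> Obj C; X \<in> Obj C; Y \<in> Obj C; Z \<in> Obj C;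
        f \<in> Hom C W X; g \<in> Hom C X Y; h \<in> Hom C Y Z\<rbrakk>
      \<Longrightarrow> Comp C W X Z (Comp C X Y Z h g) f = Comp C W Y Z h (Comp C W X Y g f)"
  using assms unfolding category_def by simp_all

lemma
  assumes "is_functor C D F"
  shows functor_obj: "X \<in> Obj C \<Longrightarrow> omap F X \<in> Obj D"
    and functor_hom: "\<lbrakk>X \<in> Obj C; Y \<in> Obj C; f \<in> Hom C X Y\<rbrakk>
      \<Longrightarrow> amap F X Y f \<in> Hom D (omap F X) (omap F Y)"
    and functor_ident: "X \<in> Obj C \<Longrightarrow> amap F X X (Ident C X) = Ident D (omap F X)"
    and functor_comp: "\<lbrakk>X \<in> Obj C; Y \<in> Obj C; Z \<in> Obj C; f \<in> Hom C X Y; g \<in> Hom C Y Z\<rbrakk>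
      \<Longrightarrow> amap F X Z (Comp C X Y Z g f) =
        Comp D (omap F X) (omap F Y) (omap F Z) (amap F Y Z g) (amap F X Y f)"
  using assms unfolding is_functor_def by simp_all

lemma comp_map_simps [simp]:
  "omap (comp_map G F) X = omap G (omap F X)"
  "amap (comp_map G F) X Y f = amap G (omap F X) (omap F Y) (amap F X Y f)"
  "omap id_map X = X" "amap id_map X Y g = g"
  by (simp_all add: comp_map_def id_map_def)

lemma is_functor_comp_map:
  assumes "is_functor C D F" "is_functor D E G"
  shows "is_functor C E (comp_map G F)"
  using assms unfolding is_functor_def comp_map_simps by simp

section \<open>Isomorphisms and natural isomorphisms\<close>

lemma iso_arrow_in_hom: "iso_arrow C X Y f \<Longrightarrow> f \<in> Hom C X Y"
  by (simp add: iso_arrow_def)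

lemma iso_arrowE:
  assumes "iso_arrow C X Y f"
  obtains g where "g \<in> Hom C Y X" "iso_arrow C Y X g"
    "Comp C X Y X g f = Ident C X" "Comp C Y X Y f g = Ident C Y"
  using assms unfolding iso_arrow_def by blast

lemma iso_arrow_comp:
  assumes C: "category C" and o: "X \<in> Obj C" "Y \<in> Obj C" "Z \<in> Obj C"
    and f: "iso_arrow C X Y f" and g: "iso_arrow C Y Z g"
  shows "iso_arrow C X Z (Comp C X Y Z g f)"
proof -
  note h = iso_arrow_in_hom[OF f] iso_arrow_in_hom[OF g]
  obtain f' where f': "f' \<in> Hom C Y X" "Comp C X Y X f' f = Ident C X" "Comp C Y X Y f f' = Ident C Y"
    using f by (rule iso_arrowE)
  obtain g' where g': "g' \<in> Hom C Z Y" "Comp C Y Z Y g' g = Ident C Y" "Comp C Z Y Z g g' = Ident C Z"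
    using g by (rule iso_arrowE)
  note c = comp_in_hom[OF C] comp_ident_left[OF C]
  have "Comp C X Z X (Comp C Z Y X f' g') (Comp C X Y Z g f)
      = Comp C X Y X f' (Comp C X Z Y g' (Comp C X Y Z g f))"
    using o h f' g' by (simp add: comp_assoc[OF C] c(1))
  also have "\<dots> = Comp C X Y X f' (Comp C X Y Y (Comp C Y Z Y g' g) f)"
    using comp_assoc[OF C o(1,2,3,2) h g'(1)] by simp
  finally have l: "Comp C X Z X (Comp C Z Y X f' g') (Comp C X Y Z g f) = Ident C X"
    using o h f' g' by (simp add: c)
  have "Comp C Z X Z (Comp C X Y Z g f) (Comp C Z Y X f' g')
      = Comp C Z Y Z g (Comp C Z X Y f (Comp C Z Y X f' g'))"
    using o h f' g' by (simp add: comp_assoc[OF C] c(1))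
  also have "\<dots> = Comp C Z Y Z g (Comp C Z Y Y (Comp C Y X Y f f') g')"
    using comp_assoc[OF C o(3,2,1,2) g'(1) f'(1) h(1)] by simp
  finally have "Comp C Z X Z (Comp C X Y Z g f) (Comp C Z Y X f' g') = Ident C Z"
    using o h f' g' by (simp add: c)
  with l show ?thesis
    unfolding iso_arrow_def using o h f' g' by (auto simp: c intro!: bexI[of _ "Comp C Z Y X f' g'"])
qed

lemma iso_cancel_right:
  assumes C: "category C" and o: "X \<in> Obj C" "Y \<in> Obj C" "Z \<in> Obj C"
    and u: "iso_arrow C X Y u" and gh: "g \<in> Hom C Y Z" "h \<in> Hom C Y Z"
    and eq: "Comp C X Y Z g u = Comp C X Y Z h u"
  shows "g = h"
proof -
  obtain v where v: "v \<in> Hom C Y X" "Comp C Y X Y u v = Ident C Y" using u by (rule iso_arrowE)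
  note h = iso_arrow_in_hom[OF u]
  have "g = Comp C Y X Z (Comp C X Y Z g u) v" if "g \<in> Hom C Y Z" for g
    using that o h v by (simp add: comp_assoc[OF C] comp_ident_right[OF C])
  then show ?thesis using gh eq by metis
qed

lemma iso_cancel_left:
  assumes C: "category C" and o: "X \<in> Obj C" "Y \<in> Obj C" "W \<in> Obj C"
    and u: "iso_arrow C X Y u" and gh: "g \<in> Hom C W X" "h \<in> Hom C W X"
    and eq: "Comp C W X Y u g = Comp C W X Y u h"
  shows "g = h"
proof -
  obtain v where v: "v \<in> Hom C Y X" "Comp C X Y X v u = Ident C X" using u by (rule iso_arrowE)
  note h = iso_arrow_in_hom[OF u]
  have "g = Comp C W Y X v (Comp C W X Y u g)" if "g \<in> Hom C W X" for g
    using that o h v by (simp add: comp_assoc[OF C, symmetric] comp_ident_left[OF C])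
  then show ?thesis using gh eq by metis
qed

lemma natural_isoD:
  assumes "natural_iso C D F G \<eta>"
  shows "X \<in> Obj C \<Longrightarrow> iso_arrow D (omap F X) (omap G X) (\<eta> X)"
    and "\<lbrakk>X \<in> Obj C; Y \<in> Obj C; f \<in> Hom C X Y\<rbrakk> \<Longrightarrow>
      Comp D (omap F X) (omap F Y) (omap G Y) (\<eta> Y) (amap F X Y f) =
      Comp D (omap F X) (omap G X) (omap G Y) (amap G X Y f) (\<eta> X)"
  using assms unfolding natural_iso_def by blast+

text \<open>The pointwise inverses are natural: after composition with \<open>\<eta> Y\<close> both
  sides of the required square become \<open>amap G X Y f\<close>, and the invertible
  \<open>\<eta> Y\<close> can be cancelled.\<close>

lemma natural_iso_inverse:
  assumes D: "category D" and F: "is_functor C D F" and G: "is_functor C D G"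
    and \<eta>: "natural_iso C D F G \<eta>"
  obtains \<theta> where "natural_iso C D G F \<theta>"
proof -
  have "\<exists>g. iso_arrow D (omap G X) (omap F X) g
      \<and> Comp D (omap G X) (omap F X) (omap G X) (\<eta> X) g = Ident D (omap G X)
      \<and> Comp D (omap F X) (omap G X) (omap F X) g (\<eta> X) = Ident D (omap F X)" if "X \<in> Obj C" for X
    using natural_isoD(1)[OF \<eta> that] by (metis iso_arrowE)
  then obtain \<theta> where \<theta>: "\<And>X. X \<in> Obj C \<Longrightarrow> iso_arrow D (omap G X) (omap F X) (\<theta> X)"
      "\<And>X. X \<in> Obj C \<Longrightarrow> Comp D (omap G X) (omap F X) (omap G X) (\<eta> X) (\<theta> X) = Ident D (omap G X)"
    by metis
  have "Comp D (omap G X) (omap G Y) (omap F Y) (\<theta> Y) (amap G X Y f) =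
      Comp D (omap G X) (omap F X) (omap F Y) (amap F X Y f) (\<theta> X)"
    if o: "X \<in> Obj C" "Y \<in> Obj C" and f: "f \<in> Hom C X Y" for X Y f
  proof -
    note oD = functor_obj[OF F o(1)] functor_obj[OF F o(2)] functor_obj[OF G o(1)] functor_obj[OF G o(2)]
    note hs = functor_hom[OF F o f] functor_hom[OF G o f] iso_arrow_in_hom[OF \<theta>(1)[OF o(1)]]
      iso_arrow_in_hom[OF \<theta>(1)[OF o(2)]] iso_arrow_in_hom[OF natural_isoD(1)[OF \<eta> o(1)]]
      iso_arrow_in_hom[OF natural_isoD(1)[OF \<eta> o(2)]]
    have l: "Comp D (omap G X) (omap F Y) (omap G Y) (\<eta> Y)
        (Comp D (omap G X) (omap G Y) (omap F Y) (\<theta> Y) (amap G X Y f)) = amap G X Y f"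
      using oD hs \<theta>(2)[OF o(2)] by (simp add: comp_assoc[OF D, symmetric] comp_ident_left[OF D])
    have "Comp D (omap G X) (omap F Y) (omap G Y) (\<eta> Y)
        (Comp D (omap G X) (omap F X) (omap F Y) (amap F X Y f) (\<theta> X)) =
        Comp D (omap G X) (omap F X) (omap G Y)
        (Comp D (omap F X) (omap G X) (omap G Y) (amap G X Y f) (\<eta> X)) (\<theta> X)"
      using oD hs natural_isoD(2)[OF \<eta> o f] by (simp add: comp_assoc[OF D, symmetric])
    also have "\<dots> = amap G X Y f"
      using oD hs \<theta>(2)[OF o(1)] by (simp add: comp_assoc[OF D] comp_ident_right[OF D])
    finally show ?thesis
      using l oD hs by - (rule iso_cancel_left[OF D oD(2,4,3) natural_isoD(1)[OF \<eta> o(2)]],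
        simp_all add: comp_in_hom[OF D])
  qed
  then have "natural_iso C D G F \<theta>" unfolding natural_iso_def using \<theta>(1) by blast
  then show ?thesis ..
qed

lemma is_functor_id_map: "is_functor C C id_map"
  by (simp add: is_functor_def)

text \<open>In the definition the unit leaves the identity while the counit enters it, so exchanging
  the two functors requires inverting both.\<close>

lemma equivalent_cats_sym:
  assumes "C \<simeq>\<^sub>c D" shows "D \<simeq>\<^sub>c C"
proof -
  obtain F G \<eta> \<epsilon> where cat: "category C" "category D" and fs: "is_functor C D F" "is_functor D C G"
    and nat: "natural_iso C C id_map (comp_map G F) \<eta>" "natural_iso D D (comp_map F G) id_map \<epsilon>"
    using assms unfolding equivalent_cats_def by blast
  note comps = is_functor_comp_map[OF fs] is_functor_comp_map[OF fs(2,1)]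
  obtain \<eta>' where "natural_iso C C (comp_map G F) id_map \<eta>'"
    using natural_iso_inverse[OF cat(1) is_functor_id_map comps(1) nat(1)] .
  moreover obtain \<epsilon>' where "natural_iso D D id_map (comp_map F G) \<epsilon>'"
    using natural_iso_inverse[OF cat(2) comps(2) is_functor_id_map nat(2)] .
  ultimately show ?thesis using cat fs unfolding equivalent_cats_def by blast
qed

section \<open>Equivalences as fully faithful, essentially surjective functors\<close>

definition weak_equivalence :: "('o, 'a) cat \<Rightarrow> ('p, 'b) cat \<Rightarrow> ('o, 'a, 'p, 'b) cat_map \<Rightarrow> bool" where
  "weak_equivalence C D F \<longleftrightarrow> is_functor C D F \<and>
    (\<forall>X\<in>Obj C. \<forall>Y\<in>Obj C. bij_betw (amap F X Y) (Hom C X Y) (Hom D (omap F X) (omap F Y))) \<and>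
    (\<forall>Z\<in>Obj D. \<exists>X\<in>Obj C. \<exists>f. iso_arrow D (omap F X) Z f)"

lemma
  assumes "weak_equivalence C D F"
  shows weak_equivalence_functor: "is_functor C D F"
    and weak_equivalence_faithful: "\<lbrakk>X \<in> Obj C; Y \<in> Obj C; f \<in> Hom C X Y; g \<in> Hom C X Y;
      amap F X Y f = amap F X Y g\<rbrakk> \<Longrightarrow> f = g"
    and weak_equivalence_full: "\<lbrakk>X \<in> Obj C; Y \<in> Obj C; h \<in> Hom D (omap F X) (omap F Y)\<rbrakk>
      \<Longrightarrow> \<exists>f\<in>Hom C X Y. amap F X Y f = h"
    and weak_equivalence_dense: "Z \<in> Obj D \<Longrightarrow> \<exists>X\<in>Obj C. \<exists>f. iso_arrow D (omap F X) Z f"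
  using assms unfolding weak_equivalence_def bij_betw_def inj_on_def
  by (blast, blast, metis imageE, blast)

text \<open>Naturality conjugates \<open>f\<close> by \<open>\<eta>\<close> into the image of
  \<open>f\<close> under \<open>G F\<close>, so the image under \<open>F\<close> already determines
  \<open>f\<close>.\<close>

lemma natural_iso_id_faithful:
  assumes C: "category C" and F: "is_functor C D F" and G: "is_functor D C G"
    and \<eta>: "natural_iso C C id_map (comp_map G F) \<eta>"
    and o: "X \<in> Obj C" "Y \<in> Obj C" and fg: "f \<in> Hom C X Y" "g \<in> Hom C X Y"
    and eq: "amap F X Y f = amap F X Y g"
  shows "f = g"
proof -
  have "Comp C X Y (omap G (omap F Y)) (\<eta> Y) f = Comp C X Y (omap G (omap F Y)) (\<eta> Y) g"
    using natural_isoD(2)[OF \<eta> o fg(1)] natural_isoD(2)[OF \<eta> o fg(2)] eq by simp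
  moreover have "iso_arrow C Y (omap G (omap F Y)) (\<eta> Y)" using natural_isoD(1)[OF \<eta> o(2)] by simp
  ultimately show ?thesis
    using iso_cancel_left[OF C o(2) functor_obj[OF G functor_obj[OF F o(2)]] o(1)] fg by blast
qed

lemma weak_equivalence_of_natural_isos:
  assumes C: "category C" and D: "category D" and F: "is_functor C D F" and G: "is_functor D C G"
    and \<eta>: "natural_iso C C id_map (comp_map G F) \<eta>"
    and \<epsilon>: "natural_iso D D (comp_map F G) id_map \<epsilon>"
  shows "weak_equivalence C D F"
proof -
  \<comment> \<open>The inverted counit is a unit for \<open>G\<close>, so the preceding lemma makes
    \<open>G\<close> faithful too.\<close>
  obtain \<epsilon>' where \<epsilon>': "natural_iso D D id_map (comp_map F G) \<epsilon>'"
    using natural_iso_inverse[OF D is_functor_comp_map[OF G F] is_functor_id_map \<epsilon>] .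
  have full: "\<exists>f\<in>Hom C X Y. amap F X Y f = h"
    if o: "X \<in> Obj C" "Y \<in> Obj C" and h: "h \<in> Hom D (omap F X) (omap F Y)" for X Y h
  proof -
    note oF = functor_obj[OF F o(1)] functor_obj[OF F o(2)]
    note oGF = functor_obj[OF G oF(1)] functor_obj[OF G oF(2)]
    have i: "iso_arrow C X (omap G (omap F X)) (\<eta> X)" "iso_arrow C Y (omap G (omap F Y)) (\<eta> Y)"
      using natural_isoD(1)[OF \<eta> o(1)] natural_isoD(1)[OF \<eta> o(2)] by simp_all
    note ih = iso_arrow_in_hom[OF i(1)] iso_arrow_in_hom[OF i(2)]
    obtain j where j: "j \<in> Hom C (omap G (omap F Y)) Y"
      "Comp C (omap G (omap F Y)) Y (omap G (omap F Y)) (\<eta> Y) j = Ident C (omap G (omap F Y))"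
      using i(2) by (rule iso_arrowE)
    \<comment> \<open>A preimage of \<open>h\<close> must be the image of \<open>h\<close> under
      \<open>G\<close>, conjugated by \<open>\<eta>\<close>. The resulting \<open>f\<close>
      satisfies \<open>G F f = G h\<close>, and faithfulness of \<open>G\<close> finishes.\<close>
    define k where "k = Comp C X (omap G (omap F X)) (omap G (omap F Y))
      (amap G (omap F X) (omap F Y) h) (\<eta> X)"
    note Gh = functor_hom[OF G oF h]
    have k: "k \<in> Hom C X (omap G (omap F Y))"
      unfolding k_def using o oGF Gh ih by (simp add: comp_in_hom[OF C])
    define f where "f = Comp C X (omap G (omap F Y)) Y j k"
    have f: "f \<in> Hom C X Y" unfolding f_def using o oGF j k by (simp add: comp_in_hom[OF C])
    note GFf = functor_hom[OF G oF functor_hom[OF F o f]]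
    have "Comp C X (omap G (omap F X)) (omap G (omap F Y))
        (amap G (omap F X) (omap F Y) (amap F X Y f)) (\<eta> X) = Comp C X Y (omap G (omap F Y)) (\<eta> Y) f"
      using natural_isoD(2)[OF \<eta> o f] by simp
    also have "\<dots> = k"
      unfolding f_def using o oGF j k ih
      by (simp add: comp_assoc[OF C, symmetric] comp_ident_left[OF C])
    finally have "amap G (omap F X) (omap F Y) (amap F X Y f) = amap G (omap F X) (omap F Y) h"
      using iso_cancel_right[OF C o(1) oGF i(1) GFf Gh] by (simp add: k_def)
    then have "amap F X Y f = h"
      using natural_iso_id_faithful[OF D G F \<epsilon>' oF functor_hom[OF F o f] h] by simp
    with f show ?thesis by blast
  qed
  have "bij_betw (amap F X Y) (Hom C X Y) (Hom D (omap F X) (omap F Y))"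
    if o: "X \<in> Obj C" "Y \<in> Obj C" for X Y
    unfolding bij_betw_def inj_on_def
    using natural_iso_id_faithful[OF C F G \<eta> o] full[OF o] functor_hom[OF F o] by blast
  moreover have "\<exists>X\<in>Obj C. \<exists>f. iso_arrow D (omap F X) Z f" if "Z \<in> Obj D" for Z
    using natural_isoD(1)[OF \<epsilon> that] functor_obj[OF G that] by auto
  ultimately show ?thesis using F unfolding weak_equivalence_def by blast
qed

lemma equivalent_cats_imp_weak_equivalence:
  assumes "C \<simeq>\<^sub>c D" obtains F where "weak_equivalence C D F"
  using assms weak_equivalence_of_natural_isos unfolding equivalent_cats_def by blast

lemma weak_equivalence_iso_arrow:
  assumes C: "category C" and D: "category D" and F: "weak_equivalence C D F"
    and o: "X \<in> Obj C" "Y \<in> Obj C" and h: "iso_arrow D (omap F X) (omap F Y) h"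
  shows "\<exists>f. iso_arrow C X Y f \<and> amap F X Y f = h"
proof -
  note Ff = weak_equivalence_functor[OF F]
  obtain h' where h': "h' \<in> Hom D (omap F Y) (omap F X)"
    "Comp D (omap F X) (omap F Y) (omap F X) h' h = Ident D (omap F X)"
    "Comp D (omap F Y) (omap F X) (omap F Y) h h' = Ident D (omap F Y)"
    using h by (rule iso_arrowE)
  obtain f where f: "f \<in> Hom C X Y" "amap F X Y f = h"
    using weak_equivalence_full[OF F o iso_arrow_in_hom[OF h]] by blast
  obtain g where g: "g \<in> Hom C Y X" "amap F Y X g = h'"
    using weak_equivalence_full[OF F o(2,1) h'(1)] by blast
  have "Comp C X Y X g f = Ident C X"
    using o f g h' by - (rule weak_equivalence_faithful[OF F o(1,1)],
      simp_all add: comp_in_hom[OF C] ident_in_hom[OF C] functor_comp[OF Ff] functor_ident[OF Ff])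
  moreover have "Comp C Y X Y f g = Ident C Y"
    using o f g h' by - (rule weak_equivalence_faithful[OF F o(2,2)],
      simp_all add: comp_in_hom[OF C] ident_in_hom[OF C] functor_comp[OF Ff] functor_ident[OF Ff])
  ultimately show ?thesis using f g unfolding iso_arrow_def by blast
qed

lemma weak_equivalence_imp_equivalent_cats:
  assumes C: "category C" and D: "category D" and F: "weak_equivalence C D F"
  shows "C \<simeq>\<^sub>c D"
proof -
  note Ff = weak_equivalence_functor[OF F]
  have "\<forall>Z\<in>Obj D. \<exists>X e. X \<in> Obj C \<and> iso_arrow D (omap F X) Z e"
    using weak_equivalence_dense[OF F] by blast
  then obtain G0 \<epsilon> where G0: "\<And>Z. Z \<in> Obj D \<Longrightarrow> G0 Z \<in> Obj C"
    and \<epsilon>: "\<And>Z. Z \<in> Obj D \<Longrightarrow> iso_arrow D (omap F (G0 Z)) Z (\<epsilon> Z)"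
    by metis
  note \<epsilon>h = iso_arrow_in_hom[OF \<epsilon>] and FG0 = functor_obj[OF Ff G0]
  \<comment> \<open>\<open>\<epsilon> W\<close> is a universal arrow from \<open>F\<close> to
    \<open>W\<close>: every arrow into \<open>W\<close> from an image of \<open>F\<close> factors
    through it, and uniquely so. Functoriality of \<open>G\<close> and naturality of
    \<open>\<eta>\<close> below are read off from this uniqueness.\<close>
  have lift: "\<exists>g\<in>Hom C X (G0 W). Comp D (omap F X) (omap F (G0 W)) W (\<epsilon> W) (amap F X (G0 W) g) = k"
    if X: "X \<in> Obj C" and W: "W \<in> Obj D" and k: "k \<in> Hom D (omap F X) W" for X W k
  proof -
    note FX = functor_obj[OF Ff X]
    obtain e where e: "e \<in> Hom D W (omap F (G0 W))"
      "Comp D W (omap F (G0 W)) W (\<epsilon> W) e = Ident D W"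
      using \<epsilon>[OF W] by (rule iso_arrowE)
    obtain g where g: "g \<in> Hom C X (G0 W)" "amap F X (G0 W) g = Comp D (omap F X) W (omap F (G0 W)) e k"
      using weak_equivalence_full[OF F X G0[OF W] comp_in_hom[OF D FX W FG0[OF W] k e(1)]] by blast
    have "Comp D (omap F X) (omap F (G0 W)) W (\<epsilon> W) (amap F X (G0 W) g) = k"
      using FX W FG0[OF W] \<epsilon>h[OF W] e k
      by (simp add: g comp_assoc[OF D, symmetric] comp_ident_left[OF D])
    with g show ?thesis by blast
  qed
  have lift_unique: "g = g'"
    if X: "X \<in> Obj C" and W: "W \<in> Obj D" and g: "g \<in> Hom C X (G0 W)" "g' \<in> Hom C X (G0 W)"
      "Comp D (omap F X) (omap F (G0 W)) W (\<epsilon> W) (amap F X (G0 W) g) =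
       Comp D (omap F X) (omap F (G0 W)) W (\<epsilon> W) (amap F X (G0 W) g')" for X W g g'
    using iso_cancel_left[OF D FG0[OF W] W functor_obj[OF Ff X] \<epsilon>[OF W]
        functor_hom[OF Ff X G0[OF W] g(1)] functor_hom[OF Ff X G0[OF W] g(2)] g(3)]
    by (rule weak_equivalence_faithful[OF F X G0[OF W] g(1,2)])
  have "\<exists>g. \<forall>Z\<in>Obj D. \<forall>W\<in>Obj D. \<forall>f\<in>Hom D Z W. g Z W f \<in> Hom C (G0 Z) (G0 W) \<and>
      Comp D (omap F (G0 Z)) (omap F (G0 W)) W (\<epsilon> W) (amap F (G0 Z) (G0 W) (g Z W f)) =
      Comp D (omap F (G0 Z)) Z W f (\<epsilon> Z)"
  proof -
    have "\<exists>g. (Z \<in> Obj D \<and> W \<in> Obj D \<and> f \<in> Hom D Z W \<longrightarrow> g \<in> Hom C (G0 Z) (G0 W) \<and>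
      Comp D (omap F (G0 Z)) (omap F (G0 W)) W (\<epsilon> W) (amap F (G0 Z) (G0 W) g) =
      Comp D (omap F (G0 Z)) Z W f (\<epsilon> Z))" for Z W f
      using lift[OF G0, of Z W "Comp D (omap F (G0 Z)) Z W f (\<epsilon> Z)"]
        comp_in_hom[OF D FG0[of Z], of Z W "\<epsilon> Z" f] \<epsilon>h[of Z] by blast
    then show ?thesis by metis
  qed
  then obtain G1 where G1: "\<And>Z W f. \<lbrakk>Z \<in> Obj D; W \<in> Obj D; f \<in> Hom D Z W\<rbrakk> \<Longrightarrow> G1 Z W f \<in> Hom C (G0 Z) (G0 W)"
    and G1_eq: "\<And>Z W f. \<lbrakk>Z \<in> Obj D; W \<in> Obj D; f \<in> Hom D Z W\<rbrakk> \<Longrightarrow>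
      Comp D (omap F (G0 Z)) (omap F (G0 W)) W (\<epsilon> W) (amap F (G0 Z) (G0 W) (G1 Z W f)) =
      Comp D (omap F (G0 Z)) Z W f (\<epsilon> Z)" by blast
  define G where "G = \<lparr>omap = G0, amap = G1\<rparr>"
  note [simp] = G_def
  have G: "is_functor D C G"
    unfolding is_functor_def
  proof (intro conjI ballI)
    fix Z assume Z: "Z \<in> Obj D"
    show "omap G Z \<in> Obj C" using Z G0 by simp
    show "amap G Z Z (Ident D Z) = Ident C (omap G Z)"
      using G0[OF Z] Z FG0[OF Z] \<epsilon>h[OF Z] G1[OF Z Z ident_in_hom[OF D Z]]
      by - (rule lift_unique[OF G0[OF Z] Z], auto simp: G1_eq ident_in_hom[OF C] ident_in_hom[OF D]
            functor_ident[OF Ff] comp_ident_left[OF D] comp_ident_right[OF D])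
  next
    fix Z W f assume "Z \<in> Obj D" "W \<in> Obj D" "f \<in> Hom D Z W"
    then show "amap G Z W f \<in> Hom C (omap G Z) (omap G W)" using G1 by simp
  next
    fix X Y Z f g assume o: "X \<in> Obj D" "Y \<in> Obj D" "Z \<in> Obj D" and f: "f \<in> Hom D X Y" and g: "g \<in> Hom D Y Z"
    note oG = G0[OF o(1)] G0[OF o(2)] G0[OF o(3)] and oF = FG0[OF o(1)] FG0[OF o(2)] FG0[OF o(3)]
    note hG = G1[OF o(1,2) f] G1[OF o(2,3) g]
    note hF = functor_hom[OF Ff oG(1,2) hG(1)] functor_hom[OF Ff oG(2,3) hG(2)]
    note gf = comp_in_hom[OF D o f g]
    note es = \<epsilon>h[OF o(1)] \<epsilon>h[OF o(2)] \<epsilon>h[OF o(3)]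
    have "Comp D (omap F (G0 X)) (omap F (G0 Z)) Z (\<epsilon> Z)
        (amap F (G0 X) (G0 Z) (Comp C (G0 X) (G0 Y) (G0 Z) (G1 Y Z g) (G1 X Y f)))
      = Comp D (omap F (G0 X)) (omap F (G0 Y)) Z (Comp D (omap F (G0 Y)) (omap F (G0 Z)) Z
           (\<epsilon> Z) (amap F (G0 Y) (G0 Z) (G1 Y Z g))) (amap F (G0 X) (G0 Y) (G1 X Y f))"
      using o oG oF hG hF es by (simp add: functor_comp[OF Ff] comp_assoc[OF D])
    also have "\<dots> = Comp D (omap F (G0 X)) Y Z g (Comp D (omap F (G0 X)) (omap F (G0 Y)) Y
           (\<epsilon> Y) (amap F (G0 X) (G0 Y) (G1 X Y f)))"
      using o oF hF es g by (simp add: G1_eq comp_assoc[OF D])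
    also have "\<dots> = Comp D (omap F (G0 X)) X Z (Comp D X Y Z g f) (\<epsilon> X)"
      using o oF es f g by (simp add: G1_eq comp_assoc[OF D])
    finally show "amap G X Z (Comp D X Y Z g f) =
        Comp C (omap G X) (omap G Y) (omap G Z) (amap G Y Z g) (amap G X Y f)"
      using G1[OF o(1,3) gf] G1_eq[OF o(1,3) gf] comp_in_hom[OF C oG hG]
      by - (rule lift_unique[OF oG(1) o(3)], simp_all)
  qed
  have \<epsilon>n: "natural_iso D D (comp_map F G) id_map \<epsilon>"
    unfolding natural_iso_def using \<epsilon> G1_eq by simp
  \<comment> \<open>The unit at \<open>X\<close> is the lift of the inverse of
    \<open>\<epsilon> (omap F X)\<close>. A triangle identity then holds by construction and reduces
    naturality of the unit to that of the counit.\<close>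
  have "\<exists>e. iso_arrow C X (G0 (omap F X)) e \<and>
      Comp D (omap F X) (omap F (G0 (omap F X))) (omap F X) (\<epsilon> (omap F X))
        (amap F X (G0 (omap F X)) e) = Ident D (omap F X)" if X: "X \<in> Obj C" for X
  proof -
    note FX = functor_obj[OF Ff X]
    obtain h where "iso_arrow D (omap F X) (omap F (G0 (omap F X))) h"
      "Comp D (omap F X) (omap F (G0 (omap F X))) (omap F X) (\<epsilon> (omap F X)) h = Ident D (omap F X)"
      using \<epsilon>[OF FX] by (rule iso_arrowE)
    then show ?thesis using weak_equivalence_iso_arrow[OF C D F X G0[OF FX]] by metis
  qed
  then obtain \<eta> where \<eta>: "\<And>X. X \<in> Obj C \<Longrightarrow> iso_arrow C X (G0 (omap F X)) (\<eta> X)"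
    and \<eta>_eq: "\<And>X. X \<in> Obj C \<Longrightarrow> Comp D (omap F X) (omap F (G0 (omap F X))) (omap F X) (\<epsilon> (omap F X))
        (amap F X (G0 (omap F X)) (\<eta> X)) = Ident D (omap F X)" by metis
  have "natural_iso C C id_map (comp_map G F) \<eta>"
    unfolding natural_iso_def
  proof (intro conjI ballI)
    fix X assume "X \<in> Obj C"
    then show "iso_arrow C (omap id_map X) (omap (comp_map G F) X) (\<eta> X)" using \<eta> by simp
  next
    fix X Y f assume o: "X \<in> Obj C" "Y \<in> Obj C" and f: "f \<in> Hom C X Y"
    note oF = functor_obj[OF Ff o(1)] functor_obj[OF Ff o(2)]
    note oG = G0[OF oF(1)] G0[OF oF(2)] and oFG = FG0[OF oF(1)] FG0[OF oF(2)]
    note \<eta>h = iso_arrow_in_hom[OF \<eta>[OF o(1)]] iso_arrow_in_hom[OF \<eta>[OF o(2)]]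
    note Fh = functor_hom[OF Ff o f] and F\<eta> = functor_hom[OF Ff o(1) oG(1) \<eta>h(1)]
      functor_hom[OF Ff o(2) oG(2) \<eta>h(2)]
    note Gh = G1[OF oF Fh] and FGh = functor_hom[OF Ff oG G1[OF oF Fh]]
    note es = \<epsilon>h[OF oF(1)] \<epsilon>h[OF oF(2)]
    have l: "Comp D (omap F X) (omap F (G0 (omap F Y))) (omap F Y) (\<epsilon> (omap F Y))
        (amap F X (G0 (omap F Y)) (Comp C X Y (G0 (omap F Y)) (\<eta> Y) f)) = amap F X Y f"
      using o oF oG oFG \<eta>h F\<eta> Fh es f \<eta>_eq[OF o(2)]
      by (simp add: functor_comp[OF Ff] comp_assoc[OF D, symmetric] comp_ident_left[OF D])
    have "Comp D (omap F X) (omap F (G0 (omap F Y))) (omap F Y) (\<epsilon> (omap F Y))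
        (amap F X (G0 (omap F Y)) (Comp C X (G0 (omap F X)) (G0 (omap F Y)) (G1 (omap F X) (omap F Y) (amap F X Y f)) (\<eta> X)))
       = Comp D (omap F X) (omap F (G0 (omap F X))) (omap F Y)
          (Comp D (omap F (G0 (omap F X))) (omap F X) (omap F Y) (amap F X Y f) (\<epsilon> (omap F X)))
          (amap F X (G0 (omap F X)) (\<eta> X))"
      using o oF oG oFG \<eta>h F\<eta> Fh Gh FGh es G1_eq[OF oF Fh]
      by (simp add: functor_comp[OF Ff] comp_assoc[OF D, symmetric])
    also have "\<dots> = amap F X Y f"
      using oF oFG F\<eta> Fh es \<eta>_eq[OF o(1)] by (simp add: comp_assoc[OF D] comp_ident_right[OF D])
    finally show "Comp C (omap id_map X) (omap id_map Y) (omap (comp_map G F) Y) (\<eta> Y) (amap id_map X Y f) =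
        Comp C (omap id_map X) (omap (comp_map G F) X) (omap (comp_map G F) Y)
          (amap (comp_map G F) X Y f) (\<eta> X)"
      using l comp_in_hom[OF C o(1) o(2) oG(2) f \<eta>h(2)] comp_in_hom[OF C o(1) oG \<eta>h(1) Gh]
      by - (rule lift_unique[OF o(1) oF(2)], simp_all)
  qed
  with G \<epsilon>n Ff C D show ?thesis unfolding equivalent_cats_def by blast
qed

text \<open>Transitivity of equivalence is reached through this form, which spares the pasting of
  natural isomorphisms.\<close>

lemma weak_equivalence_comp_map:
  assumes E: "category E" and F: "weak_equivalence C D F" and G: "weak_equivalence D E G"
  shows "weak_equivalence C E (comp_map G F)"
  unfolding weak_equivalence_def
proof (intro conjI ballI)
  note Ff = weak_equivalence_functor[OF F] and Gf = weak_equivalence_functor[OF G]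
  show "is_functor C E (comp_map G F)" using Ff Gf by (rule is_functor_comp_map)
  fix X Y assume "X \<in> Obj C" "Y \<in> Obj C"
  then have "bij_betw (amap G (omap F X) (omap F Y) \<circ> amap F X Y)
      (Hom C X Y) (Hom E (omap G (omap F X)) (omap G (omap F Y)))"
    using F G functor_obj[OF Ff] unfolding weak_equivalence_def by (blast intro: bij_betw_trans)
  then show "bij_betw (amap (comp_map G F) X Y) (Hom C X Y)
      (Hom E (omap (comp_map G F) X) (omap (comp_map G F) Y))" by (simp add: comp_def comp_map_def)
next
  note Ff = weak_equivalence_functor[OF F] and Gf = weak_equivalence_functor[OF G]
  fix Z assume Z: "Z \<in> Obj E"
  obtain Y g where Y: "Y \<in> Obj D" "iso_arrow E (omap G Y) Z g" using weak_equivalence_dense[OF G Z] by blast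
  obtain X f where X: "X \<in> Obj C" "iso_arrow D (omap F X) Y f" using weak_equivalence_dense[OF F Y(1)] by blast
  note FX = functor_obj[OF Ff X(1)]
  obtain f' where f': "f' \<in> Hom D Y (omap F X)" "Comp D (omap F X) Y (omap F X) f' f = Ident D (omap F X)"
    "Comp D Y (omap F X) Y f f' = Ident D Y" using X(2) by (rule iso_arrowE)
  note fh = iso_arrow_in_hom[OF X(2)]
  have "iso_arrow E (omap G (omap F X)) (omap G Y) (amap G (omap F X) Y f)"
    unfolding iso_arrow_def using functor_hom[OF Gf FX Y(1) fh] functor_hom[OF Gf Y(1) FX f'(1)] f' FX Y(1) fh
    by (auto intro!: bexI[of _ "amap G Y (omap F X) f'"] simp: functor_comp[OF Gf, symmetric] functor_ident[OF Gf])
  from iso_arrow_comp[OF E functor_obj[OF Gf FX] functor_obj[OF Gf Y(1)] Z this Y(2)]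
  show "\<exists>X\<in>Obj C. \<exists>f. iso_arrow E (omap (comp_map G F) X) Z f" using X by auto
qed

lemma equivalent_cats_trans:
  assumes "C \<simeq>\<^sub>c D" "D \<simeq>\<^sub>c E" shows "C \<simeq>\<^sub>c E"
proof -
  obtain F where F: "weak_equivalence C D F" using assms(1) by (rule equivalent_cats_imp_weak_equivalence)
  obtain G where G: "weak_equivalence D E G" using assms(2) by (rule equivalent_cats_imp_weak_equivalence)
  have "category C" "category E" using assms unfolding equivalent_cats_def by auto
  then show ?thesis
    using weak_equivalence_comp_map[OF _ F G] by (blast intro: weak_equivalence_imp_equivalent_cats)
qed

section \<open>Invariance of epimorphisms and supercompactness under equivalence\<close>

lemma weak_equivalence_epi_arrow:
  assumes C: "category C" and D: "category D" and F: "weak_equivalence C D F"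
    and X: "X \<in> Obj C" and Y: "Y \<in> Obj C" and epi: "epi_arrow C X Y f"
  shows "epi_arrow D (omap F X) (omap F Y) (amap F X Y f)"
  unfolding epi_arrow_def
proof (intro conjI ballI impI)
  note Ff = weak_equivalence_functor[OF F]
  note FX = functor_obj[OF Ff X] and FY = functor_obj[OF Ff Y]
  have f: "f \<in> Hom C X Y" using epi by (simp add: epi_arrow_def)
  show "amap F X Y f \<in> Hom D (omap F X) (omap F Y)" using functor_hom[OF Ff X Y f] .
  fix Z g h assume Z: "Z \<in> Obj D" and g: "g \<in> Hom D (omap F Y) Z" and h: "h \<in> Hom D (omap F Y) Z"
    and eq: "Comp D (omap F X) (omap F Y) Z g (amap F X Y f) = Comp D (omap F X) (omap F Y) Z h (amap F X Y f)"
  note Fh = functor_hom[OF Ff X Y f]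
  \<comment> \<open>The test object is replaced by an isomorphic image of \<open>F\<close>; arrows
    into it from an image lift to \<open>C\<close>, where the epimorphism property can be
    used.\<close>
  obtain Z' v' where Z': "Z' \<in> Obj C" and "iso_arrow D (omap F Z') Z v'"
    using weak_equivalence_dense[OF F Z] by blast
  then obtain v where v: "iso_arrow D Z (omap F Z') v" by (metis iso_arrowE)
  note FZ' = functor_obj[OF Ff Z'] and vh = iso_arrow_in_hom[OF v]
  obtain g' where g': "g' \<in> Hom C Y Z'" "amap F Y Z' g' = Comp D (omap F Y) Z (omap F Z') v g"
    using weak_equivalence_full[OF F Y Z' comp_in_hom[OF D FY Z FZ' g vh]] by blast
  obtain h' where h': "h' \<in> Hom C Y Z'" "amap F Y Z' h' = Comp D (omap F Y) Z (omap F Z') v h"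
    using weak_equivalence_full[OF F Y Z' comp_in_hom[OF D FY Z FZ' h vh]] by blast
  have "amap F X Z' (Comp C X Y Z' g' f) = amap F X Z' (Comp C X Y Z' h' f)"
    using X Y Z' f g' h' FX FY FZ' Z Fh g h vh eq by (simp add: functor_comp[OF Ff] comp_assoc[OF D])
  then have "Comp C X Y Z' g' f = Comp C X Y Z' h' f"
    using weak_equivalence_faithful[OF F X Z'] comp_in_hom[OF C X Y Z' f] g' h' by blast
  then have "g' = h'" using epi Z' g' h' unfolding epi_arrow_def by blast
  then have "Comp D (omap F Y) Z (omap F Z') v g = Comp D (omap F Y) Z (omap F Z') v h"
    using g' h' by simp
  then show "g = h" using iso_cancel_left[OF D Z FZ' FY v g h] by blast
qed

lemma weak_equivalence_supercompact:
  assumes C: "category C" and D: "category D" and F: "weak_equivalence C D F" and Y: "supercompact C Y"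
  shows "supercompact D (omap F Y)"
  unfolding supercompact_def
proof (intro conjI allI impI)
  note Ff = weak_equivalence_functor[OF F]
  have Yo: "Y \<in> Obj C" using Y by (simp add: supercompact_def)
  note FY = functor_obj[OF Ff Yo]
  show "omap F Y \<in> Obj D" by (rule FY)
  fix S assume S: "sink D (omap F Y) S \<and> jointly_epic D (omap F Y) S"
  \<comment> \<open>All arrows of \<open>C\<close> whose image is a member of \<open>S\<close> up to
    an isomorphism of domains. This family inherits joint epicity from \<open>S\<close>, and an
    epimorphism found in it yields one in \<open>S\<close>.\<close>
  define S' where "S' = {(A', f'). A' \<in> Obj C \<and> f' \<in> Hom C A' Y \<and>
    (\<exists>(A, f)\<in>S. \<exists>u. iso_arrow D (omap F A') A u \<and> amap F A' Y f' = Comp D (omap F A') A (omap F Y) f u)}"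
  have "sink C Y S'" by (auto simp: sink_def S'_def)
  moreover have "jointly_epic C Y S'"
    unfolding jointly_epic_def
  proof (intro ballI impI)
    fix Z g h assume Z: "Z \<in> Obj C" and g: "g \<in> Hom C Y Z" and h: "h \<in> Hom C Y Z"
      and eq: "\<forall>(A, f)\<in>S'. Comp C A Y Z g f = Comp C A Y Z h f"
    note FZ = functor_obj[OF Ff Z]
    note Fgh = functor_hom[OF Ff Yo Z g] functor_hom[OF Ff Yo Z h]
    have "Comp D A (omap F Y) (omap F Z) (amap F Y Z g) f = Comp D A (omap F Y) (omap F Z) (amap F Y Z h) f"
      if Af: "(A, f) \<in> S" for A f
    proof -
      have A: "A \<in> Obj D" and f: "f \<in> Hom D A (omap F Y)" using S Af by (auto simp: sink_def)
      obtain A' u where A': "A' \<in> Obj C" and u: "iso_arrow D (omap F A') A u"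
        using weak_equivalence_dense[OF F A] by blast
      note FA' = functor_obj[OF Ff A'] and uh = iso_arrow_in_hom[OF u]
      obtain f' where f': "f' \<in> Hom C A' Y" "amap F A' Y f' = Comp D (omap F A') A (omap F Y) f u"
        using weak_equivalence_full[OF F A' Yo comp_in_hom[OF D FA' A FY uh f]] by blast
      have "(A', f') \<in> S'" unfolding S'_def using A' f' Af u by blast
      then have "Comp C A' Y Z g f' = Comp C A' Y Z h f'" using eq by blast
      then have "amap F A' Z (Comp C A' Y Z g f') = amap F A' Z (Comp C A' Y Z h f')" by simp
      then have "Comp D (omap F A') A (omap F Z) (Comp D A (omap F Y) (omap F Z) (amap F Y Z g) f) u =
          Comp D (omap F A') A (omap F Z) (Comp D A (omap F Y) (omap F Z) (amap F Y Z h) f) u"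
        using A' Yo Z f' g h FA' FY FZ A f uh Fgh by (simp add: functor_comp[OF Ff] comp_assoc[OF D])
      then show ?thesis
        using iso_cancel_right[OF D FA' A FZ u] comp_in_hom[OF D A FY FZ f] Fgh by blast
    qed
    then have "amap F Y Z g = amap F Y Z h" using S FZ Fgh unfolding jointly_epic_def by blast
    then show "g = h" using weak_equivalence_faithful[OF F Yo Z g h] by blast
  qed
  ultimately obtain A' f' where "(A', f') \<in> S'" and epi: "epi_arrow C A' Y f'"
    using Y unfolding supercompact_def by blast
  then obtain A f u where A': "A' \<in> Obj C" and f': "f' \<in> Hom C A' Y" and Af: "(A, f) \<in> S"
    and u: "iso_arrow D (omap F A') A u" and Ff': "amap F A' Y f' = Comp D (omap F A') A (omap F Y) f u"
    unfolding S'_def by blast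
  have A: "A \<in> Obj D" and f: "f \<in> Hom D A (omap F Y)" using S Af by (auto simp: sink_def)
  note FA' = functor_obj[OF Ff A'] and uh = iso_arrow_in_hom[OF u]
  have "epi_arrow D A (omap F Y) f"
    unfolding epi_arrow_def
  proof (intro conjI ballI impI f)
    fix Z g h assume Z: "Z \<in> Obj D" and g: "g \<in> Hom D (omap F Y) Z" and h: "h \<in> Hom D (omap F Y) Z"
      and eq: "Comp D A (omap F Y) Z g f = Comp D A (omap F Y) Z h f"
    have "Comp D (omap F A') (omap F Y) Z k (amap F A' Y f') = Comp D (omap F A') A Z (Comp D A (omap F Y) Z k f) u"
      if "k \<in> Hom D (omap F Y) Z" for k
      using that FA' A FY Z uh f by (simp add: Ff' comp_assoc[OF D])
    with eq g h have "Comp D (omap F A') (omap F Y) Z g (amap F A' Y f') = Comp D (omap F A') (omap F Y) Z h (amap F A' Y f')"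
      by simp
    then show "g = h"
      using weak_equivalence_epi_arrow[OF C D F A' Yo epi] Z g h unfolding epi_arrow_def by blast
  qed
  then show "\<exists>(A, f)\<in>S. epi_arrow D A (omap F Y) f" using Af by blast
qed

lemma full_subcategory_simps [simp]:
  "Obj (full_subcategory C S) = Obj C \<inter> S" "Hom (full_subcategory C S) = Hom C"
  "Ident (full_subcategory C S) = Ident C" "Comp (full_subcategory C S) = Comp C"
  by (simp_all add: full_subcategory_def)

lemma category_full_subcategory: "category C \<Longrightarrow> category (full_subcategory C S)"
  unfolding category_def by simp

lemma iso_arrow_full_subcategory [simp]: "iso_arrow (full_subcategory C S) = iso_arrow C"
  by (simp add: iso_arrow_def fun_eq_iff)

text \<open>Both functors preserve supercompactness, so the same functors and natural isomorphisms
  serve for the full subcategories.\<close>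

lemma equivalent_cats_supercompact:
  assumes "C \<simeq>\<^sub>c D"
  shows "supercompact_objects C \<simeq>\<^sub>c supercompact_objects D"
proof -
  obtain F G \<eta> \<epsilon> where cat: "category C" "category D" and fs: "is_functor C D F" "is_functor D C G"
    and nat: "natural_iso C C id_map (comp_map G F) \<eta>" "natural_iso D D (comp_map F G) id_map \<epsilon>"
    using assms unfolding equivalent_cats_def by blast
  obtain \<eta>' where \<eta>': "natural_iso C C (comp_map G F) id_map \<eta>'"
    using natural_iso_inverse[OF cat(1) is_functor_id_map is_functor_comp_map[OF fs] nat(1)] .
  obtain \<epsilon>' where \<epsilon>': "natural_iso D D id_map (comp_map F G) \<epsilon>'"
    using natural_iso_inverse[OF cat(2) is_functor_comp_map[OF fs(2,1)] is_functor_id_map nat(2)] .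
  have F: "supercompact D (omap F X)" if "supercompact C X" for X
    using weak_equivalence_supercompact[OF cat weak_equivalence_of_natural_isos[OF cat fs nat] that] .
  have G: "supercompact C (omap G X)" if "supercompact D X" for X
    using weak_equivalence_supercompact[OF cat(2,1)
      weak_equivalence_of_natural_isos[OF cat(2,1) fs(2,1) \<epsilon>' \<eta>'] that] .
  show ?thesis
    unfolding equivalent_cats_def
  proof (intro conjI exI)
    show "category (supercompact_objects C)" "category (supercompact_objects D)"
      unfolding supercompact_objects_def using cat by (auto intro: category_full_subcategory)
    show "is_functor (supercompact_objects C) (supercompact_objects D) F"
      using fs(1) F unfolding supercompact_objects_def is_functor_def by simp
    show "is_functor (supercompact_objects D) (supercompact_objects C) G"
      using fs(2) G unfolding supercompact_objects_def is_functor_def by simp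
    show "natural_iso (supercompact_objects C) (supercompact_objects C) id_map (comp_map G F) \<eta>"
      using nat(1) unfolding supercompact_objects_def natural_iso_def by simp
    show "natural_iso (supercompact_objects D) (supercompact_objects D) (comp_map F G) id_map \<epsilon>"
      using nat(2) unfolding supercompact_objects_def natural_iso_def by simp
  qed
qed

section \<open>Continuous actions and right congruences\<close>

unbundle cardinal_syntax

lemma small_lepoll: "\<lbrakk>small \<U> B; A \<lesssim> B\<rbrakk> \<Longrightarrow> small \<U> A"
  unfolding small_def using lepoll_trans by blast

lemma small_of_mem: "X \<in> \<U> \<Longrightarrow> small \<U> X"
  unfolding small_def by blast

lemma small_embedding:
  assumes "set_universe \<U>" "small \<U> A"
  obtains j where "inj_on j A" "j ` A \<in> \<U>"
proof -
  obtain X j where X: "X \<in> \<U>" "inj_on j A" "j ` A \<subseteq> X"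
    using assms(2) unfolding small_def lepoll_def by blast
  have "j ` A \<lesssim> X" using X(3) by (rule subset_imp_lepoll)
  then have "j ` A \<in> \<U>" using assms(1) X(1) unfolding set_universe_def by blast
  with X show ?thesis using that by blast
qed

text \<open>Cardinals are comparable, so some infinite member \<open>Z\<close> of the universe
  dominates both factors, and \<open>Z \<times> Z\<close> has the cardinality of
  \<open>Z\<close>.\<close>

lemma small_Times:
  assumes U: "set_universe \<U>" and "small \<U> A" "small \<U> B"
  shows "small \<U> (A \<times> B)"
proof -
  obtain I where I: "I \<in> \<U>" "infinite I" using U unfolding set_universe_def by blast
  have max: "\<exists>Z\<in>\<U>. infinite Z \<and> X \<lesssim> Z \<and> Y \<lesssim> Z" if XY: "X \<in> \<U>" "Y \<in> \<U>" and inf: "infinite Y" for X Y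
  proof (cases "X \<lesssim> Y")
    case False
    then have "|Y| \<le>o |X|"
      using ordLeq_total[OF card_of_Well_order card_of_Well_order, of X Y]
      by (auto simp: lepoll_def card_of_ordLeq)
    then have "Y \<lesssim> X" by (auto simp: lepoll_def card_of_ordLeq[symmetric])
    moreover from this have "infinite X" using inf by (metis lepoll_def finite_imageI finite_imageD finite_subset)
    ultimately show ?thesis using XY by (metis lepoll_refl)
  qed (use XY inf in auto)
  obtain X Y where X: "X \<in> \<U>" "A \<lesssim> X" and Y: "Y \<in> \<U>" "B \<lesssim> Y"
    using assms(2,3) unfolding small_def by blast
  obtain W where W: "W \<in> \<U>" "infinite W" "X \<lesssim> W" using max[OF X(1) I] by blast
  obtain Z where Z: "Z \<in> \<U>" "infinite Z" "Y \<lesssim> Z" "W \<lesssim> Z" using max[OF Y(1) W(1,2)] by blast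
  have "A \<lesssim> Z" "B \<lesssim> Z" using X Y W Z lepoll_trans by blast+
  then have "|A| \<le>o |Z|" "|B| \<le>o |Z|" by (auto simp: lepoll_def card_of_ordLeq[symmetric])
  then have "|A \<times> B| \<le>o |Z|"
    using card_of_Times_mono1[of A Z B] card_of_Times_mono2[of B Z Z] card_of_Times_same_infinite[OF Z(2)]
    by (meson ordLeq_ordIso_trans ordLeq_transitive)
  then have "A \<times> B \<lesssim> Z" by (auto simp: lepoll_def card_of_ordLeq[symmetric])
  with Z(1) show ?thesis unfolding small_def by blast
qed

section \<open>Right congruences with continuous quotient, described by openness of classes\<close>

definition continuous_congruence :: "'m::topological_monoid_mult rel \<Rightarrow> bool" where
  "continuous_congruence r \<longleftrightarrow> right_congruence r \<and> (\<forall>p q. open {n. (p * n, q) \<in> r})"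

lemma
  assumes "right_congruence r"
  shows right_congruence_refl: "(p, p) \<in> r"
    and right_congruence_sym: "(p, q) \<in> r \<Longrightarrow> (q, p) \<in> r"
    and right_congruence_trans: "\<lbrakk>(p, q) \<in> r; (q, l) \<in> r\<rbrakk> \<Longrightarrow> (p, l) \<in> r"
    and right_congruence_mult: "(p, q) \<in> r \<Longrightarrow> (p * m, q * m) \<in> r"
    and right_congruence_class_eq: "r `` {p} = r `` {q} \<longleftrightarrow> (p, q) \<in> r"
proof -
  have eq: "equiv UNIV r" using assms unfolding right_congruence_def by blast
  show "(p, p) \<in> r" using eq by (meson UNIV_I equivE refl_onD)
  show "(p, q) \<in> r \<Longrightarrow> (q, p) \<in> r" using eq by (meson equivE symD)
  show "\<lbrakk>(p, q) \<in> r; (q, l) \<in> r\<rbrakk> \<Longrightarrow> (p, l) \<in> r" using eq by (meson equivE transD)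
  show "(p, q) \<in> r \<Longrightarrow> (p * m, q * m) \<in> r" using assms unfolding right_congruence_def by blast
  show "r `` {p} = r `` {q} \<longleftrightarrow> (p, q) \<in> r" using eq_equiv_class_iff[OF eq] by simp
qed

lemma right_congruenceI:
  assumes "\<And>p. (p, p) \<in> r" "\<And>p q. (p, q) \<in> r \<Longrightarrow> (q, p) \<in> r"
    "\<And>p q l. \<lbrakk>(p, q) \<in> r; (q, l) \<in> r\<rbrakk> \<Longrightarrow> (p, l) \<in> r"
    "\<And>p q m. (p, q) \<in> r \<Longrightarrow> (p * m, q * m) \<in> r"
  shows "right_congruence r"
proof -
  have "refl r" by (rule refl_onI) (rule assms(1))
  moreover have "sym r" by (rule symI) (rule assms(2))
  moreover have "trans r" by (rule transI) (rule assms(3))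
  ultimately show ?thesis using assms(4) by (simp add: right_congruence_def equiv_def)
qed

lemma continuous_congruence_imp_right [simp]: "continuous_congruence r \<Longrightarrow> right_congruence r"
  by (simp add: continuous_congruence_def)

text \<open>A class of \<open>s\<close> is a union of classes of \<open>r\<close>, so each set in
  question is a union of open sets.\<close>

lemma continuous_congruence_supset:
  assumes r: "continuous_congruence r" and s: "right_congruence s" and sub: "r \<subseteq> s"
  shows "continuous_congruence s"
  unfolding continuous_congruence_def
proof (intro conjI allI s)
  fix p q
  have "{n. (p * n, q) \<in> s} = (\<Union>l\<in>{l. (l, q) \<in> s}. {n. (p * n, l) \<in> r})"
    using sub right_congruence_trans[OF s] right_congruence_refl[of r] r by auto
  then show "open {n. (p * n, q) \<in> s}" using r by (auto simp: continuous_congruence_def)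
qed

lemma continuous_congruence_Int:
  assumes "continuous_congruence r" "continuous_congruence s"
  shows "continuous_congruence (r \<inter> s)"
proof -
  have "{n. (p * n, q) \<in> r \<inter> s} = {n. (p * n, q) \<in> r} \<inter> {n. (p * n, q) \<in> s}" for p q by auto
  moreover have "right_congruence (r \<inter> s)"
    by (rule right_congruenceI)
      (use assms in \<open>auto intro: right_congruence_refl right_congruence_sym right_congruence_trans right_congruence_mult\<close>)
  ultimately show ?thesis using assms by (auto simp: continuous_congruence_def)
qed

lemma mem_pullback_rel [simp]: "(p, q) \<in> pullback_rel m r \<longleftrightarrow> (m * p, m * q) \<in> r"
  by (simp add: pullback_rel_def)

lemma continuous_congruence_pullback:
  assumes "continuous_congruence r"
  shows "continuous_congruence (pullback_rel m r)"
proof -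
  have "right_congruence (pullback_rel m r)"
    by (rule right_congruenceI)
      (use assms in \<open>auto intro: right_congruence_refl right_congruence_sym right_congruence_trans
         simp: mult.assoc[symmetric] right_congruence_mult\<close>)
  then show ?thesis using assms by (auto simp: continuous_congruence_def mult.assoc[symmetric])
qed

section \<open>Continuity of actions and the quotients \<open>M/r\<close>\<close>

lemma
  assumes "right_mset X"
  shows act_in_pts: "x \<in> pts X \<Longrightarrow> act X x m \<in> pts X"
    and act_one: "x \<in> pts X \<Longrightarrow> act X x 1 = x"
    and act_act: "x \<in> pts X \<Longrightarrow> act X (act X x m) n = act X x (m * n)"
  using assms unfolding right_mset_def PiE_def Pi_def by auto

text \<open>Since \<open>X\<close> is discrete, joint continuity is continuity in the monoid
  variable: around \<open>(x, m)\<close> the box of \<open>{x}\<close> and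
  \<open>{n. act X x n = act X x m}\<close> is open and the action is constant on it.\<close>

lemma continuous_mset_iff:
  "continuous_mset X \<longleftrightarrow> right_mset X \<and> (\<forall>x\<in>pts X. \<forall>y\<in>pts X. open {m. act X x m = y})"
proof (cases "right_mset X")
  case True
  let ?P = "prod_topology (discrete_topology (pts X)) (euclidean :: 'b topology)"
  have "continuous_map ?P (discrete_topology (pts X)) (\<lambda>(x, m). act X x m)
    \<longleftrightarrow> (\<forall>x\<in>pts X. \<forall>y\<in>pts X. open {m. act X x m = y})" (is "?L \<longleftrightarrow> ?R")
  proof
    assume L: ?L
    show ?R
    proof (intro ballI)
      fix x y assume x: "x \<in> pts X" and y: "y \<in> pts X"
      have "continuous_map (euclidean :: 'b topology) ?P (\<lambda>m. (x, m))"
        using x by (intro continuous_map_pairedI) auto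
      from continuous_map_compose[OF this L]
      have "continuous_map euclidean (discrete_topology (pts X)) (\<lambda>m. act X x m)" by (simp add: comp_def)
      then have "openin euclidean {m \<in> topspace euclidean. act X x m \<in> {y}}"
        by (rule openin_continuous_map_preimage) (use y in simp)
      then show "open {m. act X x m = y}" by simp
    qed
  next
    assume R: ?R
    show ?L
      unfolding continuous_map_def
    proof (intro conjI allI impI)
      show "(\<lambda>(x, m). act X x m) \<in> topspace ?P \<rightarrow> topspace (discrete_topology (pts X))"
        using act_in_pts[OF True] by auto
      fix U assume "openin (discrete_topology (pts X)) U"
      show "openin ?P {z \<in> topspace ?P. (case z of (x, m) \<Rightarrow> act X x m) \<in> U}"
        unfolding openin_prod_topology_alt
      proof (intro allI impI)
        fix x m assume xm: "(x, m) \<in> {z \<in> topspace ?P. (case z of (x, m) \<Rightarrow> act X x m) \<in> U}"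
        then show "\<exists>V W. openin (discrete_topology (pts X)) V \<and> openin euclidean W \<and> x \<in> V \<and> m \<in> W \<and>
            V \<times> W \<subseteq> {z \<in> topspace ?P. (case z of (x, m) \<Rightarrow> act X x m) \<in> U}"
          using R act_in_pts[OF True]
          by (intro exI[of _ "{x}"] exI[of _ "{n. act X x n = act X x m}"]) auto
      qed
    qed
  qed
  with True show ?thesis by (simp add: continuous_mset_def)
qed (simp add: continuous_mset_def)

lemma continuous_mset_imp_right [simp]: "continuous_mset X \<Longrightarrow> right_mset X"
  by (simp add: continuous_mset_def)

lemma quotient_mset_act:
  assumes "right_congruence r"
  shows "act (quotient_mset r) (r `` {p}) m = r `` {p * m}"
proof -
  have "(\<Union>q\<in>r `` {p}. r `` {q * m}) = r `` {p * m}"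
    using assms right_congruence_refl[OF assms, of p]
      right_congruence_class_eq[OF assms] right_congruence_mult[OF assms] by blast
  then show ?thesis by (simp add: quotient_mset_def quotientI)
qed

lemma quotient_mset_pts: "pts (quotient_mset r) = range (\<lambda>p. r `` {p})"
  by (auto simp: quotient_mset_def quotient_def)

lemma right_mset_quotient:
  assumes "right_congruence r"
  shows "right_mset (quotient_mset r)"
  unfolding right_mset_def
proof (intro conjI)
  show "act (quotient_mset r) \<in> pts (quotient_mset r) \<rightarrow>\<^sub>E (UNIV \<rightarrow> pts (quotient_mset r))"
  proof (rule PiE_I)
    fix x assume "x \<notin> pts (quotient_mset r)"
    then show "act (quotient_mset r) x = undefined" by (simp add: quotient_mset_def)
  qed (use assms in \<open>auto simp: quotient_mset_pts quotient_mset_act\<close>)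
qed (use assms in \<open>auto simp: quotient_mset_pts quotient_mset_act mult.assoc\<close>)

lemma continuous_mset_quotient_iff:
  assumes "right_congruence r"
  shows "continuous_mset (quotient_mset r) \<longleftrightarrow> continuous_congruence r"
  using assms by (simp add: continuous_mset_iff right_mset_quotient quotient_mset_pts quotient_mset_act
    right_congruence_class_eq continuous_congruence_def)

section \<open>The category of congruences\<close>

lemma RCong_simps [simp]:
  "Obj (RCong TYPE('m::topological_monoid_mult)) = Collect continuous_congruence"
  "Hom (RCong TYPE('m)) r s = {s `` {m} | m. r \<subseteq> pullback_rel m s}"
  "Ident (RCong TYPE('m)) r = r `` {1}"
  using continuous_mset_quotient_iff by (auto simp: RCong_def)

text \<open>The unions in \<open>Comp\<close> run over all representatives. Changing
  \<open>m\<close> within its class is harmless because left multiplication by \<open>n\<close>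
  carries \<open>s\<close> into \<open>t\<close>; changing \<open>n\<close> is harmless because
  \<open>t\<close> is a right congruence.\<close>

lemma RCong_comp:
  fixes r s t :: "'m::topological_monoid_mult rel"
  assumes s: "right_congruence s" and t: "right_congruence t" and n: "s \<subseteq> pullback_rel n t"
  shows "Comp (RCong TYPE('m)) r s t (t `` {n}) (s `` {m}) = t `` {n * m}"
proof -
  have "t `` {n' * m'} = t `` {n * m}" if "(m, m') \<in> s" "(n, n') \<in> t" for m' n'
  proof -
    have "(n * m, n * m') \<in> t" using n that by auto
    moreover have "(n * m', n' * m') \<in> t" using that right_congruence_mult[OF t] by blast
    ultimately have "(n * m, n' * m') \<in> t" by (rule right_congruence_trans[OF t])
    then show ?thesis using right_congruence_class_eq[OF t] by blast
  qed
  then have "(\<Union>m'\<in>s `` {m}. \<Union>n'\<in>t `` {n}. t `` {n' * m'}) = (\<Union>m'\<in>s `` {m}. \<Union>n'\<in>t `` {n}. t `` {n * m})"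
    by (intro SUP_cong) auto
  moreover have "s `` {m} \<noteq> {}" "t `` {n} \<noteq> {}" using right_congruence_refl s t by blast+
  ultimately show ?thesis by (simp add: RCong_def)
qed

lemma pullback_rel_mult: "\<lbrakk>r \<subseteq> pullback_rel m s; s \<subseteq> pullback_rel n t\<rbrakk> \<Longrightarrow> r \<subseteq> pullback_rel (n * m) t"
  by (force simp: mult.assoc)

lemma category_RCong: "category (RCong TYPE('m::topological_monoid_mult))"
  unfolding category_def
proof (intro conjI ballI)
  fix r :: "'m rel" assume "r \<in> Obj (RCong TYPE('m))"
  then show "Ident (RCong TYPE('m)) r \<in> Hom (RCong TYPE('m)) r r"
    by (auto intro!: exI[of _ 1])
next
  fix r s t :: "'m rel" and f g
  assume o: "r \<in> Obj (RCong TYPE('m))" "s \<in> Obj (RCong TYPE('m))" "t \<in> Obj (RCong TYPE('m))"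
    and "f \<in> Hom (RCong TYPE('m)) r s" "g \<in> Hom (RCong TYPE('m)) s t"
  then obtain m n where "f = s `` {m}" "r \<subseteq> pullback_rel m s" "g = t `` {n}" "s \<subseteq> pullback_rel n t" by auto
  then show "Comp (RCong TYPE('m)) r s t g f \<in> Hom (RCong TYPE('m)) r t"
    using o pullback_rel_mult[of r m s n t] by (auto simp: RCong_comp)
next
  fix r s :: "'m rel" and f
  assume o: "r \<in> Obj (RCong TYPE('m))" "s \<in> Obj (RCong TYPE('m))" and "f \<in> Hom (RCong TYPE('m)) r s"
  then obtain m where f: "f = s `` {m}" "r \<subseteq> pullback_rel m s" by auto
  show "Comp (RCong TYPE('m)) r r s f (Ident (RCong TYPE('m)) r) = f" using o f by (simp add: RCong_comp)
  have "s \<subseteq> pullback_rel 1 s" by auto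
  then show "Comp (RCong TYPE('m)) r s s (Ident (RCong TYPE('m)) s) f = f" using o f by (simp add: RCong_comp)
next
  fix r s t u :: "'m rel" and f g h
  assume o: "r \<in> Obj (RCong TYPE('m))" "s \<in> Obj (RCong TYPE('m))" "t \<in> Obj (RCong TYPE('m))"
    "u \<in> Obj (RCong TYPE('m))"
    and "f \<in> Hom (RCong TYPE('m)) r s" "g \<in> Hom (RCong TYPE('m)) s t" "h \<in> Hom (RCong TYPE('m)) t u"
  then obtain l m n where "f = s `` {l}" "r \<subseteq> pullback_rel l s" "g = t `` {m}" "s \<subseteq> pullback_rel m t"
    "h = u `` {n}" "t \<subseteq> pullback_rel n u" by auto
  then show "Comp (RCong TYPE('m)) r t u h (Comp (RCong TYPE('m)) r s t g f) =
      Comp (RCong TYPE('m)) r s u (Comp (RCong TYPE('m)) s t u h g) f"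
    using o pullback_rel_mult[of s m t n u] by (simp add: RCong_comp mult.assoc)
qed

section \<open>The category of continuous actions\<close>

lemma Cont_simps [simp]:
  "Obj (Cont \<U> TYPE('m::topological_monoid_mult)) = {X. pts X \<in> \<U> \<and> continuous_mset X}"
  "Hom (Cont \<U> TYPE('m)) = equivariant_maps"
  "Ident (Cont \<U> TYPE('m)) X = restrict (\<lambda>x. x) (pts X)"
  "Comp (Cont \<U> TYPE('m)) X Y Z g f = compose (pts X) g f"
  by (simp_all add: Cont_def)

lemma
  assumes "f \<in> equivariant_maps X Y" "x \<in> pts X"
  shows equivariant_pts: "f x \<in> pts Y" and equivariant_act: "f (act X x m) = act Y (f x) m"
  using assms unfolding equivariant_maps_def by auto

lemma equivariant_mapsI:
  assumes "\<And>x. x \<in> pts X \<Longrightarrow> f x \<in> pts Y" "\<And>x. x \<notin> pts X \<Longrightarrow> f x = undefined"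
    "\<And>x m. x \<in> pts X \<Longrightarrow> f (act X x m) = act Y (f x) m"
  shows "f \<in> equivariant_maps X Y"
  using assms unfolding equivariant_maps_def by auto

lemma equivariant_maps_eqI:
  assumes "f \<in> equivariant_maps X Y" "g \<in> equivariant_maps X Y" "\<And>x. x \<in> pts X \<Longrightarrow> f x = g x"
  shows "f = g"
  using assms unfolding equivariant_maps_def by (auto intro: PiE_ext)

lemma equivariant_compose:
  assumes "right_mset X" "f \<in> equivariant_maps X Y" "g \<in> equivariant_maps Y Z"
  shows "compose (pts X) g f \<in> equivariant_maps X Z"
  using assms by (intro equivariant_mapsI)
    (auto simp: compose_def act_in_pts equivariant_act equivariant_act[OF assms(3)] equivariant_pts
      intro!: equivariant_pts[OF assms(3)])

lemma equivariant_ident: "right_mset X \<Longrightarrow> restrict (\<lambda>x. x) (pts X) \<in> equivariant_maps X X"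
  by (intro equivariant_mapsI) (auto simp: act_in_pts)

lemma category_Cont: "category (Cont \<U> TYPE('m::topological_monoid_mult))"
  unfolding category_def
proof (intro conjI ballI)
  fix X Y and f assume o: "X \<in> Obj (Cont \<U> TYPE('m))" "Y \<in> Obj (Cont \<U> TYPE('m))"
    and f: "f \<in> Hom (Cont \<U> TYPE('m)) X Y"
  then have ext: "f \<in> extensional (pts X)" by (simp add: equivariant_maps_def PiE_def)
  show "Comp (Cont \<U> TYPE('m)) X X Y f (Ident (Cont \<U> TYPE('m)) X) = f"
    using ext by (auto simp: compose_def fun_eq_iff extensional_def)
  show "Comp (Cont \<U> TYPE('m)) X Y Y (Ident (Cont \<U> TYPE('m)) Y) f = f"
    using ext f by (auto simp: compose_def fun_eq_iff extensional_def equivariant_pts)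
next
  fix X Y Z and f g assume "X \<in> Obj (Cont \<U> TYPE('m))"
    "f \<in> Hom (Cont \<U> TYPE('m)) X Y" "g \<in> Hom (Cont \<U> TYPE('m)) Y Z"
  then show "Comp (Cont \<U> TYPE('m)) X Y Z g f \<in> Hom (Cont \<U> TYPE('m)) X Z"
    by (simp add: equivariant_compose)
qed (auto simp: equivariant_ident compose_def fun_eq_iff intro: equivariant_pts)

lemma iso_arrow_Cont:
  assumes X: "X \<in> Obj (Cont \<U> TYPE('m::topological_monoid_mult))" and f: "f \<in> equivariant_maps X Y"
    and bij: "bij_betw f (pts X) (pts Y)"
  shows "iso_arrow (Cont \<U> TYPE('m)) X Y f"
proof -
  define g where "g = restrict (inv_into (pts X) f) (pts Y)"
  have gf: "g (f x) = x" if "x \<in> pts X" for x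
    using bij that equivariant_pts[OF f that] by (simp add: g_def bij_betw_inv_into_left)
  have g: "g y \<in> pts X" "f (g y) = y" if "y \<in> pts Y" for y
    using bij that by (auto simp: g_def bij_betw_inv_into_right bij_betw_def intro: inv_into_into)
  have "g \<in> equivariant_maps Y X"
  proof (rule equivariant_mapsI)
    fix y m assume y: "y \<in> pts Y"
    have "act X (g y) m \<in> pts X" using X g y by (simp add: act_in_pts)
    moreover have "f (act X (g y) m) = act Y y m" using g y f by (simp add: equivariant_act)
    ultimately show "g (act Y y m) = act X (g y) m" using gf by metis
  qed (auto simp: g, simp add: g_def)
  moreover have "compose (pts X) g f = restrict (\<lambda>x. x) (pts X)" "compose (pts Y) f g = restrict (\<lambda>x. x) (pts Y)"
    using gf g by (auto simp: compose_def fun_eq_iff)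
  ultimately show ?thesis using f unfolding iso_arrow_def by auto
qed

text \<open>\<open>fixed X r\<close> is the hom-set from \<open>M/r\<close> to \<open>X\<close>, a map being identified with its value at the
  class of \<open>1\<close>; a morphism \<open>c\<close> of congruences then acts by \<open>class_act X _ c\<close>.\<close>

definition fixed :: "('u, 'm::topological_monoid_mult) mset \<Rightarrow> 'm rel \<Rightarrow> 'u set" where
  "fixed X r = {x \<in> pts X. \<forall>p q. (p, q) \<in> r \<longrightarrow> act X x p = act X x q}"

definition stabilizer :: "('u, 'm::topological_monoid_mult) mset \<Rightarrow> 'u \<Rightarrow> 'm rel" where
  "stabilizer X x = {(p, q). act X x p = act X x q}"

definition class_act :: "('u, 'm::topological_monoid_mult) mset \<Rightarrow> 'u \<Rightarrow> 'm set \<Rightarrow> 'u" where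
  "class_act X x c = act X x (SOME m. m \<in> c)"

lemma fixed_subset: "x \<in> fixed X r \<Longrightarrow> x \<in> pts X"
  by (simp add: fixed_def)

lemma fixedD: "\<lbrakk>x \<in> fixed X r; (p, q) \<in> r\<rbrakk> \<Longrightarrow> act X x p = act X x q"
  by (simp add: fixed_def)

lemma fixed_iff_stabilizer: "x \<in> fixed X r \<longleftrightarrow> x \<in> pts X \<and> r \<subseteq> stabilizer X x"
  by (auto simp: fixed_def stabilizer_def)

lemma mem_fixed_stabilizer: "x \<in> pts X \<Longrightarrow> x \<in> fixed X (stabilizer X x)"
  by (simp add: fixed_iff_stabilizer)

text \<open>The openness condition is continuity of the action at the point
  \<open>act X x p\<close>.\<close>

lemma continuous_congruence_stabilizer:
  assumes X: "continuous_mset X" and x: "x \<in> pts X"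
  shows "continuous_congruence (stabilizer X x)"
proof -
  have Xr: "right_mset X" using X by simp
  have mult: "act X x (p * m) = act X (act X x p) m" for p m using act_act[OF Xr x] by simp
  have "right_congruence (stabilizer X x)"
    by (rule right_congruenceI) (auto simp: stabilizer_def mult)
  moreover have "open {n. act X (act X x p) n = act X x q}" for p q
    using X x act_in_pts[OF Xr x] by (simp add: continuous_mset_iff)
  ultimately show ?thesis by (simp add: continuous_congruence_def stabilizer_def mult)
qed

text \<open>Related elements act equally on a fixed point, so the arbitrary representative chosen in
  \<open>class_act\<close> can be exchanged for \<open>m\<close>.\<close>

lemma class_act_eq:
  assumes x: "x \<in> fixed X s" and s: "right_congruence s"
  shows "class_act X x (s `` {m}) = act X x m"
proof -
  have "(SOME n. n \<in> s `` {m}) \<in> s `` {m}"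
    using right_congruence_refl[OF s, of m] by - (rule someI[of _ m], auto)
  then have "(m, SOME n. n \<in> s `` {m}) \<in> s" by auto
  from fixedD[OF x this] show ?thesis by (simp add: class_act_def)
qed

text \<open>This is precomposition of a map from \<open>M/s\<close> to \<open>X\<close> with the
  morphism \<open>[m]\<close> from \<open>M/r\<close> to \<open>M/s\<close>.\<close>

lemma act_mem_fixed:
  assumes X: "right_mset X" and x: "x \<in> fixed X s" and m: "r \<subseteq> pullback_rel m s"
  shows "act X x m \<in> fixed X r"
proof -
  have "act X (act X x m) p = act X (act X x m) q" if "(p, q) \<in> r" for p q
    using fixedD[OF x, of "m * p" "m * q"] m that act_act[OF X fixed_subset[OF x]] by auto
  then show ?thesis using act_in_pts[OF X fixed_subset[OF x]] by (simp add: fixed_def)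
qed

lemma equivariant_fixed:
  assumes "f \<in> equivariant_maps X Y" "x \<in> fixed X r"
  shows "f x \<in> fixed Y r"
  using assms unfolding fixed_def by (auto simp: equivariant_pts equivariant_act[symmetric])

lemma equivariant_class_act:
  assumes "f \<in> equivariant_maps X Y" "x \<in> pts X"
  shows "f (class_act X x c) = class_act Y (f x) c"
  using assms by (simp add: class_act_def equivariant_act)

text \<open>Natural transformations between the functors of fixed points come from equivariant maps,
  because every point \<open>x\<close> is fixed by its own stabilizer.\<close>

lemma fixed_natural_extends:
  assumes X: "continuous_mset X" and Y: "continuous_mset Y"
    and \<alpha>: "\<And>r x. \<lbrakk>continuous_congruence r; x \<in> fixed X r\<rbrakk> \<Longrightarrow> \<alpha> r x \<in> fixed Y r"
    and nat: "\<And>r s m x. \<lbrakk>continuous_congruence r; continuous_congruence s; r \<subseteq> pullback_rel m s; x \<in> fixed X s\<rbrakk>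
      \<Longrightarrow> \<alpha> r (act X x m) = act Y (\<alpha> s x) m"
  shows "\<exists>f\<in>equivariant_maps X Y. \<forall>r x. continuous_congruence r \<longrightarrow> x \<in> fixed X r \<longrightarrow> f x = \<alpha> r x"
proof -
  define f where "f = (\<lambda>x\<in>pts X. \<alpha> (stabilizer X x) x)"
  note st = continuous_congruence_stabilizer[OF X]
  have Xr: "right_mset X" and Yr: "right_mset Y" using X Y by auto
  have f: "f x = \<alpha> r x" if r: "continuous_congruence r" and x: "x \<in> fixed X r" for r x
  proof -
    note xp = fixed_subset[OF x]
    \<comment> \<open>\<open>[1]\<close> is a morphism from \<open>r\<close> to the stabilizer of
      \<open>x\<close>; naturality along it identifies \<open>\<alpha> r x\<close> with the value
      used to define \<open>f x\<close>.\<close>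
    have "r \<subseteq> pullback_rel 1 (stabilizer X x)" using x by (auto simp: fixed_iff_stabilizer)
    from nat[OF r st[OF xp] this mem_fixed_stabilizer[OF xp]]
    show ?thesis
      using \<alpha>[OF st[OF xp] mem_fixed_stabilizer[OF xp]] xp Xr Yr
      by (simp add: f_def act_one fixed_subset)
  qed
  have "f \<in> equivariant_maps X Y"
  proof (rule equivariant_mapsI)
    fix x assume x: "x \<in> pts X"
    note fx = f[OF st[OF x] mem_fixed_stabilizer[OF x]]
    show "f x \<in> pts Y" using \<alpha>[OF st[OF x] mem_fixed_stabilizer[OF x]] fx by (simp add: fixed_subset)
    fix m
    \<comment> \<open>This is the stabilizer of \<open>act X x m\<close>, and \<open>[m]\<close> is
      a morphism from it to the stabilizer of \<open>x\<close>. Naturality along \<open>[m]\<close>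
      is equivariance of \<open>f\<close>.\<close>
    let ?r = "pullback_rel m (stabilizer X x)"
    have r: "continuous_congruence ?r" using st[OF x] by (rule continuous_congruence_pullback)
    have "f (act X x m) = \<alpha> ?r (act X x m)"
      using f[OF r act_mem_fixed[OF Xr mem_fixed_stabilizer[OF x] order.refl]] .
    also have "\<dots> = act Y (f x) m"
      using nat[OF r st[OF x] order.refl mem_fixed_stabilizer[OF x]] fx by simp
    finally show "f (act X x m) = act Y (f x) m" .
  qed (simp add: f_def)
  with f show ?thesis by blast
qed

text \<open>Quotients and realizations are built over types other than that of the universe; an
  injection of their points onto a member of the universe carries the action along.\<close>

lemma transport_mset:
  fixes X :: "('a, 'm::topological_monoid_mult) mset"
  assumes U: "set_universe \<U>" and X: "continuous_mset X" and small: "small \<U> (pts X)"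
  shows "\<exists>Y\<in>Obj (Cont \<U> TYPE('m)). \<exists>j. bij_betw j (pts X) (pts Y) \<and>
    (\<forall>x\<in>pts X. \<forall>m. act Y (j x) m = j (act X x m))"
proof -
  have Xr: "right_mset X" using X by simp
  obtain j where j: "inj_on j (pts X)" "j ` pts X \<in> \<U>" using small_embedding[OF U small] .
  define Y where "Y = \<lparr>pts = j ` pts X, act = (\<lambda>y\<in>j ` pts X. \<lambda>m. j (act X (inv_into (pts X) j y) m))\<rparr>"
  have act: "act Y (j x) m = j (act X x m)" if "x \<in> pts X" for x m
    using that j by (simp add: Y_def)
  have pts: "pts Y = j ` pts X" by (simp add: Y_def)
  have "right_mset Y"
    unfolding right_mset_def
  proof (intro conjI)
    show "act Y \<in> pts Y \<rightarrow>\<^sub>E (UNIV \<rightarrow> pts Y)"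
    proof (rule PiE_I)
      fix y assume "y \<notin> pts Y"
      then show "act Y y = undefined" by (simp add: Y_def)
    qed (auto simp: pts act act_in_pts[OF Xr])
  qed (auto simp: pts act act_in_pts[OF Xr] act_one[OF Xr] act_act[OF Xr])
  moreover have "open {m. act Y y m = z}" if yz: "y \<in> pts Y" "z \<in> pts Y" for y z
  proof -
    obtain a b where ab: "a \<in> pts X" "y = j a" "b \<in> pts X" "z = j b" using yz by (auto simp: pts)
    then have "{m. act Y y m = z} = {m. act X a m = b}"
      using j(1) act_in_pts[OF Xr] by (auto simp: act inj_on_eq_iff)
    then show ?thesis using X ab by (simp add: continuous_mset_iff)
  qed
  ultimately have "Y \<in> Obj (Cont \<U> TYPE('m))" using j by (simp add: pts continuous_mset_iff)
  then show ?thesis using j act pts by (metis bij_betw_imageI)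
qed

section \<open>Supercompact objects\<close>

text \<open>Here \<open>Z\<close> is a quotient of \<open>Y\<close> with \<open>\<rho>\<close>
  choosing representatives: the last hypothesis says that the kernel of \<open>\<rho>\<close> is
  compatible with the action. Choosing representatives keeps the quotient inside the type of
  \<open>Y\<close>.\<close>

lemma continuous_mset_retract:
  assumes Y: "continuous_mset Y" and \<rho>: "\<And>y. y \<in> pts Y \<Longrightarrow> \<rho> y \<in> pts Y" "\<And>y. y \<in> pts Y \<Longrightarrow> \<rho> (\<rho> y) = \<rho> y"
    "\<And>y m. y \<in> pts Y \<Longrightarrow> \<rho> (act Y (\<rho> y) m) = \<rho> (act Y y m)"
  defines "Z \<equiv> \<lparr>pts = \<rho> ` pts Y, act = (\<lambda>z\<in>\<rho> ` pts Y. \<lambda>m. \<rho> (act Y z m))\<rparr>"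
  shows "continuous_mset Z" and "restrict \<rho> (pts Y) \<in> equivariant_maps Y Z"
proof -
  have Yr: "right_mset Y" using Y by simp
  have pts: "pts Z = \<rho> ` pts Y" by (simp add: Z_def)
  have act: "act Z (\<rho> y) m = \<rho> (act Y y m)" if "y \<in> pts Y" for y m
    using that \<rho> by (simp add: Z_def)
  have "right_mset Z"
    unfolding right_mset_def
  proof (intro conjI)
    show "act Z \<in> pts Z \<rightarrow>\<^sub>E (UNIV \<rightarrow> pts Z)"
    proof (rule PiE_I)
      fix z assume "z \<notin> pts Z"
      then show "act Z z = undefined" by (simp add: Z_def)
    qed (auto simp: pts act act_in_pts[OF Yr])
  qed (auto simp: pts act act_in_pts[OF Yr] act_one[OF Yr] act_act[OF Yr])
  moreover have "open {m. act Z z m = z'}" if zz: "z \<in> pts Z" "z' \<in> pts Z" for z z'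
  proof -
    obtain y where y: "y \<in> pts Y" "z = \<rho> y" using zz by (auto simp: pts)
    then have "{m. act Z z m = z'} = (\<Union>y'\<in>{y' \<in> pts Y. \<rho> y' = z'}. {m. act Y y m = y'})"
      using act_in_pts[OF Yr] by (auto simp: act)
    then show ?thesis using Y y by (auto simp: continuous_mset_iff)
  qed
  ultimately show "continuous_mset Z" by (simp add: continuous_mset_iff)
  show "restrict \<rho> (pts Y) \<in> equivariant_maps Y Z"
    by (rule equivariant_mapsI) (auto simp: pts act act_in_pts[OF Yr])
qed

lemma jointly_epic_imp_surjective:
  fixes Y :: "('u, 'm::topological_monoid_mult) mset"
  assumes U: "set_universe \<U>" and Y: "Y \<in> Obj (Cont \<U> TYPE('m))"
    and S: "sink (Cont \<U> TYPE('m)) Y S" and epic: "jointly_epic (Cont \<U> TYPE('m)) Y S"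
  shows "(\<Union>(A, f)\<in>S. f ` pts A) = pts Y"
proof (rule ccontr)
  define I where "I = (\<Union>(A, f)\<in>S. f ` pts A)"
  assume "(\<Union>(A, f)\<in>S. f ` pts A) \<noteq> pts Y"
  then have neq: "I \<noteq> pts Y" by (simp add: I_def)
  have Yc: "continuous_mset Y" and Yr: "right_mset Y" and YU: "pts Y \<in> \<U>" using Y by auto
  have SA: "continuous_mset A" "f \<in> equivariant_maps A Y" if "(A, f) \<in> S" for A f
    using S that by (auto simp: sink_def)
  have fI: "f a \<in> I" if "(A, f) \<in> S" "a \<in> pts A" for A f a using that by (auto simp: I_def)
  have "I \<subseteq> pts Y" using SA(2) by (auto simp: I_def intro: equivariant_pts)
  then obtain y where y: "y \<in> pts Y" "y \<notin> I" using neq by blast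
  have I_act: "act Y i m \<in> I" if i: "i \<in> I" for i m
  proof -
    obtain A f a where a: "(A, f) \<in> S" "a \<in> pts A" "i = f a" using i by (auto simp: I_def)
    then have "act Y i m = f (act A a m)" using SA(2)[OF a(1)] by (simp add: equivariant_act)
    then show ?thesis using a SA[OF a(1)] fI by (simp add: act_in_pts)
  qed
  \<comment> \<open>The quotient collapsing \<open>I\<close> to a point separates \<open>I\<close> from its complement; if \<open>I\<close> is empty,
    there is no point to collapse to, and two constant maps do the job.\<close>
  have "\<exists>Z g h. Z \<in> Obj (Cont \<U> TYPE('m)) \<and> g \<in> equivariant_maps Y Z \<and> h \<in> equivariant_maps Y Z \<and>
    (\<forall>i\<in>I. g i = h i) \<and> g y \<noteq> h y"
  proof (cases "I = {}")
    case True
    obtain X where X: "X \<in> \<U>" "infinite X" using U unfolding set_universe_def by blast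
    obtain a where a: "a \<in> X" using X(2) infinite_imp_nonempty by blast
    obtain b where b: "b \<in> X" "a \<noteq> b"
    proof -
      have "\<not> X \<subseteq> {a}" using X(2) finite_subset by blast
      then show thesis using that by blast
    qed
    define Z :: "('u, 'm) mset" where "Z = \<lparr>pts = {a, b}, act = (\<lambda>z\<in>{a, b}. \<lambda>m. z)\<rparr>"
    have "{a, b} \<lesssim> X" using a b by (intro subset_imp_lepoll) auto
    then have "{a, b} \<in> \<U>" using U X(1) unfolding set_universe_def by blast
    moreover have "right_mset Z"
      unfolding right_mset_def by (auto simp: Z_def)
    moreover have "open {m::'m. act Z z m = z'}" if "z \<in> pts Z" for z z'
      using that by (cases "z = z'") (simp_all add: Z_def)
    ultimately have Z: "Z \<in> Obj (Cont \<U> TYPE('m))" by (simp add: continuous_mset_iff) (simp add: Z_def)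
    have "restrict (\<lambda>_. c) (pts Y) \<in> equivariant_maps Y Z" if "c \<in> {a, b}" for c
      using that by (intro equivariant_mapsI) (auto simp: Z_def act_in_pts[OF Yr])
    then show ?thesis using Z b y True
      by (intro exI[of _ Z] exI[of _ "restrict (\<lambda>_. a) (pts Y)"] exI[of _ "restrict (\<lambda>_. b) (pts Y)"]) auto
  next
    case False
    then obtain i where i: "i \<in> I" by blast
    have ip: "i \<in> pts Y" using i \<open>I \<subseteq> pts Y\<close> by blast
    define \<rho> where "\<rho> = (\<lambda>y. if y \<in> I then i else y)"
    define Z where "Z = \<lparr>pts = \<rho> ` pts Y, act = (\<lambda>z\<in>\<rho> ` pts Y. \<lambda>m. \<rho> (act Y z m))\<rparr>"
    have \<rho>: "\<And>y. y \<in> pts Y \<Longrightarrow> \<rho> y \<in> pts Y" "\<And>y. y \<in> pts Y \<Longrightarrow> \<rho> (\<rho> y) = \<rho> y"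
      "\<And>y m. y \<in> pts Y \<Longrightarrow> \<rho> (act Y (\<rho> y) m) = \<rho> (act Y y m)"
      using i ip I_act by (auto simp: \<rho>_def)
    note Z = continuous_mset_retract[OF Yc \<rho>, folded Z_def]
    have "\<rho> ` pts Y \<in> \<U>" using U YU image_lepoll unfolding set_universe_def by blast
    then have ZU: "Z \<in> Obj (Cont \<U> TYPE('m))" using Z(1) by (simp add: Z_def)
    \<comment> \<open>\<open>I\<close> is closed under the action, so the collapsed point
      \<open>i\<close> is fixed in \<open>Z\<close> and the constant map at \<open>i\<close> is
      equivariant.\<close>
    have "restrict (\<lambda>_. i) (pts Y) \<in> equivariant_maps Y Z"
    proof (rule equivariant_mapsI)
      have "\<rho> i = i" using i by (simp add: \<rho>_def)
      then have im: "i \<in> \<rho> ` pts Y" using ip by (metis imageI)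
      have "act Z i m = i" for m using im I_act[OF i] by (simp add: Z_def \<rho>_def)
      then show "restrict (\<lambda>_. i) (pts Y) (act Y x m) = act Z (restrict (\<lambda>_. i) (pts Y) x) m"
        if "x \<in> pts Y" for x m using that act_in_pts[OF Yr that] by simp
      show "restrict (\<lambda>_. i) (pts Y) x \<in> pts Z" if "x \<in> pts Y" for x using that im by (simp add: Z_def)
    qed simp
    moreover have "restrict \<rho> (pts Y) j = restrict (\<lambda>_. i) (pts Y) j" if "j \<in> I" for j
      using that \<open>I \<subseteq> pts Y\<close> by (auto simp: \<rho>_def)
    moreover have "restrict \<rho> (pts Y) y \<noteq> restrict (\<lambda>_. i) (pts Y) y" using y i by (auto simp: \<rho>_def)
    ultimately show ?thesis using Z(2) ZU by blast
  qed
  then obtain Z g h where Z: "Z \<in> Obj (Cont \<U> TYPE('m))" and gh: "g \<in> equivariant_maps Y Z" "h \<in> equivariant_maps Y Z"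
    and eq: "\<forall>i\<in>I. g i = h i" and ne: "g y \<noteq> h y" by blast
  have "compose (pts A) g f = compose (pts A) h f" if "(A, f) \<in> S" for A f
    using eq fI[OF that] by (auto simp: compose_def fun_eq_iff)
  then have "g = h" using epic Z gh unfolding jointly_epic_def by (simp add: case_prod_beta')
  with ne show False by simp
qed

lemma surjective_imp_epi_arrow:
  fixes A Y :: "('u, 'm::topological_monoid_mult) mset"
  assumes f: "f \<in> equivariant_maps A Y" and surj: "f ` pts A = pts Y"
  shows "epi_arrow (Cont \<U> TYPE('m)) A Y f"
  unfolding epi_arrow_def
proof (intro conjI ballI impI)
  fix Z g h assume g: "g \<in> Hom (Cont \<U> TYPE('m)) Y Z" and h: "h \<in> Hom (Cont \<U> TYPE('m)) Y Z"
    and eq: "Comp (Cont \<U> TYPE('m)) A Y Z g f = Comp (Cont \<U> TYPE('m)) A Y Z h f"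
  have "g (f a) = h (f a)" if "a \<in> pts A" for a
    using fun_cong[OF eq, of a] that by (simp add: compose_def)
  then have "g y = h y" if "y \<in> pts Y" for y using that unfolding surj[symmetric] by blast
  then show "g = h" using g h by (auto intro: equivariant_maps_eqI)
qed (simp add: f)

definition cyclic :: "('u, 'm) mset \<Rightarrow> 'u \<Rightarrow> bool" where
  "cyclic X x \<longleftrightarrow> x \<in> pts X \<and> pts X \<subseteq> range (act X x)"

lemma cyclic_ptsE:
  assumes "cyclic X x" "y \<in> pts X"
  obtains m where "y = act X x m"
  using assms unfolding cyclic_def by blast

lemma supercompact_imp_cyclic:
  fixes Y :: "('u, 'm::topological_monoid_mult) mset"
  assumes U: "set_universe \<U>" and sc: "supercompact (Cont \<U> TYPE('m)) Y"
  shows "\<exists>y. cyclic Y y"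
proof -
  have Y: "Y \<in> Obj (Cont \<U> TYPE('m))" using sc by (simp add: supercompact_def)
  then have Yc: "continuous_mset Y" and Yr: "right_mset Y" and YU: "pts Y \<in> \<U>" by auto
  define orbit where "orbit = (\<lambda>y. \<lparr>pts = range (act Y y), act = restrict (act Y) (range (act Y y))\<rparr>)"
  define incl where "incl = (\<lambda>y. restrict (\<lambda>x. x) (range (act Y y)))"
  define S where "S = (\<lambda>y. (orbit y, incl y)) ` pts Y"
  have orbit: "orbit y \<in> Obj (Cont \<U> TYPE('m))" "incl y \<in> equivariant_maps (orbit y) Y"
    if y: "y \<in> pts Y" for y
  proof -
    have sub: "range (act Y y) \<subseteq> pts Y" using act_in_pts[OF Yr y] by auto
    then have "range (act Y y) \<in> \<U>"
      using U YU subset_imp_lepoll unfolding set_universe_def by blast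
    moreover have "right_mset (orbit y)"
      unfolding right_mset_def using act_in_pts[OF Yr y] act_act[OF Yr y] act_one[OF Yr]
      by (auto simp: orbit_def mult.assoc)
    moreover have "open {m. act (orbit y) x m = z}" if "x \<in> pts (orbit y)" "z \<in> pts (orbit y)" for x z
      using Yc that sub by (auto simp: continuous_mset_iff orbit_def)
    ultimately show "orbit y \<in> Obj (Cont \<U> TYPE('m))" by (simp add: continuous_mset_iff) (simp add: orbit_def)
    show "incl y \<in> equivariant_maps (orbit y) Y"
      using sub by (intro equivariant_mapsI) (auto simp: incl_def orbit_def act_act[OF Yr y])
  qed
  then have "sink (Cont \<U> TYPE('m)) Y S" by (auto simp: sink_def S_def)
  moreover have "jointly_epic (Cont \<U> TYPE('m)) Y S"
    unfolding jointly_epic_def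
  proof (intro ballI impI)
    fix Z g h assume g: "g \<in> Hom (Cont \<U> TYPE('m)) Y Z" and h: "h \<in> Hom (Cont \<U> TYPE('m)) Y Z"
      and eq: "\<forall>(A, f)\<in>S. Comp (Cont \<U> TYPE('m)) A Y Z g f = Comp (Cont \<U> TYPE('m)) A Y Z h f"
    have "g y = h y" if y: "y \<in> pts Y" for y
    proof -
      have "compose (pts (orbit y)) g (incl y) = compose (pts (orbit y)) h (incl y)"
        using eq y by (simp add: S_def)
      from fun_cong[OF this, of y] show ?thesis
        using range_eqI[of y "act Y y" 1] act_one[OF Yr y] by (simp add: compose_def incl_def orbit_def)
    qed
    then show "g = h" using g h by (auto intro: equivariant_maps_eqI)
  qed
  ultimately obtain A f where Af: "(A, f) \<in> S" and epi: "epi_arrow (Cont \<U> TYPE('m)) A Y f"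
    using sc unfolding supercompact_def by blast
  then obtain y where y: "y \<in> pts Y" "A = orbit y" "f = incl y" by (auto simp: S_def)
  \<comment> \<open>An epimorphism is a jointly epic family with one member, hence surjective; the
    orbit of \<open>y\<close> is therefore all of \<open>Y\<close>.\<close>
  have "sink (Cont \<U> TYPE('m)) Y {(A, f)}" using orbit[OF y(1)] y by (simp add: sink_def)
  moreover have "jointly_epic (Cont \<U> TYPE('m)) Y {(A, f)}"
    using epi unfolding epi_arrow_def jointly_epic_def by simp
  ultimately have "f ` pts A = pts Y" using jointly_epic_imp_surjective[OF U Y] by fastforce
  then show ?thesis using y unfolding cyclic_def by (auto simp: incl_def orbit_def)
qed

text \<open>A jointly epic family is jointly onto, so one member hits the generator; its image is
  closed under the action, so this member is onto and epic.\<close>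

lemma cyclic_imp_supercompact:
  fixes Y :: "('u, 'm::topological_monoid_mult) mset"
  assumes U: "set_universe \<U>" and Y: "Y \<in> Obj (Cont \<U> TYPE('m))" and y: "cyclic Y y"
  shows "supercompact (Cont \<U> TYPE('m)) Y"
  unfolding supercompact_def
proof (intro conjI allI impI Y)
  fix S assume S: "sink (Cont \<U> TYPE('m)) Y S \<and> jointly_epic (Cont \<U> TYPE('m)) Y S"
  then have "y \<in> (\<Union>(A, f)\<in>S. f ` pts A)" using jointly_epic_imp_surjective[OF U Y, of S] y by (simp add: cyclic_def)
  then obtain A f a where a: "(A, f) \<in> S" "a \<in> pts A" "y = f a" by auto
  have A: "right_mset A" and f: "f \<in> equivariant_maps A Y" using S a(1) by (auto simp: sink_def)
  have "f ` pts A = pts Y"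
  proof
    show "f ` pts A \<subseteq> pts Y" using f by (auto intro: equivariant_pts)
    show "pts Y \<subseteq> f ` pts A"
    proof
      fix z assume "z \<in> pts Y"
      then obtain m where "z = act Y y m" using y by (auto simp: cyclic_def)
      then have "z = f (act A a m)" using a f by (simp add: equivariant_act)
      then show "z \<in> f ` pts A" using act_in_pts[OF A a(2)] by blast
    qed
  qed
  then show "\<exists>(A, f)\<in>S. epi_arrow (Cont \<U> TYPE('m)) A Y f" using a f surjective_imp_epi_arrow by blast
qed

section \<open>Maps out of cyclic objects and the first equivalence\<close>

lemma cyclic_maps_eqI:
  assumes "cyclic Y y" "f \<in> equivariant_maps Y X" "g \<in> equivariant_maps Y X" "f y = g y"
  shows "f = g"
proof (rule equivariant_maps_eqI[OF assms(2,3)])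
  fix x assume "x \<in> pts Y"
  then obtain m where "x = act Y y m" using assms(1) by (auto simp: cyclic_def)
  then show "f x = g x" using assms by (simp add: cyclic_def equivariant_act)
qed

text \<open>The universal property of \<open>M/r\<close>, for \<open>r\<close> the stabilizer of the
  generator: sending \<open>act Y y n\<close> to \<open>act X x n\<close> is well defined because
  \<open>x\<close> is fixed by \<open>r\<close>.\<close>

lemma cyclic_map_exists:
  assumes Y: "right_mset Y" and X: "right_mset X" and y: "cyclic Y y" and x: "x \<in> fixed X (stabilizer Y y)"
  shows "\<exists>f\<in>equivariant_maps Y X. f y = x"
proof -
  have yp: "y \<in> pts Y" using y by (simp add: cyclic_def)
  define f where "f = (\<lambda>z\<in>pts Y. act X x (SOME n. act Y y n = z))"
  have f: "f (act Y y n) = act X x n" for n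
  proof -
    have "act Y y (SOME k. act Y y k = act Y y n) = act Y y n" by (rule someI) simp
    then have "(SOME k. act Y y k = act Y y n, n) \<in> stabilizer Y y" by (simp add: stabilizer_def)
    from fixedD[OF x this] show ?thesis using act_in_pts[OF Y yp] by (simp add: f_def)
  qed
  have "f \<in> equivariant_maps Y X"
  proof (rule equivariant_mapsI)
    fix z m assume "z \<in> pts Y"
    then obtain n where n: "z = act Y y n" using y by (auto simp: cyclic_def)
    show "f z \<in> pts X" using act_in_pts[OF X fixed_subset[OF x]] by (simp add: n f)
    show "f (act Y z m) = act X (f z) m"
      using act_act[OF X fixed_subset[OF x]] act_act[OF Y yp] by (simp add: n f)
  qed (simp add: f_def)
  moreover have "f y = x" using f[of 1] act_one[OF Y yp] act_one[OF X fixed_subset[OF x]] by simp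
  ultimately show ?thesis by blast
qed

text \<open>The object is a copy of \<open>M/r\<close> inside the universe, generated by the class
  of \<open>1\<close>; it is small because it is an image of the monoid.\<close>

lemma cyclic_object_exists:
  assumes U: "set_universe \<U>" and small: "small \<U> (UNIV :: 'm::topological_monoid_mult set)"
    and r: "continuous_congruence (r :: 'm rel)"
  shows "\<exists>Y y. Y \<in> Obj (Cont \<U> TYPE('m)) \<and> cyclic Y y \<and> stabilizer Y y = r"
proof -
  have rr: "right_congruence r" using r by simp
  let ?Q = "quotient_mset r"
  have "small \<U> (pts ?Q)"
    using small small_lepoll[OF _ image_lepoll] by (simp add: quotient_mset_pts)
  moreover have "continuous_mset ?Q" using r by (simp add: continuous_mset_quotient_iff)
  ultimately obtain Y j where Y: "Y \<in> Obj (Cont \<U> TYPE('m))" and j: "bij_betw j (pts ?Q) (pts Y)"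
    and act: "\<And>x m. x \<in> pts ?Q \<Longrightarrow> act Y (j x) m = j (act ?Q x m)"
    using transport_mset[OF U] by blast
  have act': "act Y (j (r `` {1})) m = j (r `` {m})" for m
    using act[of "r `` {1}"] quotient_mset_act[OF rr, of 1 m] by (simp add: quotient_mset_pts)
  have "cyclic Y (j (r `` {1}))"
    using j by (auto simp: cyclic_def act' bij_betw_def quotient_mset_pts)
  moreover have "(p, q) \<in> stabilizer Y (j (r `` {1})) \<longleftrightarrow> (p, q) \<in> r" for p q
  proof -
    have "j (r `` {p}) = j (r `` {q}) \<longleftrightarrow> r `` {p} = r `` {q}"
      by (rule inj_on_eq_iff[OF bij_betw_imp_inj_on[OF j]]) (auto simp: quotient_mset_pts)
    then show ?thesis by (simp add: stabilizer_def act' right_congruence_class_eq[OF rr])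
  qed
  then have "stabilizer Y (j (r `` {1})) = r" by auto
  ultimately show ?thesis using Y by blast
qed

text \<open>The functor takes \<open>r\<close> to a chosen copy \<open>Y0 r\<close> of
  \<open>M/r\<close>, and a class \<open>c\<close> to the map sending the generator
  \<open>y0 r\<close> to the translate of \<open>y0 s\<close> by \<open>c\<close>. Maps out of a
  cyclic object are determined at the generator, so every equation of maps is checked there.\<close>

lemma RCong_equivalent_supercompact:
  assumes U: "set_universe \<U>" and small: "small \<U> (UNIV :: 'm::topological_monoid_mult set)"
  shows "RCong TYPE('m) \<simeq>\<^sub>c supercompact_objects (Cont \<U> TYPE('m))"
proof -
  let ?R = "RCong TYPE('m)" and ?S = "supercompact_objects (Cont \<U> TYPE('m))"
  obtain Y0 :: "'m rel \<Rightarrow> ('a, 'm) mset" and y0 where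
    Y0: "\<And>r. continuous_congruence r \<Longrightarrow> Y0 r \<in> Obj (Cont \<U> TYPE('m))"
    and y0: "\<And>r. continuous_congruence r \<Longrightarrow> cyclic (Y0 r) (y0 r)"
    and st: "\<And>r. continuous_congruence r \<Longrightarrow> stabilizer (Y0 r) (y0 r) = r"
    using cyclic_object_exists[OF U small] by metis
  have Yr: "right_mset (Y0 r)" if "continuous_congruence r" for r using Y0[OF that] by simp
  have yp: "y0 r \<in> pts (Y0 r)" if "continuous_congruence r" for r using y0[OF that] by (simp add: cyclic_def)
  have fx: "y0 r \<in> fixed (Y0 r) r" if "continuous_congruence r" for r
    using yp[OF that] st[OF that] by (simp add: fixed_iff_stabilizer)
  have ex: "\<exists>f. continuous_congruence r \<and> continuous_congruence s \<and> c \<in> Hom ?R r s \<longrightarrow>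
      f \<in> equivariant_maps (Y0 r) (Y0 s) \<and> f (y0 r) = class_act (Y0 s) (y0 s) c" for r s c
  proof (cases "continuous_congruence r \<and> continuous_congruence s \<and> c \<in> Hom ?R r s")
    case True
    then obtain m where m: "c = s `` {m}" "r \<subseteq> pullback_rel m s" by auto
    have "act (Y0 s) (y0 s) m \<in> fixed (Y0 s) (stabilizer (Y0 r) (y0 r))"
      using act_mem_fixed[OF Yr fx m(2)] True st by simp
    moreover have "class_act (Y0 s) (y0 s) c = act (Y0 s) (y0 s) m"
      unfolding m(1) using True by (intro class_act_eq fx) simp_all
    ultimately show ?thesis using cyclic_map_exists[OF Yr[of r] Yr[of s] y0[of r]] True by auto
  qed auto
  obtain \<phi> where \<phi>': "\<And>r s c. continuous_congruence r \<and> continuous_congruence s \<and> c \<in> Hom ?R r s \<Longrightarrow>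
      \<phi> r s c \<in> equivariant_maps (Y0 r) (Y0 s) \<and> \<phi> r s c (y0 r) = class_act (Y0 s) (y0 s) c"
    using ex by metis
  have \<phi>: "\<phi> r s (s `` {m}) \<in> equivariant_maps (Y0 r) (Y0 s)" "\<phi> r s (s `` {m}) (y0 r) = act (Y0 s) (y0 s) m"
    if "continuous_congruence r" "continuous_congruence s" "r \<subseteq> pullback_rel m s" for r s m
    using \<phi>'[of r s "s `` {m}"] that class_act_eq[OF fx] by auto
  define F where "F = \<lparr>omap = Y0, amap = \<phi>\<rparr>"
  have "is_functor ?R ?S F"
    unfolding is_functor_def
  proof (intro conjI ballI)
    fix r assume "r \<in> Obj ?R"
    then have r: "continuous_congruence r" by simp
    show "omap F r \<in> Obj ?S"
      using Y0[OF r] cyclic_imp_supercompact[OF U Y0[OF r] y0[OF r]]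
      by (simp add: F_def supercompact_objects_def)
    have one: "r \<subseteq> pullback_rel 1 r" by auto
    have "\<phi> r r (r `` {1}) = restrict (\<lambda>x. x) (pts (Y0 r))"
      using \<phi>[OF r r one] equivariant_ident[OF Yr[OF r]] act_one[OF Yr[OF r] yp[OF r]] yp[OF r]
      by - (rule cyclic_maps_eqI[OF y0[OF r]], auto)
    then show "amap F r r (Ident ?R r) = Ident ?S (omap F r)" by (simp add: F_def supercompact_objects_def)
  next
    fix r s c assume "r \<in> Obj ?R" "s \<in> Obj ?R" "c \<in> Hom ?R r s"
    then show "amap F r s c \<in> Hom ?S (omap F r) (omap F s)"
      using \<phi>' by (simp add: F_def supercompact_objects_def)
  next
    fix r s t c d assume o: "r \<in> Obj ?R" "s \<in> Obj ?R" "t \<in> Obj ?R" "c \<in> Hom ?R r s" "d \<in> Hom ?R s t"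
    then have r: "continuous_congruence r" and s: "continuous_congruence s" and t: "continuous_congruence t"
      by simp_all
    obtain m n where m: "c = s `` {m}" "r \<subseteq> pullback_rel m s" and n: "d = t `` {n}" "s \<subseteq> pullback_rel n t"
      using o by auto
    note nm = pullback_rel_mult[OF m(2) n(2)]
    have "\<phi> r t (t `` {n * m}) = compose (pts (Y0 r)) (\<phi> s t (t `` {n})) (\<phi> r s (s `` {m}))"
    proof (rule cyclic_maps_eqI[OF y0[OF r]])
      show "compose (pts (Y0 r)) (\<phi> s t (t `` {n})) (\<phi> r s (s `` {m})) \<in> equivariant_maps (Y0 r) (Y0 t)"
        using equivariant_compose[OF Yr[OF r] \<phi>(1)[OF r s m(2)] \<phi>(1)[OF s t n(2)]] .
      show "\<phi> r t (t `` {n * m}) (y0 r) = compose (pts (Y0 r)) (\<phi> s t (t `` {n})) (\<phi> r s (s `` {m})) (y0 r)"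
        using yp[OF r] act_act[OF Yr[OF t] yp[OF t]] equivariant_act[OF \<phi>(1)[OF s t n(2)] yp[OF s]]
        by (simp add: compose_def \<phi>(2)[OF r s m(2)] \<phi>(2)[OF s t n(2)] \<phi>(2)[OF r t nm])
    qed (rule \<phi>(1)[OF r t nm])
    then show "amap F r t (Comp ?R r s t d c) = Comp ?S (omap F r) (omap F s) (omap F t) (amap F s t d) (amap F r s c)"
      using s t n by (simp add: F_def supercompact_objects_def m(1) n(1) RCong_comp)
  qed
  moreover have "bij_betw (amap F r s) (Hom ?R r s) (Hom ?S (omap F r) (omap F s))"
    if o: "r \<in> Obj ?R" "s \<in> Obj ?R" for r s
  proof (rule bij_betw_imageI)
    have r: "continuous_congruence r" and s: "continuous_congruence s" using o by simp_all
    then have sr: "right_congruence s" by simp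
    show "inj_on (amap F r s) (Hom ?R r s)"
    proof (rule inj_onI)
      fix c d assume cd: "c \<in> Hom ?R r s" "d \<in> Hom ?R r s" "amap F r s c = amap F r s d"
      obtain m n where m: "c = s `` {m}" "r \<subseteq> pullback_rel m s" and n: "d = s `` {n}" "r \<subseteq> pullback_rel n s"
        using cd by auto
      have "act (Y0 s) (y0 s) m = act (Y0 s) (y0 s) n"
        using cd(3) \<phi>(2)[OF r s m(2)] \<phi>(2)[OF r s n(2)] by (simp add: F_def m(1) n(1))
      then have "(m, n) \<in> s" using st[OF s] by (auto simp: stabilizer_def)
      then show "c = d" using m n right_congruence_class_eq[OF sr] by simp
    qed
    show "amap F r s ` Hom ?R r s = Hom ?S (omap F r) (omap F s)"
    proof (intro equalityI subsetI)
      fix f assume "f \<in> amap F r s ` Hom ?R r s"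
      then show "f \<in> Hom ?S (omap F r) (omap F s)"
        using \<phi>'[of r s] r s by (auto simp: F_def supercompact_objects_def)
    next
      fix f assume "f \<in> Hom ?S (omap F r) (omap F s)"
      then have f: "f \<in> equivariant_maps (Y0 r) (Y0 s)" by (simp add: F_def supercompact_objects_def)
      obtain m where m: "f (y0 r) = act (Y0 s) (y0 s) m"
        using equivariant_pts[OF f yp[OF r]] y0[OF s] by (auto simp: cyclic_def)
      have "f (y0 r) \<in> fixed (Y0 s) r" using equivariant_fixed[OF f fx[OF r]] .
      \<comment> \<open>The image of \<open>y0 r\<close> is the translate of \<open>y0 s\<close> by
        \<open>m\<close>; that \<open>r\<close> fixes it is precisely the condition for
        \<open>[m]\<close> to be a morphism from \<open>r\<close> to \<open>s\<close>.\<close>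
      then have "r \<subseteq> pullback_rel m (stabilizer (Y0 s) (y0 s))"
        by (auto simp: fixed_def m act_act[OF Yr[OF s] yp[OF s]] stabilizer_def)
      then have rm: "r \<subseteq> pullback_rel m s" by (simp add: st[OF s])
      have "f = \<phi> r s (s `` {m})"
        using cyclic_maps_eqI[OF y0[OF r] f \<phi>(1)[OF r s rm]] \<phi>(2)[OF r s rm] m by simp
      then show "f \<in> amap F r s ` Hom ?R r s" using rm by (auto simp: F_def)
    qed
  qed
  moreover have "\<exists>r\<in>Obj ?R. \<exists>f. iso_arrow ?S (omap F r) Z f" if Z: "Z \<in> Obj ?S" for Z
  proof -
    have Zo: "Z \<in> Obj (Cont \<U> TYPE('m))" "supercompact (Cont \<U> TYPE('m)) Z"
      using Z by (simp_all add: supercompact_objects_def)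
    then have Zc: "continuous_mset Z" by simp
    obtain z where z: "cyclic Z z" using supercompact_imp_cyclic[OF U Zo(2)] by blast
    then have zp: "z \<in> pts Z" by (simp add: cyclic_def)
    \<comment> \<open>A cyclic object is isomorphic to the copy of \<open>M/r\<close> for
      \<open>r\<close> the stabilizer of any of its generators.\<close>
    define r where "r = stabilizer Z z"
    have r: "continuous_congruence r" unfolding r_def using Zc zp by (rule continuous_congruence_stabilizer)
    have "z \<in> fixed Z (stabilizer (Y0 r) (y0 r))" using mem_fixed_stabilizer[OF zp] st[OF r] by (simp add: r_def)
    then obtain f where f: "f \<in> equivariant_maps (Y0 r) Z" "f (y0 r) = z"
      using cyclic_map_exists[OF Yr[OF r] continuous_mset_imp_right[OF Zc] y0[OF r]] by blast
    have fa: "f (act (Y0 r) (y0 r) m) = act Z z m" for m using equivariant_act[OF f(1) yp[OF r]] f(2) by simp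
    have "inj_on f (pts (Y0 r))"
    proof (rule inj_onI)
      fix a b assume ab: "a \<in> pts (Y0 r)" "b \<in> pts (Y0 r)" "f a = f b"
      obtain p q where pq: "a = act (Y0 r) (y0 r) p" "b = act (Y0 r) (y0 r) q"
        using cyclic_ptsE[OF y0[OF r] ab(1)] cyclic_ptsE[OF y0[OF r] ab(2)] by metis
      have "(p, q) \<in> r" using ab(3) fa by (simp add: pq r_def stabilizer_def)
      then show "a = b" using st[OF r] by (auto simp: pq stabilizer_def)
    qed
    moreover have "f ` pts (Y0 r) = pts Z"
    proof
      show "pts Z \<subseteq> f ` pts (Y0 r)"
      proof
        fix x assume "x \<in> pts Z"
        then obtain m where "x = act Z z m" using z by (auto simp: cyclic_def)
        then show "x \<in> f ` pts (Y0 r)" using fa act_in_pts[OF Yr[OF r] yp[OF r]] by (metis imageI)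
      qed
    qed (use f(1) in \<open>auto intro: equivariant_pts\<close>)
    ultimately have "iso_arrow (Cont \<U> TYPE('m)) (Y0 r) Z f"
      using iso_arrow_Cont[OF Y0[OF r] f(1)] by (simp add: bij_betw_def)
    then show ?thesis using r by (auto simp: F_def supercompact_objects_def)
  qed
  ultimately have "weak_equivalence ?R ?S F" unfolding weak_equivalence_def by blast
  then show ?thesis
    by (intro weak_equivalence_imp_equivalent_cats category_RCong)
      (auto simp: supercompact_objects_def intro: category_full_subcategory category_Cont)
qed

section \<open>Sheaves on the category of congruences\<close>

lemma pullback_rel_one [simp]: "pullback_rel 1 r = r"
  by (auto simp: pullback_rel_def)

lemma pullback_rel_pullback_rel [simp]: "pullback_rel n (pullback_rel m r) = pullback_rel (m * n) r"
  by (auto simp: pullback_rel_def mult.assoc)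

lemma pullback_rel_mono: "r \<subseteq> s \<Longrightarrow> pullback_rel m r \<subseteq> pullback_rel m s"
  by (auto simp: pullback_rel_def)

text \<open>A presheaf on the category of congruences, with \<open>res w r p\<close> the restriction along the morphism
  \<open>[p]\<close> from \<open>w\<close> to \<open>r\<close>. The sheaf condition is only needed for the covers \<open>[1]\<close>, which are the
  projections from \<open>M/r\<close> to \<open>M/s\<close>.\<close>

locale congruence_sheaf =
  fixes P :: "'m::topological_monoid_mult rel \<Rightarrow> 'a set" and res :: "'m rel \<Rightarrow> 'm rel \<Rightarrow> 'm \<Rightarrow> 'a \<Rightarrow> 'a"
  assumes res_in: "\<lbrakk>continuous_congruence w; continuous_congruence r; w \<subseteq> pullback_rel p r; x \<in> P r\<rbrakk>
      \<Longrightarrow> res w r p x \<in> P w"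
    and res_one: "\<lbrakk>continuous_congruence r; x \<in> P r\<rbrakk> \<Longrightarrow> res r r 1 x = x"
    and res_res: "\<lbrakk>continuous_congruence v; continuous_congruence w; continuous_congruence r;
        v \<subseteq> pullback_rel q w; w \<subseteq> pullback_rel p r; x \<in> P r\<rbrakk>
      \<Longrightarrow> res v w q (res w r p x) = res v r (p * q) x"
    and res_cong: "\<lbrakk>continuous_congruence w; continuous_congruence r; w \<subseteq> pullback_rel p r; x \<in> P r;
        (p, q) \<in> r\<rbrakk> \<Longrightarrow> res w r p x = res w r q x"
    and glue: "\<lbrakk>continuous_congruence r; continuous_congruence s; r \<subseteq> s; x \<in> P r;
        \<And>w p q. \<lbrakk>continuous_congruence w; w \<subseteq> pullback_rel p r; w \<subseteq> pullback_rel q r; (p, q) \<in> s\<rbrakk>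
          \<Longrightarrow> res w r p x = res w r q x\<rbrakk>
      \<Longrightarrow> \<exists>!y. y \<in> P s \<and> res r s 1 y = x"
begin

text \<open>The largest congruence to which \<open>x\<close> descends.\<close>

definition descent :: "'m rel \<Rightarrow> 'a \<Rightarrow> 'm rel" where
  "descent r x = {(p, q). \<exists>w. continuous_congruence w \<and> w \<subseteq> pullback_rel p r \<and> w \<subseteq> pullback_rel q r \<and>
    res w r p x = res w r q x}"

definition descended :: "'m rel \<Rightarrow> 'a \<Rightarrow> 'a" where
  "descended r x = (THE y. y \<in> P (descent r x) \<and> res r (descent r x) 1 y = x)"

definition point :: "'m rel \<Rightarrow> 'a \<Rightarrow> 'm rel \<times> 'a" where
  "point r x = (descent r x, descended r x)"

text \<open>Restriction along inclusions is injective and congruences are closed under intersection,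
  so the colimit of \<open>P\<close> over inclusions is a directed union. Each element has a normal
  form, at the largest congruence to which it descends; taking the normal forms as points avoids
  equivalence classes.\<close>

definition points :: "('m rel \<times> 'a) set" where
  "points = {(r, x). continuous_congruence r \<and> x \<in> P r \<and> descent r x = r}"

definition realization :: "('m rel \<times> 'a, 'm) mset" where
  "realization = \<lparr>pts = points, act = (\<lambda>(r, x)\<in>points. \<lambda>m. point (pullback_rel m r) (res (pullback_rel m r) r m x))\<rparr>"

section \<open>Descent to the largest congruence and normal forms\<close>

lemma res_restrict:
  assumes "continuous_congruence w" "continuous_congruence r" "continuous_congruence s"
    "w \<subseteq> pullback_rel p r" "r \<subseteq> s" "y \<in> P s"
  shows "res w r p (res r s 1 y) = res w s p y"
  using res_res[of w r s p 1 y] assms by simp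

text \<open>A restriction from \<open>s\<close> is compatible with the cover \<open>[1]\<close> from
  \<open>r\<close> to \<open>s\<close>, because \<open>s\<close>-related \<open>p\<close> and
  \<open>q\<close> name the same morphism to \<open>s\<close>. Both \<open>x\<close> and
  \<open>y\<close> amalgamate the same datum, and gluing is unique.\<close>

lemma res_one_inj:
  assumes r: "continuous_congruence r" and s: "continuous_congruence s" and sub: "r \<subseteq> s"
    and xy: "x \<in> P s" "y \<in> P s" "res r s 1 x = res r s 1 y"
  shows "x = y"
proof -
  have "res w r p (res r s 1 x) = res w r q (res r s 1 x)"
    if "continuous_congruence w" "w \<subseteq> pullback_rel p r" "w \<subseteq> pullback_rel q r" "(p, q) \<in> s" for w p q
    using that r s sub xy(1) pullback_rel_mono[OF sub, of p]
    by (simp add: res_restrict res_cong[of w s p x q])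
  moreover have "res r s 1 x \<in> P r" using res_in[OF r s _ xy(1), of 1] sub by simp
  ultimately show ?thesis using glue[OF r s sub, of "res r s 1 x"] xy by metis
qed

text \<open>The definition of \<open>descent\<close> asks for some stage at which the restrictions
  agree. Comparing with the given stage \<open>w\<close> on their intersection, where restriction is
  injective, shows that any stage decides.\<close>

lemma mem_descent_iff:
  assumes r: "continuous_congruence r" and x: "x \<in> P r"
    and w: "continuous_congruence w" "w \<subseteq> pullback_rel p r" "w \<subseteq> pullback_rel q r"
  shows "(p, q) \<in> descent r x \<longleftrightarrow> res w r p x = res w r q x"
proof
  assume "(p, q) \<in> descent r x"
  then obtain v where v: "continuous_congruence v" "v \<subseteq> pullback_rel p r" "v \<subseteq> pullback_rel q r"
    "res v r p x = res v r q x" unfolding descent_def by auto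
  have vw: "continuous_congruence (v \<inter> w)" using v(1) w(1) by (rule continuous_congruence_Int)
  have "res (v \<inter> w) w 1 (res w r p x) = res (v \<inter> w) w 1 (res w r q x)"
    using res_res[OF vw w(1) r, of 1 p x] res_res[OF vw w(1) r, of 1 q x]
      res_res[OF vw v(1) r, of 1 p x] res_res[OF vw v(1) r, of 1 q x] v w x by simp
  then show "res w r p x = res w r q x"
    using res_one_inj[OF vw w(1)] res_in[OF w(1) r _ x] w by simp
qed (use w in \<open>auto simp: descent_def\<close>)

lemma subset_descent:
  assumes r: "continuous_congruence r" and x: "x \<in> P r"
  shows "r \<subseteq> descent r x"
proof clarify
  fix p q assume pq: "(p, q) \<in> r"
  let ?w = "pullback_rel p r \<inter> pullback_rel q r"
  have w: "continuous_congruence ?w"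
    using r by (intro continuous_congruence_Int continuous_congruence_pullback)
  then show "(p, q) \<in> descent r x" using mem_descent_iff[OF r x w] res_cong[OF w r _ x pq] by simp
qed

lemma continuous_congruence_descent:
  assumes r: "continuous_congruence r" and x: "x \<in> P r"
  shows "continuous_congruence (descent r x)"
proof (rule continuous_congruence_supset[OF r _ subset_descent[OF r x]], rule right_congruenceI)
  fix p q l m
  note pb = continuous_congruence_pullback[OF r]
  \<comment> \<open>A stage at which \<open>[p]\<close>, \<open>[q]\<close> and \<open>[l]\<close>
    are all morphisms to \<open>r\<close>, so that transitivity becomes transitivity of
    equality.\<close>
  let ?w = "pullback_rel p r \<inter> pullback_rel q r \<inter> pullback_rel l r"
  have w: "continuous_congruence ?w" using pb by (intro continuous_congruence_Int)
  show "(p, p) \<in> descent r x" using mem_descent_iff[OF r x pb order.refl order.refl] by simp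
  show "(q, p) \<in> descent r x" if "(p, q) \<in> descent r x" using that unfolding descent_def by auto
  show "(p, l) \<in> descent r x" if "(p, q) \<in> descent r x" "(q, l) \<in> descent r x"
    using that mem_descent_iff[OF r x w, of p q] mem_descent_iff[OF r x w, of q l]
      mem_descent_iff[OF r x w, of p l] by (simp add: le_infI1)
  show "(p * m, q * m) \<in> descent r x" if pq: "(p, q) \<in> descent r x"
  proof -
    let ?v = "pullback_rel p r \<inter> pullback_rel q r"
    have v: "continuous_congruence ?v" using pb by (intro continuous_congruence_Int)
    then have mv: "continuous_congruence (pullback_rel m ?v)" by (rule continuous_congruence_pullback)
    have "pullback_rel m ?v = pullback_rel (p * m) r \<inter> pullback_rel (q * m) r"
      by (auto simp: mult.assoc)
    moreover have "res ?v r p x = res ?v r q x" using pq mem_descent_iff[OF r x v] by simp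
    ultimately show ?thesis
      using mem_descent_iff[OF r x mv, of "p * m" "q * m"] res_res[OF mv v r order.refl _ x, of p]
        res_res[OF mv v r order.refl _ x, of q] by simp
  qed
qed

text \<open>By \<open>mem_descent_iff\<close>, \<open>x\<close> is compatible with the cover from
  \<open>r\<close> to \<open>descent r x\<close>, so gluing makes the definite description in
  \<open>descended\<close> meaningful.\<close>

lemma
  assumes r: "continuous_congruence r" and x: "x \<in> P r"
  shows descended_in: "descended r x \<in> P (descent r x)"
    and res_descended: "res r (descent r x) 1 (descended r x) = x"
proof -
  have "res w r p x = res w r q x" if "continuous_congruence w" "w \<subseteq> pullback_rel p r" "w \<subseteq> pullback_rel q r"
    "(p, q) \<in> descent r x" for w p q using that mem_descent_iff[OF r x that(1-3)] by simp
  from theI'[OF glue[OF r continuous_congruence_descent[OF r x] subset_descent[OF r x] x this], folded descended_def]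
  show "descended r x \<in> P (descent r x)" "res r (descent r x) 1 (descended r x) = x" by auto
qed

text \<open>A stage below \<open>r\<close> can be used to test both descents, and there
  \<open>y\<close> and its restriction to \<open>r\<close> have the same further
  restrictions.\<close>

lemma descent_restrict:
  assumes r: "continuous_congruence r" and s: "continuous_congruence s" and sub: "r \<subseteq> s" and y: "y \<in> P s"
  shows "descent r (res r s 1 y) = descent s y"
proof -
  have "(p, q) \<in> descent r (res r s 1 y) \<longleftrightarrow> (p, q) \<in> descent s y" for p q
  proof -
    let ?w = "pullback_rel p r \<inter> pullback_rel q r"
    have w: "continuous_congruence ?w" using r by (intro continuous_congruence_Int continuous_congruence_pullback)
    have ws: "?w \<subseteq> pullback_rel p s" "?w \<subseteq> pullback_rel q s" using pullback_rel_mono[OF sub] by blast+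
    have "res r s 1 y \<in> P r" using res_in[OF r s _ y, of 1] sub by simp
    then show ?thesis
      using mem_descent_iff[OF r _ w, of "res r s 1 y" p q] mem_descent_iff[OF s y w ws]
        res_restrict[OF w r s _ sub y] by simp
  qed
  then show ?thesis by auto
qed

text \<open>An element and its restriction along an inclusion share their normal form; this is what
  makes \<open>point\<close> behave as the map into the colimit.\<close>

lemma point_restrict:
  assumes r: "continuous_congruence r" and s: "continuous_congruence s" and sub: "r \<subseteq> s" and y: "y \<in> P s"
  shows "point r (res r s 1 y) = point s y"
proof -
  let ?x = "res r s 1 y" and ?e = "descent s y"
  have x: "?x \<in> P r" using res_in[OF r s _ y, of 1] sub by simp
  note e = continuous_congruence_descent[OF s y] and eq = descent_restrict[OF assms]
  have "r \<subseteq> ?e" using sub subset_descent[OF s y] by simp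
  moreover have "res r ?e 1 (descended s y) = ?x"
    using res_restrict[OF r s e _ subset_descent[OF s y] descended_in[OF s y], of 1] sub
    by (simp add: res_descended[OF s y])
  moreover have "res r ?e 1 (descended r ?x) = ?x" using res_descended[OF r x] by (simp add: eq)
  ultimately have "descended r ?x = descended s y"
    using res_one_inj[OF r e] descended_in[OF r x] descended_in[OF s y] by (simp add: eq)
  then show ?thesis by (simp add: point_def eq)
qed

lemma point_in_points:
  assumes r: "continuous_congruence r" and x: "x \<in> P r"
  shows "point r x \<in> points"
  using descent_restrict[OF r continuous_congruence_descent[OF r x] subset_descent[OF r x] descended_in[OF r x]]
  by (simp add: points_def point_def continuous_congruence_descent[OF r x] descended_in[OF r x] res_descended[OF r x])

lemma point_eq: "(r, x) \<in> points \<Longrightarrow> point r x = (r, x)"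
  using res_descended[of r x] descended_in[of r x] res_one[of r "descended r x"]
  by (auto simp: points_def point_def)

lemma point_inj:
  assumes "continuous_congruence r" "x \<in> P r" "y \<in> P r" "point r x = point r y"
  shows "x = y"
proof -
  have "descent r x = descent r y" "descended r x = descended r y" using assms(4) by (simp_all add: point_def)
  then show ?thesis using res_descended[OF assms(1,2)] res_descended[OF assms(1,3)] by argo
qed

section \<open>The realization as a continuous action\<close>

lemma act_realization:
  assumes "(r, x) \<in> points"
  shows "act realization (r, x) m = point (pullback_rel m r) (res (pullback_rel m r) r m x)"
  using assms by (simp add: realization_def)

lemma pts_realization: "pts realization = points"
  by (simp add: realization_def)

text \<open>The action can be computed from any representative of a point and at any stage where
  \<open>[p]\<close> is defined. This reduces the action laws to functoriality of
  \<open>res\<close>.\<close>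

lemma act_point:
  assumes w: "continuous_congruence w" and r: "continuous_congruence r" and p: "w \<subseteq> pullback_rel p r" and x: "x \<in> P r"
  shows "act realization (point r x) p = point w (res w r p x)"
proof -
  let ?e = "descent r x" and ?y = "descended r x"
  note e = continuous_congruence_descent[OF r x] and y = descended_in[OF r x] and sub = subset_descent[OF r x]
  have pe: "continuous_congruence (pullback_rel p ?e)" using e by (rule continuous_congruence_pullback)
  have we: "w \<subseteq> pullback_rel p ?e" using p pullback_rel_mono[OF sub] by blast
  have "res w r p x = res w ?e p ?y"
    using res_restrict[OF w r e p sub y] by (simp add: res_descended[OF r x])
  also have "\<dots> = res w (pullback_rel p ?e) 1 (res (pullback_rel p ?e) ?e p ?y)"
    using res_res[OF w pe e _ order.refl y, of 1] we by simp
  finally show ?thesis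
    using point_restrict[OF w pe we res_in[OF pe e order.refl y]] point_in_points[OF r x]
    by (simp add: point_def[of r x] act_realization)
qed

lemma right_mset_realization: "right_mset realization"
  unfolding right_mset_def
proof (intro conjI ballI allI)
  have pt: "act realization z m \<in> points" if "z \<in> points" for z m
  proof -
    obtain r x where z: "z = (r, x)" by (cases z)
    then have r: "continuous_congruence r" and x: "x \<in> P r" using that by (auto simp: points_def)
    note pr = continuous_congruence_pullback[OF r, of m]
    show ?thesis using that point_in_points[OF pr res_in[OF pr r order.refl x]] by (simp add: z act_realization)
  qed
  show "act realization \<in> pts realization \<rightarrow>\<^sub>E (UNIV \<rightarrow> pts realization)"
  proof (rule PiE_I)
    fix z assume "z \<notin> pts realization"
    then show "act realization z = undefined" by (simp add: realization_def)
  qed (auto simp: pts_realization pt)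
  fix z assume zp: "z \<in> pts realization"
  obtain r x where z: "z = (r, x)" by (cases z)
  then have r: "continuous_congruence r" and x: "x \<in> P r" and eq: "point r x = z"
    using zp point_eq[of r x] by (auto simp: pts_realization points_def)
  show "act realization z 1 = z"
    using act_point[OF r r _ x, of 1] eq by (simp add: res_one[OF r x])
  fix m n
  note pm = continuous_congruence_pullback[OF r, of m] and pmn = continuous_congruence_pullback[OF r, of "m * n"]
  have "act realization (act realization z m) n = point (pullback_rel (m * n) r)
      (res (pullback_rel (m * n) r) (pullback_rel m r) n (res (pullback_rel m r) r m x))"
    using act_point[OF pm r order.refl x] act_point[OF pmn pm _ res_in[OF pm r order.refl x], of n] eq by simp
  also have "\<dots> = act realization z (m * n)"
    using act_point[OF pmn r order.refl x] eq res_res[OF pmn pm r _ order.refl x, of n] by simp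
  finally show "act realization (act realization z m) n = act realization z (m * n)" .
qed

text \<open>At a common stage \<open>point\<close> is injective, so equality of two translates is
  equality of restrictions. That is membership in \<open>descent r x\<close>, which equals
  \<open>r\<close> for a normal form.\<close>

lemma stabilizer_realization:
  assumes "(r, x) \<in> points"
  shows "stabilizer realization (r, x) = r"
proof -
  have r: "continuous_congruence r" and x: "x \<in> P r" and e: "descent r x = r" and eq: "point r x = (r, x)"
    using assms point_eq[OF assms] by (auto simp: points_def)
  have "act realization (r, x) p = act realization (r, x) q \<longleftrightarrow> (p, q) \<in> r" for p q
  proof -
    let ?w = "pullback_rel p r \<inter> pullback_rel q r"
    have w: "continuous_congruence ?w" using r by (intro continuous_congruence_Int continuous_congruence_pullback)
    have "act realization (r, x) p = act realization (r, x) q \<longleftrightarrow> point ?w (res ?w r p x) = point ?w (res ?w r q x)"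
      using act_point[OF w r _ x, of p] act_point[OF w r _ x, of q] eq by simp
    also have "\<dots> \<longleftrightarrow> res ?w r p x = res ?w r q x"
      using point_inj[OF w res_in[OF w r _ x] res_in[OF w r _ x], of p q] by auto
    also have "\<dots> \<longleftrightarrow> (p, q) \<in> r" using mem_descent_iff[OF r x w] e by simp
    finally show ?thesis .
  qed
  then show ?thesis by (auto simp: stabilizer_def)
qed

lemma continuous_mset_realization: "continuous_mset realization"
  unfolding continuous_mset_iff
proof (intro conjI ballI right_mset_realization)
  fix z z' assume "z \<in> pts realization" "z' \<in> pts realization"
  obtain r x where z: "z = (r, x)" by (cases z)
  then have zp: "(r, x) \<in> points" and r: "continuous_congruence r"
    using \<open>z \<in> pts realization\<close> by (auto simp: pts_realization points_def)
  show "open {m. act realization z m = z'}"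
  proof (cases "\<exists>n. act realization z n = z'")
    case True
    then obtain n where n: "act realization z n = z'" by blast
    \<comment> \<open>A nonempty set of this kind is the class of \<open>n\<close> under the
      stabilizer; the factor \<open>1\<close> brings it into the shape of the openness condition
      with \<open>p = 1\<close>.\<close>
    then have "{m. act realization z m = z'} = {m. (1 * m, n) \<in> stabilizer realization (r, x)}"
      by (auto simp: stabilizer_def z)
    then show ?thesis using r stabilizer_realization[OF zp] by (simp only: continuous_congruence_def)
  qed simp
qed

text \<open>A point fixed by \<open>r\<close> is a normal form \<open>(s, y)\<close> with
  \<open>r \<subseteq> s\<close>, hence comes from the restriction of \<open>y\<close> to
  \<open>r\<close>. Thus the realization has \<open>P\<close> as its functor of fixed
  points.\<close>

lemma bij_betw_point:
  assumes r: "continuous_congruence r"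
  shows "bij_betw (point r) (P r) (fixed realization r)"
proof (rule bij_betw_imageI)
  show "inj_on (point r) (P r)" using point_inj[OF r] by (auto intro: inj_onI)
  show "point r ` P r = fixed realization r"
  proof (intro equalityI subsetI)
    fix z assume "z \<in> point r ` P r"
    then obtain x where x: "x \<in> P r" "z = point r x" by blast
    then show "z \<in> fixed realization r"
      using point_in_points[OF r x(1)] subset_descent[OF r x(1)] stabilizer_realization[of "descent r x" "descended r x"]
      by (simp add: fixed_iff_stabilizer pts_realization point_def)
  next
    fix z assume z: "z \<in> fixed realization r"
    obtain s y where sy: "z = (s, y)" by (cases z)
    have zp: "(s, y) \<in> points" using fixed_subset[OF z] by (simp add: pts_realization sy)
    then have s: "continuous_congruence s" and y: "y \<in> P s" by (auto simp: points_def)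
    have sub: "r \<subseteq> s" using z stabilizer_realization[OF zp] by (simp add: fixed_iff_stabilizer sy)
    have "point r (res r s 1 y) = z" using point_restrict[OF r s sub y] point_eq[OF zp] sy by simp
    moreover have "res r s 1 y \<in> P r" using res_in[OF r s _ y, of 1] sub by simp
    ultimately show "z \<in> point r ` P r" by blast
  qed
qed

end

section \<open>Transport of continuous actions along an equivalence\<close>

lemma RCong_homI:
  fixes r s :: "'m::topological_monoid_mult rel"
  shows "r \<subseteq> pullback_rel m s \<Longrightarrow> s `` {m} \<in> Hom (RCong TYPE('m)) r s"
  by auto

lemma class_act_in_fixed:
  fixes X :: "('u, 'm::topological_monoid_mult) mset"
  assumes "right_mset X" "continuous_congruence s" "c \<in> Hom (RCong TYPE('m)) r s" "x \<in> fixed X s"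
  shows "class_act X x c \<in> fixed X r"
  using assms act_mem_fixed[of X x s] by (auto simp: class_act_eq)

lemma class_act_comp:
  fixes X :: "('u, 'm::topological_monoid_mult) mset"
  assumes X: "right_mset X" and s: "continuous_congruence s" and t: "continuous_congruence t"
    and c: "c \<in> Hom (RCong TYPE('m)) r s" and d: "d \<in> Hom (RCong TYPE('m)) s t" and x: "x \<in> fixed X t"
  shows "class_act X (class_act X x d) c = class_act X x (Comp (RCong TYPE('m)) r s t d c)"
proof -
  obtain m n where m: "c = s `` {m}" and n: "d = t `` {n}" "s \<subseteq> pullback_rel n t" using c d by auto
  show ?thesis
    using s t act_mem_fixed[OF X x n(2)] act_act[OF X fixed_subset[OF x]]
    by (simp add: m n RCong_comp class_act_eq class_act_eq[OF x])
qed

lemma class_act_one: "\<lbrakk>right_mset X; continuous_congruence s; x \<in> fixed X s\<rbrakk> \<Longrightarrow> class_act X x (s `` {1}) = x"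
  by (simp add: class_act_eq act_one fixed_subset)

lemma bij_betw_class_act:
  fixes X :: "('u, 'm::topological_monoid_mult) mset"
  assumes X: "right_mset X" and r: "continuous_congruence r" and s: "continuous_congruence s"
    and c: "iso_arrow (RCong TYPE('m)) r s c"
  shows "bij_betw (\<lambda>x. class_act X x c) (fixed X s) (fixed X r)"
proof -
  note ch = iso_arrow_in_hom[OF c]
  obtain d where d: "d \<in> Hom (RCong TYPE('m)) s r" "Comp (RCong TYPE('m)) r s r d c = r `` {1}"
    "Comp (RCong TYPE('m)) s r s c d = s `` {1}"
    using c by (auto elim: iso_arrowE)
  show ?thesis
    by (rule bij_betwI[where g = "\<lambda>x. class_act X x d"])
      (auto intro!: class_act_in_fixed[OF X s ch] class_act_in_fixed[OF X r d(1)]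
        simp: class_act_comp[OF X r s d(1) ch] class_act_comp[OF X s r ch d(1)] d class_act_one X r s)
qed

text \<open>The conclusion places the class of \<open>1\<close> in the image of \<open>M/r\<close>,
  so the arrow is onto. Surjectivity thereby becomes a categorical property that equivalences
  preserve.\<close>

lemma epi_RCong_imp_surjective:
  fixes r s :: "'m::topological_monoid_mult rel"
  assumes r: "continuous_congruence r" and s: "continuous_congruence s" and k: "r \<subseteq> pullback_rel k s"
    and epi: "epi_arrow (RCong TYPE('m)) r s (s `` {k})"
  shows "\<exists>j. (k * j, 1) \<in> s"
proof -
  note refl = right_congruence_refl[OF continuous_congruence_imp_right[OF s]]
  note trans = right_congruence_trans[OF continuous_congruence_imp_right[OF s]]
  note sym = right_congruence_sym[OF continuous_congruence_imp_right[OF s]]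
  note mult = right_congruence_mult[OF continuous_congruence_imp_right[OF s]]
  \<comment> \<open>\<open>I\<close> is the image of the arrow; collapsing it to a point makes \<open>[1]\<close> and \<open>[k]\<close> agree on it.\<close>
  define I where "I = {p. \<exists>j. (k * j, p) \<in> s}"
  define t where "t = s \<union> I \<times> I"
  have I_sat: "q \<in> I" if "p \<in> I" "(p, q) \<in> s" for p q using that trans unfolding I_def by blast
  have I_mult: "p * m \<in> I" if "p \<in> I" for p m
  proof -
    obtain j where "(k * j, p) \<in> s" using \<open>p \<in> I\<close> by (auto simp: I_def)
    then have "(k * (j * m), p * m) \<in> s" using mult[of "k * j" p m] by (simp add: mult.assoc)
    then show ?thesis unfolding I_def by blast
  qed
  have kI: "k * p \<in> I" for p unfolding I_def using refl by blast
  have "right_congruence t"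
  proof (rule right_congruenceI)
    show "(p, p) \<in> t" for p using refl by (simp add: t_def)
    show "(q, p) \<in> t" if "(p, q) \<in> t" for p q using that sym by (auto simp: t_def)
    show "(p, l) \<in> t" if "(p, q) \<in> t" "(q, l) \<in> t" for p q l
      using that trans I_sat sym unfolding t_def by blast
    show "(p * m, q * m) \<in> t" if "(p, q) \<in> t" for p q m using that mult I_mult by (auto simp: t_def)
  qed
  then have t: "continuous_congruence t" using continuous_congruence_supset[OF s] by (simp add: t_def)
  have one: "s \<subseteq> pullback_rel 1 t" and kt: "s \<subseteq> pullback_rel k t" using kI by (auto simp: t_def)
  have "Comp (RCong TYPE('m)) r s t (t `` {1}) (s `` {k}) = Comp (RCong TYPE('m)) r s t (t `` {k}) (s `` {k})"
  proof -
    have "(k, k * k) \<in> t" using kI[of 1] kI[of k] by (simp add: t_def)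
    then have "t `` {k} = t `` {k * k}" using right_congruence_class_eq[of t k "k * k"] t by simp
    moreover have "Comp (RCong TYPE('m)) r s t (t `` {1}) (s `` {k}) = t `` {k}"
      using RCong_comp[of s t 1 r k] s t one by simp
    moreover have "Comp (RCong TYPE('m)) r s t (t `` {k}) (s `` {k}) = t `` {k * k}"
      using RCong_comp[of s t k r k] s t kt by simp
    ultimately show ?thesis by simp
  qed
  moreover have "t `` {1} \<in> Hom (RCong TYPE('m)) s t" "t `` {k} \<in> Hom (RCong TYPE('m)) s t" "t \<in> Obj (RCong TYPE('m))"
    using RCong_homI[OF one] RCong_homI[OF kt] t by simp_all
  ultimately have "t `` {1} = t `` {k}" using epi unfolding epi_arrow_def by blast
  then have "(1, k) \<in> t" using right_congruence_class_eq[of t] t by simp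
  then have "1 \<in> I" using sym kI[of 1] I_sat[of k 1] by (auto simp: t_def)
  then show ?thesis by (simp add: I_def)
qed

text \<open>Both \<open>p\<close> and \<open>q\<close> are morphisms from the intersection
  \<open>?v\<close> of the two pullbacks to \<open>H r\<close>. Essential surjectivity gives an
  isomorphism \<open>[i]\<close> from some \<open>H w\<close> to \<open>?v\<close> with inverse
  \<open>[j]\<close>; fullness lifts \<open>[p * i]\<close> and \<open>[q * i]\<close>, and
  multiplication by \<open>j\<close> recovers \<open>p\<close> and \<open>q\<close>.\<close>

lemma lift_pair:
  fixes H :: "('n::topological_monoid_mult rel, 'n set, 'm::topological_monoid_mult rel, 'm set) cat_map"
  assumes H: "weak_equivalence (RCong TYPE('n)) (RCong TYPE('m)) H" and r: "continuous_congruence r"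
  shows "\<exists>w p' q' i j. continuous_congruence w \<and> w \<subseteq> pullback_rel p' r \<and> w \<subseteq> pullback_rel q' r \<and>
    amap H w r (r `` {p'}) = omap H r `` {p * i} \<and> amap H w r (r `` {q'}) = omap H r `` {q * i} \<and>
    (p * i * j, p) \<in> omap H r \<and> (q * i * j, q) \<in> omap H r"
proof -
  let ?r = "omap H r"
  have Hr: "continuous_congruence ?r" using functor_obj[OF weak_equivalence_functor[OF H], of r] r by simp
  let ?v = "pullback_rel p ?r \<inter> pullback_rel q ?r"
  have v: "continuous_congruence ?v" using Hr by (intro continuous_congruence_Int continuous_congruence_pullback)
  obtain w e where w: "continuous_congruence w" and e: "iso_arrow (RCong TYPE('m)) (omap H w) ?v e"
    using weak_equivalence_dense[OF H, of ?v] v by auto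
  have Hw: "continuous_congruence (omap H w)"
    using functor_obj[OF weak_equivalence_functor[OF H], of w] w by simp
  obtain d where d: "d \<in> Hom (RCong TYPE('m)) ?v (omap H w)"
    "Comp (RCong TYPE('m)) ?v (omap H w) ?v e d = ?v `` {1}" using e by (auto elim: iso_arrowE)
  obtain i where i: "e = ?v `` {i}" "omap H w \<subseteq> pullback_rel i ?v" using iso_arrow_in_hom[OF e] by auto
  obtain j where j: "d = omap H w `` {j}" "?v \<subseteq> pullback_rel j (omap H w)" using d(1) by auto
  have "(i * j, 1) \<in> ?v"
    using d(2) v Hw right_congruence_class_eq[of ?v] by (simp add: i(1) j(1) RCong_comp i(2))
  then have ij: "(p * i * j, p) \<in> ?r" "(q * i * j, q) \<in> ?r" by (auto simp: mult.assoc)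
  have lift: "\<exists>p'. w \<subseteq> pullback_rel p' r \<and> amap H w r (r `` {p'}) = ?r `` {p * i}"
    if p: "?v \<subseteq> pullback_rel p ?r" for p
  proof -
    have h: "?r `` {p * i} \<in> Hom (RCong TYPE('m)) (omap H w) ?r"
      using pullback_rel_mult[OF i(2) p] by auto
    obtain c where "c \<in> Hom (RCong TYPE('n)) w r" "amap H w r c = ?r `` {p * i}"
      using weak_equivalence_full[OF H _ _ h] w r by auto
    then show ?thesis by auto
  qed
  show ?thesis using lift[of p] lift[of q] w ij by blast
qed

text \<open>The presheaf laws are functoriality of \<open>H\<close> and of fixed points. For gluing,
  the projection \<open>[1]\<close> is epic, so its image \<open>[k]\<close> under \<open>H\<close>
  is onto, and a map constant on the fibres of a surjection factors through it.\<close>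

lemma congruence_sheaf_fixed:
  fixes H :: "('n::topological_monoid_mult rel, 'n set, 'm::topological_monoid_mult rel, 'm set) cat_map"
    and X :: "('u, 'm) mset"
  assumes H: "weak_equivalence (RCong TYPE('n)) (RCong TYPE('m)) H" and X: "continuous_mset X"
  shows "congruence_sheaf (\<lambda>r. fixed X (omap H r)) (\<lambda>w r p x. class_act X x (amap H w r (r `` {p})))"
proof
  note Hf = weak_equivalence_functor[OF H]
  have Xr: "right_mset X" using X by simp
  have Ho: "continuous_congruence (omap H r)" if "continuous_congruence r" for r
    using functor_obj[OF Hf, of r] that by simp
  have hom: "r `` {p} \<in> Hom (RCong TYPE('n)) w r" if "w \<subseteq> pullback_rel p r" for w r and p :: 'n
    using that by auto
  have Hh: "amap H w r (r `` {p}) \<in> Hom (RCong TYPE('m)) (omap H w) (omap H r)"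
    if "continuous_congruence w" "continuous_congruence r" "w \<subseteq> pullback_rel p r" for w r p
    using functor_hom[OF Hf _ _ hom] that by simp
  { fix w r p x
    assume "continuous_congruence w" "continuous_congruence r" "w \<subseteq> pullback_rel p r" "x \<in> fixed X (omap H r)"
    then show "class_act X x (amap H w r (r `` {p})) \<in> fixed X (omap H w)"
      using class_act_in_fixed[OF Xr Ho Hh] by blast }
  { fix r x
    assume r: "continuous_congruence r" and "x \<in> fixed X (omap H r)"
    then show "class_act X x (amap H r r (r `` {1})) = x"
      using functor_ident[OF Hf, of r] class_act_one[OF Xr Ho[OF r]] by simp }
  { fix v w r q p x
    assume v: "continuous_congruence v" and w: "continuous_congruence w" and r: "continuous_congruence r"
      and q: "v \<subseteq> pullback_rel q w" and p: "w \<subseteq> pullback_rel p r" and x: "x \<in> fixed X (omap H r)"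
    have "amap H v r (r `` {p * q}) = amap H v r (Comp (RCong TYPE('n)) v w r (r `` {p}) (w `` {q}))"
      using w r p by (simp add: RCong_comp)
    also have "\<dots> = Comp (RCong TYPE('m)) (omap H v) (omap H w) (omap H r) (amap H w r (r `` {p})) (amap H v w (w `` {q}))"
      using functor_comp[OF Hf _ _ _ hom[OF q] hom[OF p]] v w r by simp
    finally show "class_act X (class_act X x (amap H w r (r `` {p}))) (amap H v w (w `` {q})) =
        class_act X x (amap H v r (r `` {p * q}))"
      using class_act_comp[OF Xr Ho[OF w] Ho[OF r] Hh[OF v w q] Hh[OF w r p] x] by simp }
  { fix w r p x q
    assume "continuous_congruence w" "continuous_congruence r" "w \<subseteq> pullback_rel p r"
      "x \<in> fixed X (omap H r)" "(p, q) \<in> r"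
    then show "class_act X x (amap H w r (r `` {p})) = class_act X x (amap H w r (r `` {q}))"
      using right_congruence_class_eq[of r p q] by simp }
  fix r s x
  assume r: "continuous_congruence r" and s: "continuous_congruence s" and sub: "r \<subseteq> s"
    and x: "x \<in> fixed X (omap H r)"
    and compat: "\<And>w p q. \<lbrakk>continuous_congruence w; w \<subseteq> pullback_rel p r; w \<subseteq> pullback_rel q r; (p, q) \<in> s\<rbrakk>
      \<Longrightarrow> class_act X x (amap H w r (r `` {p})) = class_act X x (amap H w r (r `` {q}))"
  let ?r = "omap H r" and ?s = "omap H s"
  have rs1: "r \<subseteq> pullback_rel 1 s" using sub by simp
  note Hr = Ho[OF r] and Hs = Ho[OF s]
  note sr = continuous_congruence_imp_right[OF s] and Hsr = continuous_congruence_imp_right[OF Hs]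
  have epi: "epi_arrow (RCong TYPE('n)) r s (s `` {1})"
    unfolding epi_arrow_def
  proof (intro conjI ballI impI hom[OF rs1])
    fix t g h assume t: "t \<in> Obj (RCong TYPE('n))" and "g \<in> Hom (RCong TYPE('n)) s t" "h \<in> Hom (RCong TYPE('n)) s t"
      and eq: "Comp (RCong TYPE('n)) r s t g (s `` {1}) = Comp (RCong TYPE('n)) r s t h (s `` {1})"
    then obtain a b where "g = t `` {a}" "s \<subseteq> pullback_rel a t" "h = t `` {b}" "s \<subseteq> pullback_rel b t" by auto
    then show "g = h" using eq s t by (simp add: RCong_comp)
  qed
  obtain k where k: "amap H r s (s `` {1}) = ?s `` {k}" "?r \<subseteq> pullback_rel k ?s"
    using Hh[OF r s rs1] by auto
  have "epi_arrow (RCong TYPE('m)) ?r ?s (?s `` {k})"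
    using weak_equivalence_epi_arrow[OF category_RCong category_RCong H _ _ epi] r s k(1) by simp
  then obtain j where j: "(k * j, 1) \<in> ?s" using epi_RCong_imp_surjective[OF Hr Hs k(2)] by blast
  \<comment> \<open>The map given by \<open>x\<close> is constant on the fibres of
    \<open>[k]\<close>. Compatibility is only assumed for morphisms of the first category, so the
    pair is lifted there by \<open>lift_pair\<close> and brought back by \<open>l\<close>.\<close>
  have act_eq: "act X x p = act X x q" if pq: "(k * p, k * q) \<in> ?s" for p q
  proof -
    obtain w p' q' i l where w: "continuous_congruence w" and p': "w \<subseteq> pullback_rel p' r"
      and q': "w \<subseteq> pullback_rel q' r" and Hp: "amap H w r (r `` {p'}) = ?r `` {p * i}"
      and Hq: "amap H w r (r `` {q'}) = ?r `` {q * i}" and il: "(p * i * l, p) \<in> ?r" "(q * i * l, q) \<in> ?r"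
      using lift_pair[OF H r, of p q] by blast
    have comp: "amap H w s (s `` {a'}) = ?s `` {k * a}"
      if a: "w \<subseteq> pullback_rel a' r" "amap H w r (r `` {a'}) = ?r `` {a}" for a' a
    proof -
      have "amap H w s (s `` {a'}) = amap H w s (Comp (RCong TYPE('n)) w r s (s `` {1}) (r `` {a'}))"
        using r s rs1 by (simp add: RCong_comp)
      also have "\<dots> = Comp (RCong TYPE('m)) (omap H w) ?r ?s (?s `` {k}) (?r `` {a})"
        using functor_comp[OF Hf _ _ _ hom[OF a(1)] hom[OF rs1]] w r s a(2) k(1) by simp
      finally show ?thesis using Hr Hs k(2) by (simp add: RCong_comp)
    qed
    have "(k * (p * i), k * (q * i)) \<in> ?s"
      using right_congruence_mult[OF Hsr pq, of i] by (simp add: mult.assoc)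
    then have "amap H w s (s `` {p'}) = amap H w s (s `` {q'})"
      using comp[OF p' Hp] comp[OF q' Hq] right_congruence_class_eq[OF Hsr] by simp
    moreover have "w \<subseteq> pullback_rel p' s" "w \<subseteq> pullback_rel q' s"
      using p' q' pullback_rel_mono[OF sub] by blast+
    ultimately have "s `` {p'} = s `` {q'}"
      using weak_equivalence_faithful[OF H, of w s] hom w s by simp
    then have "(p', q') \<in> s" using right_congruence_class_eq[OF sr] by simp
    from compat[OF w p' q' this] have "act X x (p * i) = act X x (q * i)"
      using class_act_eq[OF x] Hr by (simp add: Hp Hq)
    then have "act X x (p * i * l) = act X x (q * i * l)"
      using act_act[OF Xr fixed_subset[OF x]] by metis
    then show ?thesis using fixedD[OF x il(1)] fixedD[OF x il(2)] by simp
  qed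
  show "\<exists>!y. y \<in> fixed X ?s \<and> class_act X y (amap H r s (s `` {1})) = x"
  proof (rule ex1I)
    \<comment> \<open>\<open>j\<close> is a preimage of \<open>1\<close> under \<open>[k]\<close>
      modulo \<open>H s\<close>. An amalgamation \<open>y\<close> with \<open>y k = x\<close> must
      satisfy \<open>y = y (k j) = x j\<close>, which gives both the witness and its
      uniqueness.\<close>
    have eq1: "(k * j * a, a) \<in> ?s" for a using right_congruence_mult[OF Hsr j, of a] by simp
    have "act X x (j * a) = act X x (j * b)" if "(a, b) \<in> ?s" for a b
    proof (rule act_eq)
      have "(k * j * a, b) \<in> ?s" using right_congruence_trans[OF Hsr eq1 that] .
      then show "(k * (j * a), k * (j * b)) \<in> ?s"
        using right_congruence_trans[OF Hsr _ right_congruence_sym[OF Hsr eq1]] by (metis mult.assoc)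
    qed
    then have y: "act X x j \<in> fixed X ?s"
      using act_in_pts[OF Xr fixed_subset[OF x]] by (simp add: fixed_def act_act[OF Xr fixed_subset[OF x]])
    have "act X x (j * k) = act X x 1"
      using eq1[of k] by (intro act_eq) (simp add: mult.assoc)
    then have "class_act X (act X x j) (?s `` {k}) = x"
      using class_act_eq[OF y Hsr] act_act[OF Xr fixed_subset[OF x]] act_one[OF Xr fixed_subset[OF x]] by simp
    with y show "act X x j \<in> fixed X ?s \<and> class_act X (act X x j) (amap H r s (s `` {1})) = x" by (simp add: k(1))
    fix z assume z: "z \<in> fixed X ?s \<and> class_act X z (amap H r s (s `` {1})) = x"
    then have zk: "act X z k = x" using class_act_eq[OF conjunct1[OF z] Hsr, of k] by (simp add: k(1))
    have zp: "z \<in> pts X" using fixed_subset[OF conjunct1[OF z]] .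
    have "act X x j = act X z (k * j)" using act_act[OF Xr zp] by (simp add: zk[symmetric])
    also have "\<dots> = z" using fixedD[OF conjunct1[OF z] j] act_one[OF Xr zp] by simp
    finally show "z = act X x j" by simp
  qed
qed

text \<open>A point also carries a congruence, and these may exceed the universe in number. The
  bound rests on \<open>H r\<close> being the stabilizer of \<open>x\<close>: the element alone
  determines the image of the congruence under \<open>H\<close>.\<close>

lemma realization_small:
  fixes H :: "('n::topological_monoid_mult rel, 'n set, 'm::topological_monoid_mult rel, 'm set) cat_map"
    and X :: "('u, 'm) mset"
  assumes H: "weak_equivalence (RCong TYPE('n)) (RCong TYPE('m)) H" and X: "continuous_mset X"
  defines "P \<equiv> \<lambda>r. fixed X (omap H r)" and "res \<equiv> \<lambda>w r p x. class_act X x (amap H w r (r `` {p}))"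
  shows "congruence_sheaf.points P res \<lesssim> pts X \<times> (UNIV :: 'n set)"
proof -
  note Hf = weak_equivalence_functor[OF H]
  interpret congruence_sheaf P res
    unfolding P_def res_def by (rule congruence_sheaf_fixed[OF H X])
  have Xr: "right_mset X" using X by simp
  \<comment> \<open>If \<open>p\<close> and \<open>q\<close> act equally on \<open>x\<close>, a
    lifted pair restricts \<open>x\<close> equally, and \<open>descent r x = r\<close> then relates
    the lifts; \<open>l\<close> carries the relation back to \<open>p\<close> and
    \<open>q\<close>.\<close>
  have st: "omap H r = stabilizer X x" if rx: "(r, x) \<in> points" for r x
  proof
    have r: "continuous_congruence r" and x: "x \<in> fixed X (omap H r)" and e: "descent r x = r"
      using rx unfolding points_def by (auto simp: P_def)
    have Hr: "right_congruence (omap H r)" using functor_obj[OF Hf, of r] r by simp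
    show "omap H r \<subseteq> stabilizer X x" using x by (simp add: fixed_iff_stabilizer)
    show "stabilizer X x \<subseteq> omap H r"
    proof clarify
      fix p q assume pq: "(p, q) \<in> stabilizer X x"
      obtain w p' q' i l where w: "continuous_congruence w" and p': "w \<subseteq> pullback_rel p' r"
        and q': "w \<subseteq> pullback_rel q' r" and Hp: "amap H w r (r `` {p'}) = omap H r `` {p * i}"
        and Hq: "amap H w r (r `` {q'}) = omap H r `` {q * i}"
        and il: "(p * i * l, p) \<in> omap H r" "(q * i * l, q) \<in> omap H r"
        using lift_pair[OF H r, of p q] by blast
      have "act X x (p * i) = act X x (q * i)"
        using pq act_act[OF Xr fixed_subset[OF x]] by (simp add: stabilizer_def) metis
      then have "res w r p' x = res w r q' x" using class_act_eq[OF x Hr] by (simp add: res_def Hp Hq)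
      then have "(p', q') \<in> r" using mem_descent_iff[OF r _ w p' q', of x] x e by (simp add: P_def)
      then have "omap H r `` {p * i} = omap H r `` {q * i}"
        using right_congruence_class_eq[of r p' q'] r Hp Hq by simp
      then have "(p * i, q * i) \<in> omap H r" using right_congruence_class_eq[OF Hr] by simp
      then have "(p * i * l, q * i * l) \<in> omap H r" by (rule right_congruence_mult[OF Hr])
      then show "(p, q) \<in> omap H r"
        using il right_congruence_sym[OF Hr] right_congruence_trans[OF Hr] by blast
    qed
  qed
  \<comment> \<open>The identity of \<open>H r = H s\<close> lifts to morphisms \<open>[k]\<close>
    and \<open>[l]\<close> in the two directions, with \<open>l * k\<close> related to
    \<open>1\<close> in \<open>r\<close>. Hence left multiplication by \<open>k\<close> reflects the
    relation as well as preserving it.\<close>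
  have same: "\<exists>k. r = pullback_rel k s" if r: "continuous_congruence r" and s: "continuous_congruence s"
    and eq: "omap H r = omap H s" for r s
  proof -
    have id: "omap H r `` {1} \<in> Hom (RCong TYPE('m)) (omap H r) (omap H s)"
      "omap H r `` {1} \<in> Hom (RCong TYPE('m)) (omap H s) (omap H r)"
      "omap H r `` {1} \<in> Hom (RCong TYPE('m)) (omap H r) (omap H r)"
      using eq by (auto intro!: exI[of _ 1])
    obtain c where c: "c \<in> Hom (RCong TYPE('n)) r s" "amap H r s c = omap H r `` {1}"
      using weak_equivalence_full[OF H _ _ id(1)] r s by auto
    obtain d where d: "d \<in> Hom (RCong TYPE('n)) s r" "amap H s r d = omap H r `` {1}"
      using weak_equivalence_full[OF H _ _ id(2)] r s by auto
    obtain k where k: "c = s `` {k}" "r \<subseteq> pullback_rel k s" using c by auto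
    obtain l where l: "d = r `` {l}" "s \<subseteq> pullback_rel l r" using d by auto
    have rO: "r \<in> Obj (RCong TYPE('n))" "s \<in> Obj (RCong TYPE('n))" using r s by auto
    have Hr: "omap H r \<in> Obj (RCong TYPE('m))" using functor_obj[OF Hf rO(1)] .
    have "amap H r r (Comp (RCong TYPE('n)) r s r d c) =
        Comp (RCong TYPE('m)) (omap H r) (omap H r) (omap H r) (omap H r `` {1}) (omap H r `` {1})"
      using functor_comp[OF Hf rO(1,2,1) c(1) d(1)] c d eq by simp
    also have "\<dots> = amap H r r (Ident (RCong TYPE('n)) r)"
      using comp_ident_left[OF category_RCong Hr Hr id(3)] functor_ident[OF Hf rO(1)] by simp
    finally have "Comp (RCong TYPE('n)) r s r d c = Ident (RCong TYPE('n)) r"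
      by (rule weak_equivalence_faithful[OF H rO(1,1), rotated 2])
        (rule comp_in_hom[OF category_RCong rO(1,2,1) c(1) d(1)], rule ident_in_hom[OF category_RCong rO(1)])
    then have lk: "(l * k, 1) \<in> r"
      using r s right_congruence_class_eq[of r] by (simp add: k(1) l RCong_comp)
    have rr: "right_congruence r" using r by simp
    have "(p, q) \<in> r" if "(k * p, k * q) \<in> s" for p q
    proof -
      have "(l * k * p, l * k * q) \<in> r" using l(2) that by (auto simp: mult.assoc)
      moreover have "(l * k * a, a) \<in> r" for a using right_congruence_mult[OF rr lk, of a] by simp
      ultimately show ?thesis using right_congruence_sym[OF rr] right_congruence_trans[OF rr] by blast
    qed
    then have "r = pullback_rel k s" using k(2) by auto
    then show ?thesis ..
  qed
  \<comment> \<open>Congruences \<open>r\<close> with the same value \<open>H r\<close> are isomorphic, hence pullbacks of each other; so a point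
    \<open>(r, x)\<close> is determined by \<open>x\<close> and one element of the monoid.\<close>
  define g where "g = (\<lambda>x. SOME r. continuous_congruence r \<and> omap H r = stabilizer X x)"
  have "points \<subseteq> (\<lambda>(x, k). (pullback_rel k (g x), x)) ` (pts X \<times> UNIV)"
  proof clarify
    fix r x assume rx: "(r, x) \<in> points"
    then have r: "continuous_congruence r" and x: "x \<in> pts X" unfolding points_def by (auto simp: P_def fixed_subset)
    have "continuous_congruence (g x) \<and> omap H (g x) = stabilizer X x"
      unfolding g_def by (rule someI[of _ r]) (simp add: r st[OF rx])
    then obtain k where "r = pullback_rel k (g x)" using same[OF r, of "g x"] st[OF rx] by auto
    then show "(r, x) \<in> (\<lambda>(x, k). (pullback_rel k (g x), x)) ` (pts X \<times> UNIV)"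
      using x by (auto intro!: image_eqI[of _ _ "(x, k)"])
  qed
  then show ?thesis using image_lepoll lepoll_trans subset_imp_lepoll by blast
qed

text \<open>\<open>comparison H X Y \<beta>\<close>: the functor of fixed points of \<open>Y\<close> is that of \<open>X\<close> precomposed with \<open>H\<close>.\<close>

definition comparison :: "('n::topological_monoid_mult rel, 'n set, 'm::topological_monoid_mult rel, 'm set) cat_map
    \<Rightarrow> ('u, 'm) mset \<Rightarrow> ('u, 'n) mset \<Rightarrow> ('n rel \<Rightarrow> 'u \<Rightarrow> 'u) \<Rightarrow> bool" where
  "comparison H X Y \<beta> \<longleftrightarrow>
    (\<forall>r. continuous_congruence r \<longrightarrow> bij_betw (\<beta> r) (fixed X (omap H r)) (fixed Y r)) \<and>
    (\<forall>r s c x. continuous_congruence r \<longrightarrow> continuous_congruence s \<longrightarrow> c \<in> Hom (RCong TYPE('n)) r s \<longrightarrow>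
      x \<in> fixed X (omap H s) \<longrightarrow> \<beta> r (class_act X x (amap H r s c)) = class_act Y (\<beta> s x) c)"

lemma
  fixes H :: "('n::topological_monoid_mult rel, 'n set, 'm::topological_monoid_mult rel, 'm set) cat_map"
  assumes "comparison H X Y \<beta>"
  shows comparison_bij: "continuous_congruence r \<Longrightarrow> bij_betw (\<beta> r) (fixed X (omap H r)) (fixed Y r)"
    and comparison_fixed: "\<lbrakk>continuous_congruence r; x \<in> fixed X (omap H r)\<rbrakk> \<Longrightarrow> \<beta> r x \<in> fixed Y r"
    and comparison_natural: "\<lbrakk>continuous_congruence r; continuous_congruence s; c \<in> Hom (RCong TYPE('n)) r s;
      x \<in> fixed X (omap H s)\<rbrakk> \<Longrightarrow> \<beta> r (class_act X x (amap H r s c)) = class_act Y (\<beta> s x) c"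
  using assms unfolding comparison_def bij_betw_def by blast+

text \<open>\<open>Y\<close> is a copy of the realization inside the universe, and \<beta> sends an
  element to the copy of its normal form.\<close>

lemma comparison_exists:
  fixes H :: "('n::topological_monoid_mult rel, 'n set, 'm::topological_monoid_mult rel, 'm set) cat_map"
    and X :: "('u, 'm) mset"
  assumes U: "set_universe \<U>" and small: "small \<U> (UNIV :: 'n set)"
    and H: "weak_equivalence (RCong TYPE('n)) (RCong TYPE('m)) H" and X: "X \<in> Obj (Cont \<U> TYPE('m))"
  shows "\<exists>Y\<in>Obj (Cont \<U> TYPE('n)). \<exists>\<beta>. comparison H X Y \<beta>"
proof -
  have Xc: "continuous_mset X" and XU: "pts X \<in> \<U>" using X by auto
  let ?P = "\<lambda>r. fixed X (omap H r)" and ?res = "\<lambda>w r p x. class_act X x (amap H w r (r `` {p}))"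
  interpret congruence_sheaf ?P ?res by (rule congruence_sheaf_fixed[OF H Xc])
  have "small \<U> (pts realization)"
    using small_lepoll[OF small_Times[OF U small_of_mem[OF XU] small] realization_small[OF H Xc]]
    by (simp add: pts_realization)
  then obtain Y j where Y: "Y \<in> Obj (Cont \<U> TYPE('n))" and j: "bij_betw j (pts realization) (pts Y)"
    and act: "\<And>x m. x \<in> pts realization \<Longrightarrow> act Y (j x) m = j (act realization x m)"
    using transport_mset[OF U continuous_mset_realization] by blast
  have Rr: "right_mset realization" by (rule right_mset_realization)
  have jeq: "j a = j b \<longleftrightarrow> a = b" if "a \<in> pts realization" "b \<in> pts realization" for a b
    using inj_on_eq_iff[OF bij_betw_imp_inj_on[OF j] that] .
  have "comparison H X Y (\<lambda>r x. j (point r x))"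
    unfolding comparison_def
  proof (intro conjI allI impI)
    fix r :: "'n rel" assume r: "continuous_congruence r"
    have jfix: "j z \<in> fixed Y r \<longleftrightarrow> z \<in> fixed realization r" if z: "z \<in> pts realization" for z
      using z bij_betwE[OF j] act[OF z] jeq[OF act_in_pts[OF Rr z] act_in_pts[OF Rr z]] by (auto simp: fixed_def)
    have "bij_betw j (fixed realization r) (fixed Y r)"
    proof (rule bij_betw_imageI)
      show "inj_on j (fixed realization r)"
        using bij_betw_imp_inj_on[OF j] by (rule inj_on_subset) (auto intro: fixed_subset)
      show "j ` fixed realization r = fixed Y r"
      proof (intro equalityI subsetI)
        fix y assume y: "y \<in> fixed Y r"
        then obtain z where "z \<in> pts realization" "y = j z"
          using bij_betw_imp_surj_on[OF j] fixed_subset[OF y] by blast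
        then show "y \<in> j ` fixed realization r" using y jfix by blast
      next
        fix y assume "y \<in> j ` fixed realization r"
        then obtain z where z: "z \<in> fixed realization r" "y = j z" by blast
        then show "y \<in> fixed Y r" using jfix[OF fixed_subset[OF z(1)]] by simp
      qed
    qed
    from bij_betw_trans[OF bij_betw_point[OF r] this]
    show "bij_betw (\<lambda>x. j (point r x)) (fixed X (omap H r)) (fixed Y r)" by (simp add: comp_def)
    fix s c x
    assume s: "continuous_congruence s" and c: "c \<in> Hom (RCong TYPE('n)) r s" and x: "x \<in> fixed X (omap H s)"
    obtain m where m: "c = s `` {m}" "r \<subseteq> pullback_rel m s" using c by auto
    have ps: "point s x \<in> fixed realization s" using bij_betwE[OF bij_betw_point[OF s]] x by blast
    have "j (point r (class_act X x (amap H r s c))) = act Y (j (point s x)) m"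
      using act_point[OF r s m(2) x] act[OF fixed_subset[OF ps]] by (simp add: m(1))
    also have "act Y (j (point s x)) p = act Y (j (point s x)) q" if "(p, q) \<in> s" for p q
      using act[OF fixed_subset[OF ps]] fixedD[OF ps that] by simp
    then have "j (point s x) \<in> fixed Y s" using bij_betwE[OF j] fixed_subset[OF ps] by (simp add: fixed_def)
    then have "act Y (j (point s x)) m = class_act Y (j (point s x)) c" using class_act_eq[of _ Y s m] s by (simp add: m(1))
    finally show "j (point r (class_act X x (amap H r s c))) = class_act Y (j (point s x)) c" .
  qed
  with Y show ?thesis by blast
qed

text \<open>Every point of \<open>Y\<close> is fixed by its own stabilizer and is therefore a value
  of \<beta>, so values of \<beta> detect equality of maps.\<close>

lemma comparison_maps_eqI:
  assumes "comparison H X Y \<beta>" "continuous_mset Y" "f \<in> equivariant_maps Y Z" "g \<in> equivariant_maps Y Z"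
    "\<And>r x. \<lbrakk>continuous_congruence r; x \<in> fixed X (omap H r)\<rbrakk> \<Longrightarrow> f (\<beta> r x) = g (\<beta> r x)"
  shows "f = g"
proof (rule equivariant_maps_eqI[OF assms(3,4)])
  fix y assume y: "y \<in> pts Y"
  note r = continuous_congruence_stabilizer[OF assms(2) y]
  obtain x where "x \<in> fixed X (omap H (stabilizer Y y))" "y = \<beta> (stabilizer Y y) x"
    using comparison_bij[OF assms(1) r] mem_fixed_stabilizer[OF y] unfolding bij_betw_def by blast
  then show "f y = g y" using assms(5)[OF r] by metis
qed

text \<open>On arrows there is no choice: the last clause prescribes the map on all values of
  \<beta>. Conjugating \<open>f\<close> by these bijections is natural and extends by
  \<open>fixed_natural_extends\<close>; functoriality is then checked on values of \<beta>.\<close>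

lemma comparison_functor_exists:
  fixes H :: "('n::topological_monoid_mult rel, 'n set, 'm::topological_monoid_mult rel, 'm set) cat_map"
    and \<U> :: "'u set set"
  assumes U: "set_universe \<U>" and small: "small \<U> (UNIV :: 'n set)"
    and H: "weak_equivalence (RCong TYPE('n)) (RCong TYPE('m)) H"
  obtains T \<beta> where "is_functor (Cont \<U> TYPE('m)) (Cont \<U> TYPE('n)) T"
    "\<And>X. X \<in> Obj (Cont \<U> TYPE('m)) \<Longrightarrow> comparison H X (omap T X) (\<beta> X)"
    "\<And>X Y f r x. \<lbrakk>X \<in> Obj (Cont \<U> TYPE('m)); Y \<in> Obj (Cont \<U> TYPE('m)); f \<in> equivariant_maps X Y;
      continuous_congruence r; x \<in> fixed X (omap H r)\<rbrakk> \<Longrightarrow> amap T X Y f (\<beta> X r x) = \<beta> Y r (f x)"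
proof -
  let ?C = "Cont \<U> TYPE('m)" and ?D = "Cont \<U> TYPE('n)"
  obtain T0 \<beta> where T0: "\<And>X. X \<in> Obj ?C \<Longrightarrow> T0 X \<in> Obj ?D"
    and \<beta>: "\<And>X. X \<in> Obj ?C \<Longrightarrow> comparison H X (T0 X) (\<beta> X)"
    using comparison_exists[OF U small H] by metis
  have T0c: "continuous_mset (T0 X)" if "X \<in> Obj ?C" for X using T0[OF that] by simp
  note Hf = weak_equivalence_functor[OF H]
  have ex: "\<exists>h. X \<in> Obj ?C \<and> Y \<in> Obj ?C \<and> f \<in> equivariant_maps X Y \<longrightarrow> h \<in> equivariant_maps (T0 X) (T0 Y) \<and>
      (\<forall>r x. continuous_congruence r \<longrightarrow> x \<in> fixed X (omap H r) \<longrightarrow> h (\<beta> X r x) = \<beta> Y r (f x))" for X Y f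
  proof (cases "X \<in> Obj ?C \<and> Y \<in> Obj ?C \<and> f \<in> equivariant_maps X Y")
    case True
    then have X: "X \<in> Obj ?C" and Y: "Y \<in> Obj ?C" and f: "f \<in> equivariant_maps X Y" by auto
    have Xr: "right_mset X" using X by simp
    define \<alpha> where "\<alpha> = (\<lambda>r z. \<beta> Y r (f (inv_into (fixed X (omap H r)) (\<beta> X r) z)))"
    have \<alpha>: "\<alpha> r (\<beta> X r x) = \<beta> Y r (f x)" if "continuous_congruence r" "x \<in> fixed X (omap H r)" for r x
      using comparison_bij[OF \<beta>[OF X] that(1)] that(2) by (simp add: \<alpha>_def bij_betw_inv_into_left)
    have ex_x: "\<exists>x\<in>fixed X (omap H r). z = \<beta> X r x" if "continuous_congruence r" "z \<in> fixed (T0 X) r" for r z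
      using comparison_bij[OF \<beta>[OF X] that(1)] that(2) by (auto simp: bij_betw_def)
    have "\<exists>h\<in>equivariant_maps (T0 X) (T0 Y). \<forall>r z. continuous_congruence r \<longrightarrow> z \<in> fixed (T0 X) r \<longrightarrow> h z = \<alpha> r z"
    proof (rule fixed_natural_extends[OF T0c[OF X] T0c[OF Y]])
      fix r z assume r: "continuous_congruence r" and "z \<in> fixed (T0 X) r"
      then obtain x where x: "x \<in> fixed X (omap H r)" "z = \<beta> X r x" using ex_x by blast
      then show "\<alpha> r z \<in> fixed (T0 Y) r"
        using comparison_fixed[OF \<beta>[OF Y] r equivariant_fixed[OF f x(1)]] \<alpha>[OF r x(1)] by simp
    next
      fix r s m z assume r: "continuous_congruence r" and s: "continuous_congruence s"
        and m: "r \<subseteq> pullback_rel m s" and z: "z \<in> fixed (T0 X) s"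
      obtain x where x: "x \<in> fixed X (omap H s)" "z = \<beta> X s x" using ex_x[OF s z] by blast
      have c: "s `` {m} \<in> Hom (RCong TYPE('n)) r s" using m by auto
      have Hc: "amap H r s (s `` {m}) \<in> Hom (RCong TYPE('m)) (omap H r) (omap H s)"
        using functor_hom[OF Hf _ _ c] r s by simp
      have Hs: "continuous_congruence (omap H s)" using functor_obj[OF Hf, of s] s by simp
      note fx = equivariant_fixed[OF f x(1)]
      have "act (T0 X) z m = \<beta> X r (class_act X x (amap H r s (s `` {m})))"
        using comparison_natural[OF \<beta>[OF X] r s c x(1)] class_act_eq[OF z] s x(2) by simp
      then have "\<alpha> r (act (T0 X) z m) = \<beta> Y r (class_act Y (f x) (amap H r s (s `` {m})))"
        using \<alpha>[OF r class_act_in_fixed[OF Xr Hs Hc x(1)]] equivariant_class_act[OF f fixed_subset[OF x(1)]] by simp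
      also have "\<dots> = act (T0 Y) (\<alpha> s z) m"
        using comparison_natural[OF \<beta>[OF Y] r s c fx] \<alpha>[OF s x(1)] x(2)
          class_act_eq[OF comparison_fixed[OF \<beta>[OF Y] s fx]] s by simp
      finally show "\<alpha> r (act (T0 X) z m) = act (T0 Y) (\<alpha> s z) m" .
    qed
    then show ?thesis using \<alpha> comparison_fixed[OF \<beta>[OF X]] by metis
  qed auto
  obtain T1 where "\<forall>X Y f. X \<in> Obj ?C \<and> Y \<in> Obj ?C \<and> f \<in> equivariant_maps X Y \<longrightarrow>
      T1 X Y f \<in> equivariant_maps (T0 X) (T0 Y) \<and>
      (\<forall>r x. continuous_congruence r \<longrightarrow> x \<in> fixed X (omap H r) \<longrightarrow> T1 X Y f (\<beta> X r x) = \<beta> Y r (f x))"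
    using ex by metis
  then have T1: "T1 X Y f \<in> equivariant_maps (T0 X) (T0 Y)"
    and T1_eq: "\<And>r x. \<lbrakk>continuous_congruence r; x \<in> fixed X (omap H r)\<rbrakk> \<Longrightarrow> T1 X Y f (\<beta> X r x) = \<beta> Y r (f x)"
    if "X \<in> Obj ?C" "Y \<in> Obj ?C" "f \<in> equivariant_maps X Y" for X Y f
    using that by blast+
  define T where "T = \<lparr>omap = T0, amap = T1\<rparr>"
  have "is_functor ?C ?D T"
    unfolding is_functor_def
  proof (intro conjI ballI)
    fix X assume X: "X \<in> Obj ?C"
    show "omap T X \<in> Obj ?D" using T0[OF X] by (simp add: T_def)
    have Xr: "right_mset X" using X by simp
    note i = equivariant_ident[OF Xr] and Ti = equivariant_ident[OF continuous_mset_imp_right[OF T0c[OF X]]]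
    have "T1 X X (restrict (\<lambda>x. x) (pts X)) = restrict (\<lambda>x. x) (pts (T0 X))"
    proof (rule comparison_maps_eqI[OF \<beta>[OF X] T0c[OF X] T1[OF X X i] Ti])
      fix r x assume r: "continuous_congruence r" "x \<in> fixed X (omap H r)"
      then show "T1 X X (restrict (\<lambda>x. x) (pts X)) (\<beta> X r x) = restrict (\<lambda>x. x) (pts (T0 X)) (\<beta> X r x)"
        using fixed_subset[OF comparison_fixed[OF \<beta>[OF X] r]] fixed_subset[OF r(2)] by (simp add: T1_eq[OF X X i r])
    qed
    then show "amap T X X (Ident ?C X) = Ident ?D (omap T X)" by (simp add: T_def)
  next
    fix X Y f assume "X \<in> Obj ?C" "Y \<in> Obj ?C" "f \<in> Hom ?C X Y"
    then show "amap T X Y f \<in> Hom ?D (omap T X) (omap T Y)" using T1[of X Y f] by (simp add: T_def)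
  next
    fix X Y Z f g assume X: "X \<in> Obj ?C" and Y: "Y \<in> Obj ?C" and Z: "Z \<in> Obj ?C"
      and "f \<in> Hom ?C X Y" "g \<in> Hom ?C Y Z"
    then have f: "f \<in> equivariant_maps X Y" and g: "g \<in> equivariant_maps Y Z" by auto
    have Xr: "right_mset X" using X by simp
    note gf = equivariant_compose[OF Xr f g]
    have "T1 X Z (compose (pts X) g f) = compose (pts (T0 X)) (T1 Y Z g) (T1 X Y f)"
    proof (rule comparison_maps_eqI[OF \<beta>[OF X] T0c[OF X] T1[OF X Z gf]])
      show "compose (pts (T0 X)) (T1 Y Z g) (T1 X Y f) \<in> equivariant_maps (T0 X) (T0 Z)"
        using T0c[OF X] T1[OF X Y f] T1[OF Y Z g] by (simp add: equivariant_compose)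
      fix r x assume r: "continuous_congruence r" "x \<in> fixed X (omap H r)"
      then show "T1 X Z (compose (pts X) g f) (\<beta> X r x) = compose (pts (T0 X)) (T1 Y Z g) (T1 X Y f) (\<beta> X r x)"
        using fixed_subset[OF comparison_fixed[OF \<beta>[OF X] r]] fixed_subset[OF r(2)]
        by (simp add: compose_def T1_eq[OF X Z gf r] T1_eq[OF X Y f r] T1_eq[OF Y Z g r(1) equivariant_fixed[OF f r(2)]])
          (simp add: T1_eq[OF X Z gf r, unfolded compose_def])
    qed
    then show "amap T X Z (Comp ?C X Y Z g f) = Comp ?D (omap T X) (omap T Y) (omap T Z) (amap T Y Z g) (amap T X Y f)"
      by (simp add: T_def)
  qed
  then show ?thesis by (rule that[of T \<beta>]) (use \<beta> T1_eq in \<open>auto simp: T_def\<close>)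
qed

text \<open>Two points lie in a common set of fixed points, that of the intersection of their
  stabilizers, which gives injectivity; a target point is reached at its own stabilizer.\<close>

lemma bij_betw_fixed_imp_bij_betw:
  assumes X: "continuous_mset X" and Y: "continuous_mset Y" and f: "f \<in> equivariant_maps X Y"
    and bij: "\<And>r. continuous_congruence r \<Longrightarrow> bij_betw f (fixed X r) (fixed Y r)"
  shows "bij_betw f (pts X) (pts Y)"
proof (rule bij_betw_imageI)
  show "inj_on f (pts X)"
  proof (rule inj_onI)
    fix x y assume x: "x \<in> pts X" and y: "y \<in> pts X" and eq: "f x = f y"
    let ?r = "stabilizer X x \<inter> stabilizer X y"
    have "continuous_congruence ?r"
      using continuous_congruence_stabilizer[OF X] x y by (intro continuous_congruence_Int)
    from bij_betw_imp_inj_on[OF bij[OF this]] show "x = y"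
      using x y eq by (auto simp: fixed_iff_stabilizer dest: inj_onD)
  qed
  show "f ` pts X = pts Y"
  proof (intro equalityI subsetI)
    fix y assume y: "y \<in> pts Y"
    have "y \<in> f ` fixed X (stabilizer Y y)"
      using bij_betw_imp_surj_on[OF bij[OF continuous_congruence_stabilizer[OF Y y]]] mem_fixed_stabilizer[OF y]
      by simp
    then obtain x where x: "x \<in> fixed X (stabilizer Y y)" "y = f x" by blast
    then show "y \<in> f ` pts X" using fixed_subset[OF x(1)] by blast
  qed (use f in \<open>auto intro: equivariant_pts\<close>)
qed

text \<open>Fixed points of \<open>S T X\<close> at \<open>r\<close> correspond to those of
  \<open>X\<close> at \<open>G F r\<close>, and the isomorphism \<open>\<theta> r\<close> compares
  these with the fixed points at \<open>r\<close>. Naturality of all three bijections assembles them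
  into an isomorphism of actions.\<close>

lemma comparison_round_trip:
  fixes F :: "('m::topological_monoid_mult rel, 'm set, 'n::topological_monoid_mult rel, 'n set) cat_map"
    and G :: "('n rel, 'n set, 'm rel, 'm set) cat_map" and \<U> :: "'u set set"
  assumes Ff: "is_functor (RCong TYPE('m)) (RCong TYPE('n)) F" and Gf: "is_functor (RCong TYPE('n)) (RCong TYPE('m)) G"
    and \<theta>: "natural_iso (RCong TYPE('m)) (RCong TYPE('m)) (comp_map G F) id_map \<theta>"
    and T: "is_functor (Cont \<U> TYPE('m)) (Cont \<U> TYPE('n)) T"
    and \<beta>: "\<And>X. X \<in> Obj (Cont \<U> TYPE('m)) \<Longrightarrow> comparison G X (omap T X) (\<beta> X)"
    and T_eq: "\<And>X Y f r x. \<lbrakk>X \<in> Obj (Cont \<U> TYPE('m)); Y \<in> Obj (Cont \<U> TYPE('m)); f \<in> equivariant_maps X Y;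
      continuous_congruence r; x \<in> fixed X (omap G r)\<rbrakk> \<Longrightarrow> amap T X Y f (\<beta> X r x) = \<beta> Y r (f x)"
    and S: "is_functor (Cont \<U> TYPE('n)) (Cont \<U> TYPE('m)) S"
    and \<gamma>: "\<And>X. X \<in> Obj (Cont \<U> TYPE('n)) \<Longrightarrow> comparison F X (omap S X) (\<gamma> X)"
    and S_eq: "\<And>X Y f r x. \<lbrakk>X \<in> Obj (Cont \<U> TYPE('n)); Y \<in> Obj (Cont \<U> TYPE('n)); f \<in> equivariant_maps X Y;
      continuous_congruence r; x \<in> fixed X (omap F r)\<rbrakk> \<Longrightarrow> amap S X Y f (\<gamma> X r x) = \<gamma> Y r (f x)"
  shows "\<exists>\<kappa>. natural_iso (Cont \<U> TYPE('m)) (Cont \<U> TYPE('m)) id_map (comp_map S T) \<kappa>"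
proof -
  let ?R = "RCong TYPE('m)" and ?C = "Cont \<U> TYPE('m)" and ?D = "Cont \<U> TYPE('n)"
  have Fr: "continuous_congruence (omap F r)" if "continuous_congruence r" for r
    using functor_obj[OF Ff, of r] that by simp
  have GFr: "continuous_congruence (omap G (omap F r))" if "continuous_congruence r" for r
    using functor_obj[OF Gf, of "omap F r"] Fr[OF that] by simp
  have \<theta>i: "iso_arrow ?R (omap G (omap F r)) r (\<theta> r)" if "continuous_congruence r" for r
    using natural_isoD(1)[OF \<theta>, of r] that by simp
  define \<alpha> where "\<alpha> = (\<lambda>X r x. \<gamma> (omap T X) r (\<beta> X (omap F r) (class_act X x (\<theta> r))))"
  have \<alpha>_bij: "bij_betw (\<alpha> X r) (fixed X r) (fixed (omap S (omap T X)) r)"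
    if X: "X \<in> Obj ?C" and r: "continuous_congruence r" for X r
  proof -
    have Xr: "right_mset X" using X by simp
    have "bij_betw (\<gamma> (omap T X) r \<circ> (\<beta> X (omap F r) \<circ> (\<lambda>x. class_act X x (\<theta> r)))) (fixed X r)
        (fixed (omap S (omap T X)) r)"
      using bij_betw_class_act[OF Xr GFr[OF r] r \<theta>i[OF r]] comparison_bij[OF \<beta>[OF X] Fr[OF r]]
        comparison_bij[OF \<gamma>[OF functor_obj[OF T X]] r] by (blast intro: bij_betw_trans)
    then show ?thesis by (simp add: \<alpha>_def comp_def)
  qed
  have ex: "\<exists>k. X \<in> Obj ?C \<longrightarrow> k \<in> equivariant_maps X (omap S (omap T X)) \<and>
      (\<forall>r x. continuous_congruence r \<longrightarrow> x \<in> fixed X r \<longrightarrow> k x = \<alpha> X r x)" for X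
  proof (cases "X \<in> Obj ?C")
    case X: True
    then have Xc: "continuous_mset X" and Xr: "right_mset X" by auto
    note TX = functor_obj[OF T X] and STX = functor_obj[OF S functor_obj[OF T X]]
    have "\<exists>k\<in>equivariant_maps X (omap S (omap T X)). \<forall>r x. continuous_congruence r \<longrightarrow> x \<in> fixed X r \<longrightarrow> k x = \<alpha> X r x"
    proof (rule fixed_natural_extends[OF Xc])
      show "continuous_mset (omap S (omap T X))" using STX by simp
      fix r x assume "continuous_congruence r" "x \<in> fixed X r"
      then show "\<alpha> X r x \<in> fixed (omap S (omap T X)) r" using bij_betwE[OF \<alpha>_bij[OF X]] by blast
    next
      fix r s m x assume r: "continuous_congruence r" and s: "continuous_congruence s"
        and m: "r \<subseteq> pullback_rel m s" and x: "x \<in> fixed X s"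
      have c: "s `` {m} \<in> Hom ?R r s" using m by auto
      have Fc: "amap F r s (s `` {m}) \<in> Hom (RCong TYPE('n)) (omap F r) (omap F s)"
        using functor_hom[OF Ff _ _ c] r s by simp
      have GFc: "amap G (omap F r) (omap F s) (amap F r s (s `` {m})) \<in> Hom ?R (omap G (omap F r)) (omap G (omap F s))"
        using functor_hom[OF Gf _ _ Fc] Fr r s by simp
      let ?y = "class_act X x (\<theta> s)"
      note \<theta>h = iso_arrow_in_hom[OF \<theta>i[OF r]] iso_arrow_in_hom[OF \<theta>i[OF s]]
      have y: "?y \<in> fixed X (omap G (omap F s))" using class_act_in_fixed[OF Xr s \<theta>h(2) x] .
      have "class_act X (act X x m) (\<theta> r) = class_act X (class_act X x (s `` {m})) (\<theta> r)"
        using class_act_eq[OF x] s by simp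
      also have "\<dots> = class_act X x (Comp ?R (omap G (omap F r)) r s (s `` {m}) (\<theta> r))"
        using class_act_comp[OF Xr r s \<theta>h(1) c x] .
      also have "\<dots> = class_act X x (Comp ?R (omap G (omap F r)) (omap G (omap F s)) s (\<theta> s)
          (amap G (omap F r) (omap F s) (amap F r s (s `` {m}))))"
        using natural_isoD(2)[OF \<theta> _ _ c] r s by simp
      also have "\<dots> = class_act X ?y (amap G (omap F r) (omap F s) (amap F r s (s `` {m})))"
        using class_act_comp[OF Xr GFr[OF s] s GFc \<theta>h(2) x] by simp
      finally have "\<alpha> X r (act X x m) = \<gamma> (omap T X) r (class_act (omap T X) (\<beta> X (omap F s) ?y) (amap F r s (s `` {m})))"
        using comparison_natural[OF \<beta>[OF X] Fr[OF r] Fr[OF s] Fc y] by (simp add: \<alpha>_def)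
      also have "\<dots> = class_act (omap S (omap T X)) (\<alpha> X s x) (s `` {m})"
        using comparison_natural[OF \<gamma>[OF TX] r s c comparison_fixed[OF \<beta>[OF X] Fr[OF s] y]] by (simp add: \<alpha>_def)
      also have "\<dots> = act (omap S (omap T X)) (\<alpha> X s x) m"
        using class_act_eq[of "\<alpha> X s x" _ s m] bij_betwE[OF \<alpha>_bij[OF X s]] x s by simp
      finally show "\<alpha> X r (act X x m) = act (omap S (omap T X)) (\<alpha> X s x) m" .
    qed
    then show ?thesis by blast
  qed auto
  obtain \<kappa> where "\<forall>X. X \<in> Obj ?C \<longrightarrow> \<kappa> X \<in> equivariant_maps X (omap S (omap T X)) \<and>
      (\<forall>r x. continuous_congruence r \<longrightarrow> x \<in> fixed X r \<longrightarrow> \<kappa> X x = \<alpha> X r x)"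
    using ex by metis
  then have \<kappa>: "\<kappa> X \<in> equivariant_maps X (omap S (omap T X))"
    and \<kappa>_eq: "\<And>r x. \<lbrakk>continuous_congruence r; x \<in> fixed X r\<rbrakk> \<Longrightarrow> \<kappa> X x = \<alpha> X r x" if "X \<in> Obj ?C" for X
    using that by blast+
  have "natural_iso ?C ?C id_map (comp_map S T) \<kappa>"
    unfolding natural_iso_def
  proof (intro conjI ballI)
    fix X assume X: "X \<in> Obj ?C"
    have Xc: "continuous_mset X" "continuous_mset (omap S (omap T X))"
      using X functor_obj[OF S functor_obj[OF T X]] by auto
    have "bij_betw (\<kappa> X) (pts X) (pts (omap S (omap T X)))"
    proof (rule bij_betw_fixed_imp_bij_betw[OF Xc \<kappa>[OF X]])
      fix r :: "'m rel" assume r: "continuous_congruence r"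
      show "bij_betw (\<kappa> X) (fixed X r) (fixed (omap S (omap T X)) r)"
        using \<alpha>_bij[OF X r] \<kappa>_eq[OF X r] by (simp cong: bij_betw_cong)
    qed
    then show "iso_arrow ?C (omap id_map X) (omap (comp_map S T) X) (\<kappa> X)"
      using iso_arrow_Cont[OF X \<kappa>[OF X]] by simp
  next
    fix X Y f assume X: "X \<in> Obj ?C" and Y: "Y \<in> Obj ?C" and "f \<in> Hom ?C X Y"
    then have f: "f \<in> equivariant_maps X Y" by simp
    have Xc: "continuous_mset X" and Xr: "right_mset X" using X by auto
    note TX = functor_obj[OF T X] and TY = functor_obj[OF T Y]
    have Tf: "amap T X Y f \<in> equivariant_maps (omap T X) (omap T Y)" using functor_hom[OF T X Y] f by simp
    have "\<kappa> Y (f x) = amap S (omap T X) (omap T Y) (amap T X Y f) (\<kappa> X x)" if xp: "x \<in> pts X" for x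
    proof -
      let ?r = "stabilizer X x"
      note r = continuous_congruence_stabilizer[OF Xc xp] and x = mem_fixed_stabilizer[OF xp]
      let ?y = "class_act X x (\<theta> ?r)"
      have y: "?y \<in> fixed X (omap G (omap F ?r))"
        using class_act_in_fixed[OF Xr r iso_arrow_in_hom[OF \<theta>i[OF r]] x] .
      have "\<kappa> Y (f x) = \<gamma> (omap T Y) ?r (\<beta> Y (omap F ?r) (f ?y))"
        using \<kappa>_eq[OF Y r equivariant_fixed[OF f x]] equivariant_class_act[OF f xp] by (simp add: \<alpha>_def)
      also have "\<dots> = \<gamma> (omap T Y) ?r (amap T X Y f (\<beta> X (omap F ?r) ?y))"
        using T_eq[OF X Y f Fr[OF r] y] by simp
      also have "\<dots> = amap S (omap T X) (omap T Y) (amap T X Y f) (\<gamma> (omap T X) ?r (\<beta> X (omap F ?r) ?y))"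
        using S_eq[OF TX TY Tf r comparison_fixed[OF \<beta>[OF X] Fr[OF r] y]] by simp
      finally show ?thesis using \<kappa>_eq[OF X r x] by (simp add: \<alpha>_def)
    qed
    then show "Comp ?C (omap id_map X) (omap id_map Y) (omap (comp_map S T) Y) (\<kappa> Y) (amap id_map X Y f) =
        Comp ?C (omap id_map X) (omap (comp_map S T) X) (omap (comp_map S T) Y) (amap (comp_map S T) X Y f) (\<kappa> X)"
      by (auto simp: compose_def)
  qed
  then show ?thesis by blast
qed

lemma RCong_equivalent_imp_Cont_equivalent:
  fixes \<U> :: "'u set set"
  assumes U: "set_universe \<U>" and small: "small \<U> (UNIV :: 'm::topological_monoid_mult set)"
    "small \<U> (UNIV :: 'n::topological_monoid_mult set)"
    and eq: "RCong TYPE('m) \<simeq>\<^sub>c RCong TYPE('n)"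
  shows "Cont \<U> TYPE('m) \<simeq>\<^sub>c Cont \<U> TYPE('n)"
proof -
  let ?R = "RCong TYPE('m)" and ?Q = "RCong TYPE('n)"
  obtain F G \<eta> \<epsilon> where Ff: "is_functor ?R ?Q F" and Gf: "is_functor ?Q ?R G"
    and \<eta>: "natural_iso ?R ?R id_map (comp_map G F) \<eta>" and \<epsilon>: "natural_iso ?Q ?Q (comp_map F G) id_map \<epsilon>"
    using eq unfolding equivalent_cats_def by blast
  obtain \<eta>' where \<eta>': "natural_iso ?R ?R (comp_map G F) id_map \<eta>'"
    using natural_iso_inverse[OF category_RCong is_functor_id_map is_functor_comp_map[OF Ff Gf] \<eta>] .
  obtain \<epsilon>' where \<epsilon>': "natural_iso ?Q ?Q id_map (comp_map F G) \<epsilon>'"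
    using natural_iso_inverse[OF category_RCong is_functor_comp_map[OF Gf Ff] is_functor_id_map \<epsilon>] .
  have F: "weak_equivalence ?R ?Q F"
    using weak_equivalence_of_natural_isos[OF category_RCong category_RCong Ff Gf \<eta> \<epsilon>] .
  have G: "weak_equivalence ?Q ?R G"
    using weak_equivalence_of_natural_isos[OF category_RCong category_RCong Gf Ff \<epsilon>' \<eta>'] .
  \<comment> \<open>Precomposition reverses direction: actions of the first monoid are carried over
    by \<open>G\<close>, which leads back to its congruences.\<close>
  obtain T \<beta> where T: "is_functor (Cont \<U> TYPE('m)) (Cont \<U> TYPE('n)) T"
    "\<And>X. X \<in> Obj (Cont \<U> TYPE('m)) \<Longrightarrow> comparison G X (omap T X) (\<beta> X)"
    "\<And>X Y f r x. \<lbrakk>X \<in> Obj (Cont \<U> TYPE('m)); Y \<in> Obj (Cont \<U> TYPE('m)); f \<in> equivariant_maps X Y;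
      continuous_congruence r; x \<in> fixed X (omap G r)\<rbrakk> \<Longrightarrow> amap T X Y f (\<beta> X r x) = \<beta> Y r (f x)"
    by (rule comparison_functor_exists[OF U small(2) G]) blast
  obtain S \<gamma> where S: "is_functor (Cont \<U> TYPE('n)) (Cont \<U> TYPE('m)) S"
    "\<And>X. X \<in> Obj (Cont \<U> TYPE('n)) \<Longrightarrow> comparison F X (omap S X) (\<gamma> X)"
    "\<And>X Y f r x. \<lbrakk>X \<in> Obj (Cont \<U> TYPE('n)); Y \<in> Obj (Cont \<U> TYPE('n)); f \<in> equivariant_maps X Y;
      continuous_congruence r; x \<in> fixed X (omap F r)\<rbrakk> \<Longrightarrow> amap S X Y f (\<gamma> X r x) = \<gamma> Y r (f x)"
    by (rule comparison_functor_exists[OF U small(1) F]) blast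
  obtain \<kappa> where \<kappa>: "natural_iso (Cont \<U> TYPE('m)) (Cont \<U> TYPE('m)) id_map (comp_map S T) \<kappa>"
    using comparison_round_trip[OF Ff Gf \<eta>' T S] by blast
  obtain \<mu> where \<mu>: "natural_iso (Cont \<U> TYPE('n)) (Cont \<U> TYPE('n)) id_map (comp_map T S) \<mu>"
    using comparison_round_trip[OF Gf Ff \<epsilon> S T] by blast
  obtain \<mu>' where "natural_iso (Cont \<U> TYPE('n)) (Cont \<U> TYPE('n)) (comp_map T S) id_map \<mu>'"
    using natural_iso_inverse[OF category_Cont is_functor_id_map is_functor_comp_map[OF S(1) T(1)] \<mu>] .
  with \<kappa> T(1) S(1) show ?thesis
    unfolding equivalent_cats_def
    by (intro conjI category_Cont exI[of _ T] exI[of _ S] exI[of _ \<kappa>] exI[of _ \<mu>'])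
qed

theorem mainTheorem9:
  fixes \<U> :: "'u set set"
  assumes "set_universe \<U>"
    and "small \<U> (UNIV :: 'm::topological_monoid_mult set)"
    and "small \<U> (UNIV :: 'n::topological_monoid_mult set)"
  shows "RCong TYPE('m) \<simeq>\<^sub>c supercompact_objects (Cont \<U> TYPE('m)) \<and>
    (Cont \<U> TYPE('m) \<simeq>\<^sub>c Cont \<U> TYPE('n) \<longleftrightarrow> RCong TYPE('m) \<simeq>\<^sub>c RCong TYPE('n))"
proof (intro conjI iffI)
  note Rm = RCong_equivalent_supercompact[OF assms(1,2)] and Rn = RCong_equivalent_supercompact[OF assms(1,3)]
  show "RCong TYPE('m) \<simeq>\<^sub>c supercompact_objects (Cont \<U> TYPE('m))" by (rule Rm)
  assume "Cont \<U> TYPE('m) \<simeq>\<^sub>c Cont \<U> TYPE('n)"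
  from equivalent_cats_trans[OF equivalent_cats_trans[OF Rm equivalent_cats_supercompact[OF this]]
      equivalent_cats_sym[OF Rn]]
  show "RCong TYPE('m) \<simeq>\<^sub>c RCong TYPE('n)" .
next
  assume "RCong TYPE('m) \<simeq>\<^sub>c RCong TYPE('n)"
  with assms show "Cont \<U> TYPE('m) \<simeq>\<^sub>c Cont \<U> TYPE('n)" by (rule RCong_equivalent_imp_Cont_equivalent)
qed

end
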